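(* Let $H$ be a Hopf algebra with invertible antipode, $B$ a $\sigma$-twisted left $H$-module algebra, $(\Omega^\bullet(B),\mathrm{d}_B)$ a $\sigma$-twisted $H$-module DC on $B$ and $(\Omega^\bullet(H),\mathrm{d}_H)$ a DC on $H$ with respect to which $\Delta:H\to H\otimes H$ is differentiable. Let $(\Omega^\bullet(B\#_\sigma H),\mathrm{d}_{\#_\sigma})$ be the crossed product DC. Then the sequence $$0\longrightarrow\Omega^1(B)\wedge\Omega^{n-1}(B\#_\sigma H)\overset{i}{\longrightarrow}\Omega^n(B\#_\sigma H)\overset{\mathrm{ver}^{0,n}}{\longrightarrow}(B\#_\sigma H)\otimes{}^{\mathrm{co}H}\Omega^n(H)\longrightarrow0,$$ where $i$ is the inclusion, is exact for all $n>0$.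
   Context: Everything is over a field $\Bbbk$; algebras are associative and unital; Sweedler notation $\Delta(h)=h_1\otimes h_2$. $B$ is a $\sigma$-twisted left $H$-module algebra: there are a linear map $\cdot:H\otimes B\to B$ (a measure) with $h\cdot 1_B=\varepsilon(h)1_B$, $h\cdot(bb')=(h_1\cdot b)(h_2\cdot b')$, and a convolution invertible linear map $\sigma:H\otimes H\to B$ with convolution inverse $\sigma^{-1}$, such that $1_H\cdot b=b$, $h\cdot(h'\cdot b)=\sigma(h_1\otimes h'_1)(h_2h'_2\cdot b)\sigma^{-1}(h_3\otimes h'_3)$, $\sigma(h\otimes1_H)=\varepsilon(h)1_B=\sigma(1_H\otimes h)$ and $(h_1\cdot\sigma(h'_1\otimes h''_1))\sigma(h_2\otimes h'_2h''_2)=\sigma(h_1\otimes h'_1)\sigma(h_2h'_2\otimes h'')$. The crossed product algebra $B\#_\sigma H$ is $B\otimes H$ with unit $1_B\otimes1_H$ and product $(b\otimes h)(b'\otimes h')=b(h_1\cdot b')\sigma(h_2\otimes h'_1)\otimes h_3h'_2$. A differential calculus (DC) on an algebra $A$ is an $\mathbb N$-graded differential graded algebra $(\Omega^\bullet(A),\wedge,\mathrm{d})$ with $\Omega^0(A)=A$ such that $\Omega^n(A)$ is spanned by the elements $a^0\mathrm{d}a^1\wedge\cdots\wedge\mathrm{d}a^n$. An algebra map $f:A\to A'$ between algebras with DCi is differentiable if it extends to a (unique) morphism of differential graded algebras $\Omega^\bullet(f)$. $H\otimes H$ carries the graded tensor product DC $\Omega^n(H\otimes H)=\bigoplus_{k}\Omega^k(H)\otimes\Omega^{n-k}(H)$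 (Koszul signs). If $\Delta$ is differentiable, for $\gamma\in\Omega^n(H)$ the component of $\Omega^\bullet(\Delta)(\gamma)$ in $H\otimes\Omega^n(H)$ is the left $H$-coaction $\gamma\mapsto\gamma_{-1}\otimes\gamma_0$; $\gamma_{-2}\otimes\gamma_{-1}\otimes\gamma_0$ is the iterated left coaction and ${}^{\mathrm{co}H}\Omega^n(H)=\{\gamma\in\Omega^n(H):\gamma_{-1}\otimes\gamma_0=1_H\otimes\gamma\}$. A DC $(\Omega^\bullet(B),\mathrm{d}_B)$ is a $\sigma$-twisted $H$-module DC if there are linear maps $\cdot:H\otimes\Omega^n(B)\to\Omega^n(B)$, $n\ge1$, with $h\cdot(b^0\mathrm{d}_Bb^1\wedge\cdots\wedge\mathrm{d}_Bb^n)=(h_1\cdot b^0)(h_2\cdot\mathrm{d}_Bb^1)\wedge\cdots\wedge(h_{n+1}\cdot\mathrm{d}_Bb^n)$, $h\cdot\mathrm{d}_Bb=\mathrm{d}_B(h\cdot b)$ and $\mathrm{d}_B\circ\sigma=0$. The crossed product DC on $B\#_\sigma H$ is $\Omega^n(B\#_\sigma H)=\bigoplus_{i=0}^n\Omega^{n-i}(B)\otimes\Omega^i(H)$ with $(\omega\otimes\gamma)\wedge(\omega'\otimes\gamma')=(-1)^{jk}(\omega\wedge(\gamma_{-2}\cdot\omega')\sigma(\gamma_{-1}\otimes\gamma'_{-1}))\otimes(\gamma_0\wedge\gamma'_0)$ and $\mathrm{d}_{\#_\sigma}(\omega\otimes\gamma)=\mathrm{d}_B\omega\otimes\gamma+(-1)^i\omega\otimes\mathrm{d}_H\gamma$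 for $\omega\in\Omega^i(B)$, $\gamma\in\Omega^j(H)$, $\omega'\in\Omega^k(B)$. $\Omega^1(B)$ is regarded inside $\Omega^1(B\#_\sigma H)$ as $\Omega^1(B)\otimes\Bbbk1_H$, and $\Omega^1(B)\wedge\Omega^{n-1}(B\#_\sigma H)$ is the span of products. For $n>0$ the vertical map $\mathrm{ver}^{0,n}:\Omega^n(B\#_\sigma H)\to(B\#_\sigma H)\otimes{}^{\mathrm{co}H}\Omega^n(H)$ vanishes on the summands $\Omega^{n-i}(B)\otimes\Omega^i(H)$ with $i<n$ and is given on $B\otimes\Omega^n(H)$ by $b\otimes\gamma\mapsto b\otimes\gamma_{-2}\otimes S(\gamma_{-1})\gamma_0$. *)

theory Defs
  imports "HOL-Library.Function_Algebras" "HOL.Vector_Spaces"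
begin

section \<open>Linear maps between subspaces\<close>

text \<open>
  A vector space over a field is a subspace of a type equipped with a scaling, so that the
  homogeneous components of a graded space live in one type. Functions are only constrained on the
  subspaces they are declared on.
\<close>

definition linear_map ::
  "('k::field \<Rightarrow> 'v::ab_group_add \<Rightarrow> 'v) \<Rightarrow> ('k \<Rightarrow> 'w::ab_group_add \<Rightarrow> 'w) \<Rightarrow>
    'v set \<Rightarrow> 'w set \<Rightarrow> ('v \<Rightarrow> 'w) \<Rightarrow> bool" where
  "linear_map sV sW V W f \<longleftrightarrow>
     (\<forall>x\<in>V. f x \<in> W) \<and>
     (\<forall>x\<in>V. \<forall>y\<in>V. f (x + y) = f x + f y) \<and>
     (\<forall>c. \<forall>x\<in>V. f (sV c x) = sW c (f x))"

definition bilinear_map ::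
  "('k::field \<Rightarrow> 'v::ab_group_add \<Rightarrow> 'v) \<Rightarrow> ('k \<Rightarrow> 'w::ab_group_add \<Rightarrow> 'w) \<Rightarrow>
    ('k \<Rightarrow> 'u::ab_group_add \<Rightarrow> 'u) \<Rightarrow>
    'v set \<Rightarrow> 'w set \<Rightarrow> 'u set \<Rightarrow> ('v \<Rightarrow> 'w \<Rightarrow> 'u) \<Rightarrow> bool" where
  "bilinear_map sV sW sU V W U f \<longleftrightarrow>
     (\<forall>x\<in>V. linear_map sW sU W U (f x)) \<and>
     (\<forall>y\<in>W. linear_map sV sU V U (\<lambda>x. f x y))"

definition short_exact ::
  "('k::field \<Rightarrow> 'u::ab_group_add \<Rightarrow> 'u) \<Rightarrow> ('k \<Rightarrow> 'v::ab_group_add \<Rightarrow> 'v) \<Rightarrow>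
    ('k \<Rightarrow> 'w::ab_group_add \<Rightarrow> 'w) \<Rightarrow>
    'u set \<Rightarrow> ('u \<Rightarrow> 'v) \<Rightarrow> 'v set \<Rightarrow> ('v \<Rightarrow> 'w) \<Rightarrow> 'w set \<Rightarrow> bool" where
  "short_exact sU sV sW U f V g W \<longleftrightarrow>
     module.subspace sU U \<and> module.subspace sV V \<and> module.subspace sW W \<and>
     linear_map sU sV U V f \<and> linear_map sV sW V W g \<and>
     inj_on f U \<and> f ` U = {v \<in> V. g v = 0} \<and> g ` V = W"


section \<open>Tensor products\<close>

text \<open>
  The pure tensor of \<open>v\<close> and \<open>w\<close> is realised as evaluation at \<open>(v, w)\<close> on bilinear forms, and the
  tensor product of two subspaces as the span of their pure tensors. Over a field this is the usual
  tensor product: the lemmas \<open>tensor_lift_sum\<close> and \<open>tensor_universal\<close> below give its universal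
  property, also for proper subspaces, because tensor products over a field preserve injections.
\<close>

type_synonym ('v, 'w, 'k) tensor = "('v \<Rightarrow> 'w \<Rightarrow> 'k) \<Rightarrow> 'k"

definition tscale :: "'k::field \<Rightarrow> ('v, 'w, 'k) tensor \<Rightarrow> ('v, 'w, 'k) tensor" where
  "tscale c t = (\<lambda>f. c * t f)"

definition tensor ::
  "('k::field \<Rightarrow> 'v::ab_group_add \<Rightarrow> 'v) \<Rightarrow> ('k \<Rightarrow> 'w::ab_group_add \<Rightarrow> 'w) \<Rightarrow>
    'v \<Rightarrow> 'w \<Rightarrow> ('v, 'w, 'k) tensor" where
  "tensor sV sW v w = (\<lambda>f. if bilinear_map sV sW (*) UNIV UNIV UNIV f then f v w else 0)"

definition tensor_space ::
  "('k::field \<Rightarrow> 'v::ab_group_add \<Rightarrow> 'v) \<Rightarrow> ('k \<Rightarrow> 'w::ab_group_add \<Rightarrow> 'w) \<Rightarrow>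
    'v set \<Rightarrow> 'w set \<Rightarrow> ('v, 'w, 'k) tensor set" where
  "tensor_space sV sW V W = module.span tscale {tensor sV sW v w | v w. v \<in> V \<and> w \<in> W}"

text \<open>
  \<open>tensor_lift sV sW V W g\<close> is the linear map on the tensor product of \<open>V\<close> and \<open>W\<close> induced by a
  bilinear map \<open>g\<close>: write \<open>t\<close> as a sum of pure tensors of elements of \<open>V\<close> and \<open>W\<close> and apply \<open>g\<close> to
  the summands.
\<close>

definition tensor_lift ::
  "('k::field \<Rightarrow> 'v::ab_group_add \<Rightarrow> 'v) \<Rightarrow> ('k \<Rightarrow> 'w::ab_group_add \<Rightarrow> 'w) \<Rightarrow>
    'v set \<Rightarrow> 'w set \<Rightarrow> ('v \<Rightarrow> 'w \<Rightarrow> 'u::ab_group_add) \<Rightarrow> ('v, 'w, 'k) tensor \<Rightarrow> 'u" where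
  "tensor_lift sV sW V W g t =
     (THE u. \<exists>ps. set ps \<subseteq> V \<times> W \<and> t = (\<Sum>(v, w)\<leftarrow>ps. tensor sV sW v w) \<and>
                  u = (\<Sum>(v, w)\<leftarrow>ps. g v w))"

lemma vector_space_tscale: "vector_space (tscale :: 'k::field \<Rightarrow> ('v, 'w, 'k) tensor \<Rightarrow> _)"
  by unfold_locales (auto simp: tscale_def fun_eq_iff algebra_simps)


lemma linear_mapD: assumes "linear_map sV sW V W f"
  shows "x\<in>V \<Longrightarrow> f x \<in> W" "x\<in>V \<Longrightarrow> y\<in>V \<Longrightarrow> f (x+y) = f x + f y" "x\<in>V \<Longrightarrow> f (sV c x) = sW c (f x)"
  using assms by (auto simp: linear_map_def)

lemma bilinear_tensor:
  fixes sV :: "'k::field \<Rightarrow> 'v::ab_group_add \<Rightarrow> 'v" and sW :: "'k \<Rightarrow> 'w::ab_group_add \<Rightarrow> 'w"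
  shows "bilinear_map sV sW tscale UNIV UNIV UNIV (tensor sV sW)"
  unfolding bilinear_map_def linear_map_def
  by (auto simp: tensor_def tscale_def fun_eq_iff)
    (auto simp: bilinear_map_def linear_map_def)

lemma sum_list_fun: "(\<Sum>p\<leftarrow>ps. F p) f = (\<Sum>p\<leftarrow>ps. F p f)"
  for F :: "'p \<Rightarrow> 'x \<Rightarrow> 'k::ab_group_add"
  by (induction ps) auto

lemma linear_retraction:
  fixes s :: "'k::field \<Rightarrow> 'v::ab_group_add \<Rightarrow> 'v"
  assumes "vector_space s" "module.subspace s V"
  shows "\<exists>p. linear_map s s UNIV V p \<and> (\<forall>x\<in>V. p x = x)"
proof -
  interpret vector_space s by fact
  interpret vector_space_pair s s by unfold_locales
  obtain B where B: "B \<subseteq> V" "independent B" "span B = V"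
    using basis_exists[of V] assms(2) span_subspace by metis
  obtain g where g: "Vector_Spaces.linear s s g" "\<forall>x\<in>B. g x = x" "range g = span B"
    using linear_independent_extend_subspace[OF B(2), of "\<lambda>x. x"] by auto
  interpret g: Vector_Spaces.linear s s g by fact
  have "g x = x" if "x \<in> V" for x
    using that unfolding B(3)[symmetric]
    by (induction rule: span_induct_alt) (auto simp: g.add g.scale g(2) g.zero)
  moreover have "linear_map s s UNIV V g"
    using g(3) B(3) by (auto simp: linear_map_def g.add g.scale)
  ultimately show ?thesis by blast
qed

lemma separating_functional:
  fixes s :: "'k::field \<Rightarrow> 'u::ab_group_add \<Rightarrow> 'u"
  assumes "vector_space s" "u \<noteq> 0"
  shows "\<exists>\<phi>. Vector_Spaces.linear s (*) \<phi> \<and> \<phi> u \<noteq> 0"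
proof -
  interpret vector_space s by fact
  interpret k: vector_space "(*) :: 'k \<Rightarrow> 'k \<Rightarrow> 'k" by unfold_locales (auto simp: algebra_simps)
  interpret vector_space_pair s "(*) :: 'k \<Rightarrow> 'k \<Rightarrow> 'k" by unfold_locales
  have "independent {u}" using assms by simp
  then obtain g where "Vector_Spaces.linear s (*) g" "\<forall>x\<in>{u}. g x = 1"
    using linear_independent_extend[of "{u}" "\<lambda>_. 1"] by blast
  thus ?thesis by (intro exI[of _ g]) auto
qed

lemma tensor_lift_wd:
  fixes sV :: "'k::field \<Rightarrow> 'v::ab_group_add \<Rightarrow> 'v" and sW :: "'k \<Rightarrow> 'w::ab_group_add \<Rightarrow> 'w"
    and sU :: "'k \<Rightarrow> 'u::ab_group_add \<Rightarrow> 'u"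
  assumes V: "vector_space sV" "module.subspace sV V"
    and W: "vector_space sW" "module.subspace sW W"
    and U: "vector_space sU" and g: "bilinear_map sV sW sU V W UNIV g"
    and ps: "set ps \<subseteq> V \<times> W" and qs: "set qs \<subseteq> V \<times> W"
    and eq: "(\<Sum>(v, w)\<leftarrow>ps. tensor sV sW v w) = (\<Sum>(v, w)\<leftarrow>qs. tensor sV sW v w)"
  shows "(\<Sum>(v, w)\<leftarrow>ps. g v w) = (\<Sum>(v, w)\<leftarrow>qs. g v w)"
proof (rule ccontr)
  assume "\<not> ?thesis"
  hence "(\<Sum>(v, w)\<leftarrow>ps. g v w) - (\<Sum>(v, w)\<leftarrow>qs. g v w) \<noteq> 0" by simp
  from separating_functional[OF U this] obtain \<phi> where \<phi>: "Vector_Spaces.linear sU (*) \<phi>"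
    and ne: "\<phi> ((\<Sum>(v, w)\<leftarrow>ps. g v w) - (\<Sum>(v, w)\<leftarrow>qs. g v w)) \<noteq> 0" by blast
  interpret \<phi>: Vector_Spaces.linear sU "(*)" \<phi> by fact
  obtain p where p: "linear_map sV sV UNIV V p" "\<forall>x\<in>V. p x = x" using linear_retraction[OF V] by blast
  obtain q where q: "linear_map sW sW UNIV W q" "\<forall>x\<in>W. q x = x" using linear_retraction[OF W] by blast
  define f where "f = (\<lambda>v w. \<phi> (g (p v) (q w)))"
  have f: "bilinear_map sV sW (*) UNIV UNIV UNIV f"
    using g p(1) q(1) unfolding bilinear_map_def linear_map_def f_def
    by (simp add: \<phi>.add \<phi>.scale)
  have *: "(\<Sum>(v, w)\<leftarrow>rs. tensor sV sW v w) f = \<phi> (\<Sum>(v, w)\<leftarrow>rs. g v w)"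
    if "set rs \<subseteq> V \<times> W" for rs
    using that by (induction rs) (auto simp: tensor_def f \<phi>.add \<phi>.zero, auto simp: f_def p q)
  show False using ne eq *[OF ps] *[OF qs] by (simp add: \<phi>.diff)
qed

lemma tensor_lift_sum:
  fixes sV :: "'k::field \<Rightarrow> 'v::ab_group_add \<Rightarrow> 'v" and sW :: "'k \<Rightarrow> 'w::ab_group_add \<Rightarrow> 'w"
    and sU :: "'k \<Rightarrow> 'u::ab_group_add \<Rightarrow> 'u"
  assumes "vector_space sV" "module.subspace sV V" "vector_space sW" "module.subspace sW W"
    and "vector_space sU" "bilinear_map sV sW sU V W UNIV g" "set ps \<subseteq> V \<times> W"
  shows "tensor_lift sV sW V W g (\<Sum>(v, w)\<leftarrow>ps. tensor sV sW v w) = (\<Sum>(v, w)\<leftarrow>ps. g v w)"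
  unfolding tensor_lift_def
proof (rule the_equality)
  show "\<exists>qs. set qs \<subseteq> V \<times> W \<and>
      (\<Sum>(v, w)\<leftarrow>ps. tensor sV sW v w) = (\<Sum>(v, w)\<leftarrow>qs. tensor sV sW v w) \<and>
      (\<Sum>(v, w)\<leftarrow>ps. g v w) = (\<Sum>(v, w)\<leftarrow>qs. g v w)"
    using assms(7) by (intro exI[of _ ps] conjI refl)
next
  fix u assume "\<exists>qs. set qs \<subseteq> V \<times> W \<and>
      (\<Sum>(v, w)\<leftarrow>ps. tensor sV sW v w) = (\<Sum>(v, w)\<leftarrow>qs. tensor sV sW v w) \<and>
      u = (\<Sum>(v, w)\<leftarrow>qs. g v w)"
  then obtain qs where "set qs \<subseteq> V \<times> W" "u = (\<Sum>(v, w)\<leftarrow>qs. g v w)"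
    "(\<Sum>(v, w)\<leftarrow>ps. tensor sV sW v w) = (\<Sum>(v, w)\<leftarrow>qs. tensor sV sW v w)" by (elim exE conjE)
  thus "u = (\<Sum>(v, w)\<leftarrow>ps. g v w)" using tensor_lift_wd[OF assms] by simp
qed

lemma tensor_space_eq:
  fixes sV :: "'k::field \<Rightarrow> 'v::ab_group_add \<Rightarrow> 'v" and sW :: "'k \<Rightarrow> 'w::ab_group_add \<Rightarrow> 'w"
  assumes "vector_space sV" "module.subspace sV V"
  shows "tensor_space sV sW V W = {\<Sum>(v, w)\<leftarrow>ps. tensor sV sW v w | ps. set ps \<subseteq> V \<times> W}" (is "_ = ?R")
proof
  interpret V: vector_space sV by fact
  interpret T: vector_space "tscale :: 'k \<Rightarrow> ('v, 'w, 'k) tensor \<Rightarrow> _" by (rule vector_space_tscale)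
  show "tensor_space sV sW V W \<subseteq> ?R"
  proof
    fix t assume "t \<in> tensor_space sV sW V W"
    thus "t \<in> ?R" unfolding tensor_space_def
    proof (induction rule: T.span_induct_alt)
      case base show ?case by (auto intro!: exI[of _ "[]"])
    next
      case (step c x y)
      then obtain v w ps where x: "x = tensor sV sW v w" "v \<in> V" "w \<in> W"
        and y: "y = (\<Sum>(v, w)\<leftarrow>ps. tensor sV sW v w)" "set ps \<subseteq> V \<times> W" by blast
      have "tscale c x = tensor sV sW (sV c v) w"
        using bilinear_tensor[of sV sW] x by (auto simp: bilinear_map_def linear_map_def)
      moreover have "sV c v \<in> V" using x assms(2) V.subspace_scale by blast
      ultimately show ?case using x y by (auto intro!: exI[of _ "(sV c v, w) # ps"])
    qed
  qed
  show "?R \<subseteq> tensor_space sV sW V W"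
  proof safe
    fix ps assume "set ps \<subseteq> V \<times> W"
    thus "(\<Sum>(v, w)\<leftarrow>ps. tensor sV sW v w) \<in> tensor_space sV sW V W"
    unfolding tensor_space_def
      proof (induction ps)
      case Nil show ?case using T.span_zero by (simp add: zero_fun_def)
    next
      case (Cons a ps)
      obtain v w where a: "a = (v, w)" "v \<in> V" "w \<in> W" using Cons.prems by (cases a) auto
      have "tensor sV sW v w + (\<Sum>(v, w)\<leftarrow>ps. tensor sV sW v w)
          \<in> T.span {tensor sV sW v w | v w. v \<in> V \<and> w \<in> W}"
        by (rule T.span_add) (use Cons a in \<open>auto intro: T.span_base\<close>)
      thus ?case by (simp only: a list.map sum_list.Cons prod.case)
    qed
  qed
qed

lemma tensor_universal:
  fixes sV :: "'k::field \<Rightarrow> 'v::ab_group_add \<Rightarrow> 'v" and sW :: "'k \<Rightarrow> 'w::ab_group_add \<Rightarrow> 'w"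
    and sU :: "'k \<Rightarrow> 'u::ab_group_add \<Rightarrow> 'u"
  assumes V: "vector_space sV" "module.subspace sV V"
    and W: "vector_space sW" "module.subspace sW W"
    and U: "vector_space sU" and g: "bilinear_map sV sW sU V W UNIV g"
  shows "linear_map tscale sU (tensor_space sV sW V W) UNIV (tensor_lift sV sW V W g)"
    and "v \<in> V \<Longrightarrow> w \<in> W \<Longrightarrow> tensor_lift sV sW V W g (tensor sV sW v w) = g v w"
    and "linear_map tscale sU (tensor_space sV sW V W) UNIV G \<Longrightarrow>
      (\<And>v w. v \<in> V \<Longrightarrow> w \<in> W \<Longrightarrow> G (tensor sV sW v w) = g v w) \<Longrightarrow>
      t \<in> tensor_space sV sW V W \<Longrightarrow> G t = tensor_lift sV sW V W g t"
proof -
  interpret V: vector_space sV by fact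
  interpret U: vector_space sU by fact
  interpret T: vector_space "tscale :: 'k \<Rightarrow> ('v, 'w, 'k) tensor \<Rightarrow> _" by (rule vector_space_tscale)
  note L = tensor_lift_sum[OF assms]
  note E = tensor_space_eq[OF V, of sW W]
  show "linear_map tscale sU (tensor_space sV sW V W) UNIV (tensor_lift sV sW V W g)"
    unfolding linear_map_def
  proof (intro conjI ballI allI)
    fix x y assume "x \<in> tensor_space sV sW V W" "y \<in> tensor_space sV sW V W"
    then obtain ps qs where "x = (\<Sum>(v, w)\<leftarrow>ps. tensor sV sW v w)" "set ps \<subseteq> V \<times> W"
      "y = (\<Sum>(v, w)\<leftarrow>qs. tensor sV sW v w)" "set qs \<subseteq> V \<times> W" unfolding E by blast
    thus "tensor_lift sV sW V W g (x + y) = tensor_lift sV sW V W g x + tensor_lift sV sW V W g y"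
      using L[of ps] L[of qs] L[of "ps @ qs"] by simp
  next
    fix c x assume "x \<in> tensor_space sV sW V W"
    then obtain ps where ps: "x = (\<Sum>(v, w)\<leftarrow>ps. tensor sV sW v w)" "set ps \<subseteq> V \<times> W"
      unfolding E by blast
    define qs where "qs = map (\<lambda>(v, w). (sV c v, w)) ps"
    have qs: "set qs \<subseteq> V \<times> W" using ps(2) assms(2) V.subspace_scale by (auto simp: qs_def)
    have "(\<Sum>(v, w)\<leftarrow>qs. tensor sV sW v w) = tscale c x"
      unfolding ps(1) qs_def using bilinear_tensor[of sV sW]
      by (induction ps) (auto simp: T.scale_right_distrib bilinear_map_def linear_map_def)
    moreover have "(\<Sum>(v, w)\<leftarrow>qs. g v w) = sU c (\<Sum>(v, w)\<leftarrow>ps. g v w)"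
      using ps(2) unfolding qs_def using g
      by (induction ps) (auto simp: U.scale_right_distrib bilinear_map_def linear_map_def)
    ultimately show "tensor_lift sV sW V W g (tscale c x) = sU c (tensor_lift sV sW V W g x)"
      using L[OF qs] L[OF ps(2)] ps(1) by simp
  qed simp
  show "tensor_lift sV sW V W g (tensor sV sW v w) = g v w" if "v \<in> V" "w \<in> W"
    using L[of "[(v, w)]"] that by simp
  show "G t = tensor_lift sV sW V W g t"
    if G: "linear_map tscale sU (tensor_space sV sW V W) UNIV G"
      "\<And>v w. v \<in> V \<Longrightarrow> w \<in> W \<Longrightarrow> G (tensor sV sW v w) = g v w"
      and t: "t \<in> tensor_space sV sW V W"
  proof -
    obtain ps where ps: "t = (\<Sum>(v, w)\<leftarrow>ps. tensor sV sW v w)" "set ps \<subseteq> V \<times> W"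
      using t unfolding E by blast
    have S: "(\<Sum>(v, w)\<leftarrow>rs. tensor sV sW v w) \<in> tensor_space sV sW V W" if "set rs \<subseteq> V \<times> W" for rs
      using that unfolding E by blast
    have P: "tensor sV sW v w \<in> tensor_space sV sW V W" if "v \<in> V" "w \<in> W" for v w
      using that S[of "[(v, w)]"] by simp
    have "G (tscale 0 0) = sU 0 (G 0)"
      by (rule linear_mapD(3)[OF G(1)]) (use S[of "[]"] in simp)
    moreover have "tscale 0 (0 :: ('v, 'w, 'k) tensor) = 0" by (rule T.scale_zero_left)
    ultimately have G0: "G 0 = 0" by (simp only: U.scale_zero_left)
    have "G (\<Sum>(v, w)\<leftarrow>ps. tensor sV sW v w) = (\<Sum>(v, w)\<leftarrow>ps. g v w)"
      using ps(2)
    proof (induction ps)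
      case (Cons a ps)
      obtain v w where a: "a = (v, w)" "v \<in> V" "w \<in> W" using Cons.prems by (cases a) auto
      show ?case using linear_mapD(2)[OF G(1) P S, of v w ps] Cons G(2)[OF a(2,3)] a
        by (simp only: list.map sum_list.Cons prod.case list.set insert_subset)
    qed (simp add: G0)
    thus ?thesis using L ps by simp
  qed
qed


section \<open>Algebras and Hopf algebras\<close>

text \<open>
  A unital associative algebra is a unital subalgebra \<open>A\<close> of a type-level algebra, so that
  \<open>\<Omega>\<^sup>0(A) = A\<close> can be literally true. The sort \<open>{ring, monoid_mult}\<close>, unlike \<open>ring_1\<close>, does not
  exclude the zero algebra.
\<close>

locale k_algebra = vector_space s
  for s :: "'k::field \<Rightarrow> 'a::{ring, monoid_mult} \<Rightarrow> 'a" +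
  fixes A :: "'a set"
  assumes scale_mult_left: "s c (x * y) = s c x * y"
    and scale_mult_right: "s c (x * y) = x * s c y"
    and subspace_A: "subspace A"
    and one_A: "1 \<in> A"
    and mult_A: "x \<in> A \<Longrightarrow> y \<in> A \<Longrightarrow> x * y \<in> A"

text \<open>
  \<open>sweedler2 f h\<close> is the value of \<open>f h\<^sub>1 h\<^sub>2\<close>, and \<open>sweedler3 f h\<close> that of \<open>f h\<^sub>1 h\<^sub>2 h\<^sub>3\<close>, with
  summation understood; \<open>f\<close> is multilinear on \<open>H\<close>.
\<close>

locale coproduct =
  fixes sH :: "'k::field \<Rightarrow> 'h::{ring, monoid_mult} \<Rightarrow> 'h"
    and H :: "'h set"
    and \<Delta> :: "'h \<Rightarrow> ('h, 'h, 'k) tensor"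
begin

abbreviation tensor_HH (infixl "\<otimes>\<^sub>H" 75) where
  "x \<otimes>\<^sub>H y \<equiv> tensor sH sH x y"

definition sweedler2 :: "('h \<Rightarrow> 'h \<Rightarrow> 'u::ab_group_add) \<Rightarrow> 'h \<Rightarrow> 'u" where
  "sweedler2 f h = tensor_lift sH sH H H f (\<Delta> h)"

definition sweedler3 :: "('h \<Rightarrow> 'h \<Rightarrow> 'h \<Rightarrow> 'u::ab_group_add) \<Rightarrow> 'h \<Rightarrow> 'u" where
  "sweedler3 f h = sweedler2 (\<lambda>x y. sweedler2 (\<lambda>u v. f x u v) y) h"

text \<open>
  The action of \<open>h\<close> on a product \<open>b b\<^sub>1 \<dots> b\<^sub>n\<close> by the diagonal rule
  \<open>(h\<^sub>1 \<cdot> b) (h\<^sub>2 \<cdot> b\<^sub>1) \<dots>\<close>, the factors being given as a nonempty list.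
\<close>

primrec diagonal_act ::
  "('h \<Rightarrow> 'b \<Rightarrow> 'b::{ring, monoid_mult}) \<Rightarrow> 'b \<Rightarrow> 'b list \<Rightarrow> 'h \<Rightarrow> 'b" where
  "diagonal_act act b [] h = act h b"
| "diagonal_act act b (b' # bs) h = sweedler2 (\<lambda>h1 h2. act h1 b * diagonal_act act b' bs h2) h"

end

locale hopf_algebra = coproduct sH H \<Delta> + k_algebra sH H
  for sH :: "'k::field \<Rightarrow> 'h::{ring, monoid_mult} \<Rightarrow> 'h" and H \<Delta> +
  fixes \<epsilon> :: "'h \<Rightarrow> 'k" and S :: "'h \<Rightarrow> 'h"
  assumes linear_coproduct: "linear_map sH tscale H (tensor_space sH sH H H) \<Delta>"
    and linear_counit: "linear_map sH (*) H UNIV \<epsilon>"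
    and linear_antipode: "linear_map sH sH H H S"
    and coassoc: "h \<in> H \<Longrightarrow>
      sweedler2 (\<lambda>x y. sweedler2 (\<lambda>u v. tensor sH tscale u (v \<otimes>\<^sub>H y)) x) h =
      sweedler2 (\<lambda>x y. tensor sH tscale x (\<Delta> y)) h"
    and counit_left: "h \<in> H \<Longrightarrow> sweedler2 (\<lambda>x y. sH (\<epsilon> x) y) h = h"
    and counit_right: "h \<in> H \<Longrightarrow> sweedler2 (\<lambda>x y. sH (\<epsilon> y) x) h = h"
    and coproduct_mult: "h \<in> H \<Longrightarrow> h' \<in> H \<Longrightarrow>
      \<Delta> (h * h') = sweedler2 (\<lambda>x y. sweedler2 (\<lambda>x' y'. (x * x') \<otimes>\<^sub>H (y * y')) h') h"
    and coproduct_one: "\<Delta> 1 = 1 \<otimes>\<^sub>H 1"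
    and counit_mult: "h \<in> H \<Longrightarrow> h' \<in> H \<Longrightarrow> \<epsilon> (h * h') = \<epsilon> h * \<epsilon> h'"
    and counit_one: "\<epsilon> 1 = 1"
    and antipode_left: "h \<in> H \<Longrightarrow> sweedler2 (\<lambda>x y. S x * y) h = sH (\<epsilon> h) 1"
    and antipode_right: "h \<in> H \<Longrightarrow> sweedler2 (\<lambda>x y. x * S y) h = sH (\<epsilon> h) 1"

text \<open>
  \<open>act h b\<close> is \<open>h \<cdot> b\<close>, \<open>\<sigma> h h'\<close> is \<open>\<sigma>(h \<otimes> h')\<close>, and \<open>\<sigma>'\<close> is the convolution inverse of \<open>\<sigma>\<close>.
\<close>

locale twisted_module_algebra = hopf_algebra sH H \<Delta> \<epsilon> S + B: k_algebra sB B
  for sH :: "'k::field \<Rightarrow> 'h::{ring, monoid_mult} \<Rightarrow> 'h" and H \<Delta> \<epsilon> S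
    and sB :: "'k \<Rightarrow> 'b::{ring, monoid_mult} \<Rightarrow> 'b" and B +
  fixes act :: "'h \<Rightarrow> 'b \<Rightarrow> 'b" and \<sigma> :: "'h \<Rightarrow> 'h \<Rightarrow> 'b" and \<sigma>' :: "'h \<Rightarrow> 'h \<Rightarrow> 'b"
  assumes bilinear_act: "bilinear_map sH sB sB H B B act"
    and act_unit: "h \<in> H \<Longrightarrow> act h 1 = sB (\<epsilon> h) 1"
    and act_mult: "h \<in> H \<Longrightarrow> b \<in> B \<Longrightarrow> b' \<in> B \<Longrightarrow>
      act h (b * b') = sweedler2 (\<lambda>h1 h2. act h1 b * act h2 b') h"
    and bilinear_sigma: "bilinear_map sH sH sB H H B \<sigma>"
    and bilinear_sigma_inv: "bilinear_map sH sH sB H H B \<sigma>'"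
    and sigma_inv_right: "h \<in> H \<Longrightarrow> h' \<in> H \<Longrightarrow>
      sweedler2 (\<lambda>h1 h2. sweedler2 (\<lambda>h1' h2'. \<sigma> h1 h1' * \<sigma>' h2 h2') h') h = sB (\<epsilon> h * \<epsilon> h') 1"
    and sigma_inv_left: "h \<in> H \<Longrightarrow> h' \<in> H \<Longrightarrow>
      sweedler2 (\<lambda>h1 h2. sweedler2 (\<lambda>h1' h2'. \<sigma>' h1 h1' * \<sigma> h2 h2') h') h = sB (\<epsilon> h * \<epsilon> h') 1"
    and one_act: "b \<in> B \<Longrightarrow> act 1 b = b"
    and act_act: "h \<in> H \<Longrightarrow> h' \<in> H \<Longrightarrow> b \<in> B \<Longrightarrow>
      act h (act h' b) =
      sweedler3 (\<lambda>h1 h2 h3. sweedler3 (\<lambda>h1' h2' h3'.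
        \<sigma> h1 h1' * act (h2 * h2') b * \<sigma>' h3 h3') h') h"
    and sigma_one_right: "h \<in> H \<Longrightarrow> \<sigma> h 1 = sB (\<epsilon> h) 1"
    and sigma_one_left: "h \<in> H \<Longrightarrow> \<sigma> 1 h = sB (\<epsilon> h) 1"
    and cocycle: "h \<in> H \<Longrightarrow> h' \<in> H \<Longrightarrow> h'' \<in> H \<Longrightarrow>
      sweedler2 (\<lambda>h1 h2. sweedler2 (\<lambda>h1' h2'. sweedler2 (\<lambda>h1'' h2''.
        act h1 (\<sigma> h1' h1'') * \<sigma> h2 (h2' * h2'')) h'') h') h =
      sweedler2 (\<lambda>h1 h2. sweedler2 (\<lambda>h1' h2'. \<sigma> h1 h1' * \<sigma> (h2 * h2') h'') h') h"


section \<open>Differential calculi\<close>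

definition grading :: "('k::field \<Rightarrow> 'a::ab_group_add \<Rightarrow> 'a) \<Rightarrow> (nat \<Rightarrow> 'a set) \<Rightarrow> bool" where
  "grading s \<Omega> \<longleftrightarrow>
     (\<forall>n. module.subspace s (\<Omega> n)) \<and>
     (\<forall>x. \<exists>!c. (\<forall>n. c n \<in> \<Omega> n) \<and> finite {n. c n \<noteq> 0} \<and> x = (\<Sum>n | c n \<noteq> 0. c n))"

definition component :: "(nat \<Rightarrow> 'a::ab_group_add set) \<Rightarrow> nat \<Rightarrow> 'a \<Rightarrow> 'a" where
  "component \<Omega> n x =
     (THE c. (\<forall>n. c n \<in> \<Omega> n) \<and> finite {n. c n \<noteq> 0} \<and> x = (\<Sum>n | c n \<noteq> 0. c n)) n"

text \<open>
  The linear extension of the rule \<open>x \<mapsto> f n x\<close> on elements of degree \<open>n\<close>. It expresses formulas that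
  are stated on homogeneous elements and involve their degrees.
\<close>

definition by_degree ::
  "(nat \<Rightarrow> 'a::ab_group_add set) \<Rightarrow> (nat \<Rightarrow> 'a \<Rightarrow> 'u::ab_group_add) \<Rightarrow> 'a \<Rightarrow> 'u" where
  "by_degree \<Omega> f x = (\<Sum>n | component \<Omega> n x \<noteq> 0. f n (component \<Omega> n x))"

text \<open>
  The whole type is the direct sum of the \<open>\<Omega> n\<close>, and its multiplication is the wedge product.
\<close>

locale differential_calculus = k_algebra s A
  for s :: "'k::field \<Rightarrow> 'a::{ring, monoid_mult} \<Rightarrow> 'a" and A +
  fixes \<Omega> :: "nat \<Rightarrow> 'a set" and d :: "'a \<Rightarrow> 'a"
  assumes grading: "grading s \<Omega>"
    and degree_0: "\<Omega> 0 = A"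
    and degree_mult: "x \<in> \<Omega> m \<Longrightarrow> y \<in> \<Omega> n \<Longrightarrow> x * y \<in> \<Omega> (m + n)"
    and linear_d: "Vector_Spaces.linear s s d"
    and degree_d: "x \<in> \<Omega> n \<Longrightarrow> d x \<in> \<Omega> (Suc n)"
    and d_d: "d (d x) = 0"
    and leibniz: "x \<in> \<Omega> n \<Longrightarrow> d (x * y) = d x * y + s ((-1) ^ n) (x * d y)"
    and spanned: "\<Omega> n = span {a * prod_list (map d as) | a as. a \<in> A \<and> set as \<subseteq> A \<and> length as = n}"


text \<open>
  The extension of the action to forms is the same function \<open>act\<close>, which on \<open>\<Omega>B 0 = B\<close> is the
  given measure.
\<close>

locale twisted_module_calculus =
  twisted_module_algebra sH H \<Delta> \<epsilon> S sB B act \<sigma> \<sigma>' + B: differential_calculus sB B \<Omega>B dB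
  for sH :: "'k::field \<Rightarrow> 'h::{ring, monoid_mult} \<Rightarrow> 'h" and H \<Delta> \<epsilon> S
    and sB :: "'k \<Rightarrow> 'b::{ring, monoid_mult} \<Rightarrow> 'b" and B act \<sigma> \<sigma>' \<Omega>B dB +
  assumes bilinear_act_forms: "n \<ge> 1 \<Longrightarrow> bilinear_map sH sB sB H (\<Omega>B n) (\<Omega>B n) act"
    and act_forms: "h \<in> H \<Longrightarrow> b \<in> B \<Longrightarrow> set bs \<subseteq> B \<Longrightarrow>
      act h (b * prod_list (map dB bs)) = diagonal_act act b (map dB bs) h"
    and act_d: "h \<in> H \<Longrightarrow> b \<in> B \<Longrightarrow> act h (dB b) = dB (act h b)"
    and d_sigma: "h \<in> H \<Longrightarrow> h' \<in> H \<Longrightarrow> dB (\<sigma> h h') = 0"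


section \<open>The tensor product calculus and the coaction on forms\<close>

definition tensor_degree ::
  "('k::field \<Rightarrow> 'v::ab_group_add \<Rightarrow> 'v) \<Rightarrow> ('k \<Rightarrow> 'w::ab_group_add \<Rightarrow> 'w) \<Rightarrow>
    (nat \<Rightarrow> 'v set) \<Rightarrow> (nat \<Rightarrow> 'w set) \<Rightarrow> nat \<Rightarrow> ('v, 'w, 'k) tensor set" where
  "tensor_degree sV sW \<Omega> \<Omega>' n = module.span tscale (\<Union>i\<le>n. tensor_space sV sW (\<Omega> (n - i)) (\<Omega>' i))"

definition tensor_d ::
  "('k::field \<Rightarrow> 'v::ab_group_add \<Rightarrow> 'v) \<Rightarrow> ('k \<Rightarrow> 'w::ab_group_add \<Rightarrow> 'w) \<Rightarrow>
    (nat \<Rightarrow> 'v set) \<Rightarrow> ('v \<Rightarrow> 'v) \<Rightarrow> ('w \<Rightarrow> 'w) \<Rightarrow> ('v, 'w, 'k) tensor \<Rightarrow> ('v, 'w, 'k) tensor" where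
  "tensor_d sV sW \<Omega> d d' =
     tensor_lift sV sW UNIV UNIV (\<lambda>x y.
       tensor sV sW (d x) y + by_degree \<Omega> (\<lambda>i x. tscale ((-1) ^ i) (tensor sV sW x (d' y))) x)"

locale coproduct_forms = coproduct sH H \<Delta>
  for sH :: "'k::field \<Rightarrow> 'h::{ring, monoid_mult} \<Rightarrow> 'h" and H \<Delta> +
  fixes \<Omega>H :: "nat \<Rightarrow> 'h set" and dH :: "'h \<Rightarrow> 'h"
begin

definition tensor_wedge ::
  "('h, 'h, 'k) tensor \<Rightarrow> ('h, 'h, 'k) tensor \<Rightarrow> ('h, 'h, 'k) tensor" where
  "tensor_wedge t t' =
     tensor_lift sH sH UNIV UNIV (\<lambda>x y. tensor_lift sH sH UNIV UNIV (\<lambda>x' y'.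
       by_degree \<Omega>H (\<lambda>j y. by_degree \<Omega>H (\<lambda>k x'.
         tscale ((-1) ^ (j * k)) ((x * x') \<otimes>\<^sub>H (y * y'))) x') y) t') t"

definition extends_coproduct :: "('h \<Rightarrow> ('h, 'h, 'k) tensor) \<Rightarrow> bool" where
  "extends_coproduct \<Phi> \<longleftrightarrow>
     Vector_Spaces.linear sH tscale \<Phi> \<and>
     (\<forall>n. \<forall>\<gamma>\<in>\<Omega>H n. \<Phi> \<gamma> \<in> tensor_degree sH sH \<Omega>H \<Omega>H n) \<and>
     \<Phi> 1 = 1 \<otimes>\<^sub>H 1 \<and>
     (\<forall>\<gamma> \<gamma>'. \<Phi> (\<gamma> * \<gamma>') = tensor_wedge (\<Phi> \<gamma>) (\<Phi> \<gamma>')) \<and>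
     (\<forall>\<gamma>. \<Phi> (dH \<gamma>) = tensor_d sH sH \<Omega>H dH dH (\<Phi> \<gamma>)) \<and>
     (\<forall>h\<in>H. \<Phi> h = \<Delta> h)"

definition coproduct_differentiable :: bool where
  "coproduct_differentiable \<longleftrightarrow> (\<exists>\<Phi>. extends_coproduct \<Phi>)"

text \<open>The extension is unique, since forms are generated by \<open>H\<close> and \<open>dH\<close>.\<close>

definition \<Delta>\<Omega> :: "'h \<Rightarrow> ('h, 'h, 'k) tensor" where
  "\<Delta>\<Omega> = (SOME \<Phi>. extends_coproduct \<Phi>)"

text \<open>
  For \<open>\<gamma>\<close> of degree \<open>n\<close>, \<open>\<Delta>\<Omega> \<gamma>\<close> has total degree \<open>n\<close>, so its component in \<open>H \<otimes> \<Omega>H n\<close> is found by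
  projecting the first factor to degree 0.
\<close>

definition coaction :: "'h \<Rightarrow> ('h, 'h, 'k) tensor" where
  "coaction \<gamma> = tensor_lift sH sH UNIV UNIV (\<lambda>x y. component \<Omega>H 0 x \<otimes>\<^sub>H y) (\<Delta>\<Omega> \<gamma>)"

text \<open>
  The values of \<open>f \<gamma>\<^sub>-\<^sub>1 \<gamma>\<^sub>0\<close> and of \<open>f \<gamma>\<^sub>-\<^sub>2 \<gamma>\<^sub>-\<^sub>1 \<gamma>\<^sub>0\<close>, with summation understood.
\<close>

definition cosweedler2 :: "('h \<Rightarrow> 'h \<Rightarrow> 'u::ab_group_add) \<Rightarrow> 'h \<Rightarrow> 'u" where
  "cosweedler2 f \<gamma> = tensor_lift sH sH H UNIV f (coaction \<gamma>)"

definition cosweedler3 :: "('h \<Rightarrow> 'h \<Rightarrow> 'h \<Rightarrow> 'u::ab_group_add) \<Rightarrow> 'h \<Rightarrow> 'u" where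
  "cosweedler3 f \<gamma> = cosweedler2 (\<lambda>x y. cosweedler2 (\<lambda>u v. f x u v) y) \<gamma>"

definition coinvariants :: "nat \<Rightarrow> 'h set" where
  "coinvariants n = {\<gamma> \<in> \<Omega>H n. coaction \<gamma> = 1 \<otimes>\<^sub>H \<gamma>}"

end


section \<open>The crossed product calculus\<close>

locale crossed_product = coproduct_forms sH H \<Delta> \<Omega>H dH
  for sH :: "'k::field \<Rightarrow> 'h::{ring, monoid_mult} \<Rightarrow> 'h" and H \<Delta> \<Omega>H dH +
  fixes S :: "'h \<Rightarrow> 'h"
    and sB :: "'k \<Rightarrow> 'b::{ring, monoid_mult} \<Rightarrow> 'b" and B :: "'b set"
    and \<Omega>B :: "nat \<Rightarrow> 'b set" and dB :: "'b \<Rightarrow> 'b"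
    and act :: "'h \<Rightarrow> 'b \<Rightarrow> 'b" and \<sigma> :: "'h \<Rightarrow> 'h \<Rightarrow> 'b"
begin

abbreviation tensor_BH (infixl "\<otimes>\<^sub>B" 75) where
  "\<omega> \<otimes>\<^sub>B \<gamma> \<equiv> tensor sB sH \<omega> \<gamma>"

text \<open>
  The crossed product algebra is the space \<open>crossed_space\<close> with unit \<open>1 \<otimes>\<^sub>B 1\<close> and product
  \<open>crossed_mult\<close>. It is the degree 0 part of the crossed product calculus \<open>crossed_forms\<close>, whose
  wedge product and differential are \<open>crossed_wedge\<close> and \<open>crossed_d\<close>.
\<close>

definition crossed_space :: "('b, 'h, 'k) tensor set" where
  "crossed_space = tensor_space sB sH B H"

definition crossed_mult ::
  "('b, 'h, 'k) tensor \<Rightarrow> ('b, 'h, 'k) tensor \<Rightarrow> ('b, 'h, 'k) tensor" where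
  "crossed_mult t t' =
     tensor_lift sB sH B H (\<lambda>b h. tensor_lift sB sH B H (\<lambda>b' h'.
       sweedler3 (\<lambda>h1 h2 h3. sweedler2 (\<lambda>h1' h2'.
         (b * act h1 b' * \<sigma> h2 h1') \<otimes>\<^sub>B (h3 * h2')) h') h) t') t"

definition crossed_forms :: "nat \<Rightarrow> ('b, 'h, 'k) tensor set" where
  "crossed_forms = tensor_degree sB sH \<Omega>B \<Omega>H"

definition crossed_wedge ::
  "('b, 'h, 'k) tensor \<Rightarrow> ('b, 'h, 'k) tensor \<Rightarrow> ('b, 'h, 'k) tensor" where
  "crossed_wedge t t' =
     tensor_lift sB sH UNIV UNIV (\<lambda>\<omega> \<gamma>. tensor_lift sB sH UNIV UNIV (\<lambda>\<omega>' \<gamma>'.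
       by_degree \<Omega>H (\<lambda>j \<gamma>. by_degree \<Omega>B (\<lambda>k \<omega>'.
         tscale ((-1) ^ (j * k))
           (cosweedler3 (\<lambda>h1 h2 \<gamma>0. cosweedler2 (\<lambda>h1' \<gamma>0'.
              (\<omega> * act h1 \<omega>' * \<sigma> h2 h1') \<otimes>\<^sub>B (\<gamma>0 * \<gamma>0')) \<gamma>') \<gamma>)) \<omega>') \<gamma>) t') t"

definition crossed_d :: "('b, 'h, 'k) tensor \<Rightarrow> ('b, 'h, 'k) tensor" where
  "crossed_d = tensor_d sB sH \<Omega>B dB dH"

definition base_ideal :: "nat \<Rightarrow> ('b, 'h, 'k) tensor set" where
  "base_ideal n =
     module.span tscale {crossed_wedge (\<omega> \<otimes>\<^sub>B 1) x | \<omega> x. \<omega> \<in> \<Omega>B 1 \<and> x \<in> crossed_forms (n - 1)}"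

text \<open>
  On \<open>\<Omega>B (n - i) \<otimes> \<Omega>H i\<close> the degree \<open>n\<close> component of the second factor vanishes for \<open>i < n\<close> and is
  the second factor itself for \<open>i = n\<close>, so the component projections only select the summand
  \<open>B \<otimes> \<Omega>H n\<close> of \<open>crossed_forms n\<close>.
\<close>

definition vertical ::
  "nat \<Rightarrow> ('b, 'h, 'k) tensor \<Rightarrow> (('b, 'h, 'k) tensor, 'h, 'k) tensor" where
  "vertical n = tensor_lift sB sH UNIV UNIV (\<lambda>b \<gamma>.
     cosweedler3 (\<lambda>h1 h2 \<gamma>0.
       tensor tscale sH (component \<Omega>B 0 b \<otimes>\<^sub>B h1) (S h2 * \<gamma>0)) (component \<Omega>H n \<gamma>))"

definition vertical_target :: "nat \<Rightarrow> (('b, 'h, 'k) tensor, 'h, 'k) tensor set" where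
  "vertical_target n = tensor_space tscale sH crossed_space (coinvariants n)"

end

end

theory Submission
  imports Defs
begin

text \<open>
  As a vector space \<open>crossed_forms n\<close> is the direct sum of \<open>B \<otimes> \<Omega>H n\<close> and of the part
  \<open>positive_base_forms n\<close>, which collects the summands \<open>\<Omega>B (n - i) \<otimes> \<Omega>H i\<close> with \<open>i < n\<close>. The sequence is
  exact because the ideal is the second summand, while the vertical map kills the second summand and
  is an isomorphism from the first one onto its target.

  The ideal equals \<open>positive_base_forms n\<close> (\<open>base_ideal_eq\<close>) because multiplication by a form on the base
  from the left is the naive one, \<open>(\<omega> \<otimes> 1) \<and> (\<omega>' \<otimes> \<gamma>) = \<omega>\<omega>' \<otimes> \<gamma>\<close> (\<open>crossed_wedge_base\<close>): \<open>1\<close> acts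
  trivially on forms, and \<open>\<sigma>(1 \<otimes> h) = \<epsilon>(h)\<close>. Conversely every form of positive degree on \<open>B\<close> is a sum of
  products with a first factor \<open>b db'\<close> of degree 1.

  On \<open>B \<otimes> \<Omega>H n\<close> the vertical map is the identity of \<open>B\<close> tensored with the isomorphism
  \<open>\<gamma> \<mapsto> \<gamma>\<^sub>-\<^sub>1 \<otimes> \<pi>(\<gamma>\<^sub>0)\<close> of the fundamental theorem of Hopf modules, applied to \<open>\<Omega>H n\<close>. Here
  \<open>\<pi>(\<gamma>) = S(\<gamma>\<^sub>-\<^sub>1) \<gamma>\<^sub>0\<close> is the projection \<open>coinv_proj\<close> onto coinvariant forms, and the inverse is
  \<open>h \<otimes> \<gamma> \<mapsto> h\<gamma>\<close>. That the two maps are mutually inverse is the content of \<open>coaction_times_coinv_proj\<close> and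
  \<open>coinv_proj_times_coinvariant\<close>; that \<open>\<pi>\<close> has coinvariant values is \<open>cosweedler2_coinv_proj\<close>.

  These facts need the coaction on forms to be a multiplicative, counital and coassociative one. It is
  obtained from \<open>\<Delta>\<Omega>\<close> by projecting the first factor to degree 0, which removes all Koszul signs, so that
  it respects products (\<open>cosweedler2_mult\<close>) and the differential (\<open>cosweedler2_d\<close>). As forms are
  generated by \<open>H\<close> and \<open>dH\<close>, the comodule axioms then follow from those of \<open>H\<close> by \<open>calculus_induct\<close>.

  Sweedler expressions are handled through test functions: an identity between tensors is stated as an
  equation between the values of an arbitrary multilinear function, and all manipulations are
  instances of a few rules on lifts (\<open>lift_push\<close>, \<open>lift_swap\<close>, \<open>lift_linear_param\<close>).
\<close>

section \<open>Linear maps on subspaces\<close>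

lemma linear_mapI:
  assumes "\<And>x. x \<in> V \<Longrightarrow> f x \<in> W"
    and "\<And>x y. x \<in> V \<Longrightarrow> y \<in> V \<Longrightarrow> f (x + y) = f x + f y"
    and "\<And>c x. x \<in> V \<Longrightarrow> f (sV c x) = sW c (f x)"
  shows "linear_map sV sW V W f"
  using assms by (simp add: linear_map_def)

lemma linear_map_subset:
  "linear_map sV sW V W f \<Longrightarrow> V' \<subseteq> V \<Longrightarrow> W \<subseteq> W' \<Longrightarrow> linear_map sV sW V' W' f"
  unfolding linear_map_def by blast

lemma linear_map_codomain:
  "linear_map sV sW V W f \<Longrightarrow> (\<And>x. x \<in> V \<Longrightarrow> f x \<in> W') \<Longrightarrow> linear_map sV sW V W' f"
  unfolding linear_map_def by blast

lemma linear_map_cong: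
  assumes "linear_map sV sW V W f" "\<And>x. x \<in> V \<Longrightarrow> f x = g x" "vector_space sV" "module.subspace sV V"
  shows "linear_map sV sW V W g"
proof -
  interpret vector_space sV by fact
  show ?thesis
  proof (rule linear_mapI)
    fix x y assume xy: "x \<in> V" "y \<in> V"
    show "g x \<in> W" using assms(2)[of x] linear_mapD(1)[OF assms(1), of x] xy by simp
    show "g (x + y) = g x + g y"
      using assms(2)[of x] assms(2)[of y] assms(2)[of "x + y"] linear_mapD(2)[OF assms(1), of x y] xy
        subspace_add[OF assms(4), of x y] by simp
  next
    fix c x assume x: "x \<in> V"
    show "g (sV c x) = sW c (g x)"
      using assms(2)[of x] assms(2)[of "sV c x"] linear_mapD(3)[OF assms(1), of x c] x
        subspace_scale[OF assms(4), of x c] by simp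
  qed
qed

lemma linear_map_ident: "linear_map s s V UNIV (\<lambda>x. x)"
  by (simp add: linear_map_def)

lemma linear_map_comp:
  "linear_map sW sX UNIV X g \<Longrightarrow> linear_map sV sW V UNIV f \<Longrightarrow> linear_map sV sX V X (\<lambda>x. g (f x))"
  by (simp add: linear_map_def)

lemma linear_map_comp_on:
  "linear_map sW sX W X g \<Longrightarrow> linear_map sV sW V W f \<Longrightarrow> linear_map sV sX V X (\<lambda>x. g (f x))"
  by (simp add: linear_map_def)

lemma linear_map_add:
  assumes "vector_space sW" "linear_map sV sW V UNIV f" "linear_map sV sW V UNIV g"
  shows "linear_map sV sW V UNIV (\<lambda>x. f x + g x)"
proof -
  interpret vector_space sW by fact
  show ?thesis using assms(2,3) by (simp add: linear_map_def scale_right_distrib)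
qed

lemma linear_map_scale:
  assumes "vector_space sW" "linear_map sV sW V UNIV f"
  shows "linear_map sV sW V UNIV (\<lambda>x. sW c (f x))"
proof -
  interpret vector_space sW by fact
  show ?thesis using assms(2) by (simp add: linear_map_def scale_right_distrib mult.commute)
qed

lemma linear_map_sum_list:
  assumes "vector_space sW" "\<And>p. p \<in> set ps \<Longrightarrow> linear_map sV sW V UNIV (F p)"
  shows "linear_map sV sW V UNIV (\<lambda>x. \<Sum>p\<leftarrow>ps. F p x)"
  using assms(2)
proof (induction ps)
  case Nil
  interpret vector_space sW by fact
  show ?case by (simp add: linear_map_def)
next
  case (Cons p ps)
  then show ?case using linear_map_add[OF assms(1), of sV V "F p"] by simp
qed

lemma linear_map_sum:
  assumes "vector_space sW" "\<And>p. p \<in> P \<Longrightarrow> linear_map sV sW V UNIV (F p)"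
  shows "linear_map sV sW V UNIV (\<lambda>x. \<Sum>p\<in>P. F p x)"
  using assms(2)
proof (induction P rule: infinite_finite_induct)
  case (insert p P)
  then show ?case using linear_map_add[OF assms(1), of sV V "F p"] by simp
qed (use linear_map_sum_list[OF assms(1), of "[]"] in auto)

lemma linear_map_zero:
  assumes "vector_space sV" "vector_space sW" "module.subspace sV V" "linear_map sV sW V W f"
  shows "f 0 = 0"
proof -
  interpret V: vector_space sV by fact
  interpret W: vector_space sW by fact
  have "f (sV 0 0) = sW 0 (f 0)"
    using assms(4) V.subspace_0[OF assms(3)] by (blast intro: linear_mapD(3))
  thus ?thesis by simp
qed

lemma linear_map_of_sum_list:
  assumes "vector_space sV" "vector_space sW" "module.subspace sV V" "linear_map sV sW V W f"
    and "\<And>p. p \<in> set ps \<Longrightarrow> F p \<in> V"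
  shows "f (\<Sum>p\<leftarrow>ps. F p) = (\<Sum>p\<leftarrow>ps. f (F p)) \<and> (\<Sum>p\<leftarrow>ps. F p) \<in> V"
  using assms(5)
proof (induction ps)
  case Nil
  interpret V: vector_space sV by fact
  show ?case using linear_map_zero[OF assms(1-4)] V.subspace_0[OF assms(3)] by simp
next
  case (Cons p ps)
  interpret V: vector_space sV by fact
  show ?case using Cons V.subspace_add[OF assms(3)] linear_mapD(2)[OF assms(4)] by simp
qed

lemma linear_map_span_in:
  assumes "vector_space sV" "vector_space sW" "module.subspace sV V" "linear_map sV sW V W f"
    and "X \<subseteq> V" "module.subspace sW K" "\<And>x. x \<in> X \<Longrightarrow> f x \<in> K" "x \<in> module.span sV X"
  shows "f x \<in> K"
proof -
  interpret V: vector_space sV by fact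
  interpret W: vector_space sW by fact
  have "x \<in> V \<and> f x \<in> K" using assms(8)
  proof (induction rule: V.span_induct_alt)
    case base
    show ?case using linear_map_zero[OF assms(1-4)] V.subspace_0[OF assms(3)] W.subspace_0[OF assms(6)]
      by simp
  next
    case (step c x y)
    have "x \<in> V" using step assms(5) by blast
    moreover have "sV c x \<in> V" using calculation V.subspace_scale[OF assms(3)] by blast
    moreover have "f (sV c x) \<in> K"
      using W.subspace_scale[OF assms(6) assms(7)] linear_mapD(3)[OF assms(4)] step calculation by simp
    ultimately show ?case
      using step V.subspace_add[OF assms(3)] W.subspace_add[OF assms(6)] linear_mapD(2)[OF assms(4)]
      by simp
  qed
  thus ?thesis by simp
qed

lemma linear_map_image_subspace:
  assumes "vector_space sV" "vector_space sW" "module.subspace sV V" "linear_map sV sW V W f"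
  shows "module.subspace sW (f ` V)"
proof -
  interpret V: vector_space sV by fact
  interpret W: vector_space sW by fact
  show ?thesis
  proof (rule W.subspaceI)
    have "f 0 = 0" by (rule linear_map_zero[OF assms])
    thus "0 \<in> f ` V" using V.subspace_0[OF assms(3)] by force
  next
    fix x y assume "x \<in> f ` V" "y \<in> f ` V"
    then obtain u v where "x = f u" "y = f v" "u \<in> V" "v \<in> V" by blast
    thus "x + y \<in> f ` V"
      using linear_mapD(2)[OF assms(4), of u v] V.subspace_add[OF assms(3), of u v] by force
  next
    fix c x assume "x \<in> f ` V"
    then obtain u where "x = f u" "u \<in> V" by blast
    thus "sW c x \<in> f ` V"
      using linear_mapD(3)[OF assms(4), of u c] V.subspace_scale[OF assms(3), of u c] by force
  qed
qed

lemma bilinear_mapI: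
  assumes "\<And>x. x \<in> V \<Longrightarrow> linear_map sW sU W UNIV (\<lambda>y. f x y)"
    and "\<And>y. y \<in> W \<Longrightarrow> linear_map sV sU V UNIV (\<lambda>x. f x y)"
  shows "bilinear_map sV sW sU V W UNIV f"
  using assms by (simp add: bilinear_map_def)

lemma bilinear_mapD:
  assumes "bilinear_map sV sW sU V W U f"
  shows "x \<in> V \<Longrightarrow> linear_map sW sU W U (\<lambda>y. f x y)"
    and "y \<in> W \<Longrightarrow> linear_map sV sU V U (\<lambda>x. f x y)"
  using assms by (simp_all add: bilinear_map_def)

lemma bilinear_map_subset:
  "bilinear_map sV sW sU V W U f \<Longrightarrow> V' \<subseteq> V \<Longrightarrow> W' \<subseteq> W \<Longrightarrow> U \<subseteq> U' \<Longrightarrow> bilinear_map sV sW sU V' W' U' f"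
  unfolding bilinear_map_def linear_map_def by blast

lemma bilinear_map_comp:
  "linear_map sU sX M X L \<Longrightarrow> bilinear_map sV sW sU V W UNIV g \<Longrightarrow>
    (\<And>v w. v \<in> V \<Longrightarrow> w \<in> W \<Longrightarrow> g v w \<in> M) \<Longrightarrow> bilinear_map sV sW sX V W X (\<lambda>v w. L (g v w))"
  by (simp add: bilinear_map_def linear_map_def)

lemma linear_imp_linear_map: "Vector_Spaces.linear s s' f \<Longrightarrow> linear_map s s' UNIV UNIV f"
  by (simp add: linear_map_def linear_iff)


section \<open>Tensor products of subspaces\<close>

interpretation tens: vector_space "tscale :: 'k::field \<Rightarrow> ('v, 'w, 'k) tensor \<Rightarrow> _"
  by (rule vector_space_tscale)

lemma linear_tensor_left:
  "linear_map s sV V UNIV f \<Longrightarrow> linear_map s tscale V UNIV (\<lambda>x. tensor sV sW (f x) w)"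
  using bilinear_tensor[of sV sW] by (simp add: bilinear_map_def linear_map_def)

lemma linear_tensor_right:
  "linear_map s sW V UNIV f \<Longrightarrow> linear_map s tscale V UNIV (\<lambda>x. tensor sV sW v (f x))"
  using bilinear_tensor[of sV sW] by (simp add: bilinear_map_def linear_map_def)

lemma tensor_in: "v \<in> V \<Longrightarrow> w \<in> W \<Longrightarrow> tensor sV sW v w \<in> tensor_space sV sW V W"
  unfolding tensor_space_def by (auto intro: tens.span_base)

lemma subspace_tensor_space: "module.subspace tscale (tensor_space sV sW V W)"
  unfolding tensor_space_def by simp

lemma tensor_space_mono: "V \<subseteq> V' \<Longrightarrow> W \<subseteq> W' \<Longrightarrow> tensor_space sV sW V W \<subseteq> tensor_space sV sW V' W'"
  unfolding tensor_space_def by (intro tens.span_mono) blast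

lemma sum_list_swap:
  fixes f :: "'p \<Rightarrow> 'q \<Rightarrow> 'u::ab_group_add"
  shows "(\<Sum>p\<leftarrow>ps. \<Sum>q\<leftarrow>qs. f p q) = (\<Sum>q\<leftarrow>qs. \<Sum>p\<leftarrow>ps. f p q)"
  by (induction ps) (simp_all add: sum_list_addf)

locale tensor_pair =
  fixes sV :: "'k::field \<Rightarrow> 'v::ab_group_add \<Rightarrow> 'v" and sW :: "'k \<Rightarrow> 'w::ab_group_add \<Rightarrow> 'w"
    and V :: "'v set" and W :: "'w set"
  assumes vector_space_left: "vector_space sV" and subspace_left: "module.subspace sV V"
    and vector_space_right: "vector_space sW" and subspace_right: "module.subspace sW W"
begin

abbreviation "pure \<equiv> tensor sV sW"
abbreviation "space \<equiv> tensor_space sV sW V W"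
abbreviation "bilin sU \<equiv> bilinear_map sV sW sU V W UNIV"
abbreviation "lift \<equiv> tensor_lift sV sW V W"

lemma space_cases:
  assumes "t \<in> space"
  obtains ps where "set ps \<subseteq> V \<times> W" "t = (\<Sum>(v, w)\<leftarrow>ps. pure v w)"
  using assms tensor_space_eq[OF vector_space_left subspace_left] by blast

lemma lift_sum:
  "vector_space sU \<Longrightarrow> bilin sU g \<Longrightarrow> set ps \<subseteq> V \<times> W \<Longrightarrow>
    lift g (\<Sum>(v, w)\<leftarrow>ps. pure v w) = (\<Sum>(v, w)\<leftarrow>ps. g v w)"
  by (rule tensor_lift_sum[OF vector_space_left subspace_left vector_space_right subspace_right])

lemmas lift_linear =
  tensor_universal(1)[OF vector_space_left subspace_left vector_space_right subspace_right]

lemmas lift_pure =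
  tensor_universal(2)[OF vector_space_left subspace_left vector_space_right subspace_right]

lemma lift_cong: "(\<And>v w. v \<in> V \<Longrightarrow> w \<in> W \<Longrightarrow> g v w = g' v w) \<Longrightarrow> lift g t = lift g' t"
proof -
  assume *: "\<And>v w. v \<in> V \<Longrightarrow> w \<in> W \<Longrightarrow> g v w = g' v w"
  have "(\<Sum>(v, w)\<leftarrow>ps. g v w) = (\<Sum>(v, w)\<leftarrow>ps. g' v w)" if "set ps \<subseteq> V \<times> W" for ps
    using that by (induction ps) (auto simp: *)
  hence "(\<exists>ps. set ps \<subseteq> V \<times> W \<and> t = (\<Sum>(v, w)\<leftarrow>ps. pure v w) \<and> u = (\<Sum>(v, w)\<leftarrow>ps. g v w)) \<longleftrightarrow>
      (\<exists>ps. set ps \<subseteq> V \<times> W \<and> t = (\<Sum>(v, w)\<leftarrow>ps. pure v w) \<and> u = (\<Sum>(v, w)\<leftarrow>ps. g' v w))" for u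
    by (intro ex_cong1) (rule conj_cong[OF refl], rule conj_cong[OF refl], simp)
  thus ?thesis unfolding tensor_lift_def by simp
qed

text \<open>
  Maps such as \<open>\<Delta>\<close>, \<open>S\<close> or a lift may be linear on a proper subspace only, so \<open>L\<close> is required to be
  linear just on a subspace \<open>M\<close> that contains the values of \<open>g\<close>.
\<close>

lemma lift_push:
  assumes "t \<in> space" "vector_space sU" "vector_space sX" "bilin sU g"
    and "linear_map sU sX M X L" "module.subspace sU M" "\<And>v w. v \<in> V \<Longrightarrow> w \<in> W \<Longrightarrow> g v w \<in> M"
  shows "L (lift g t) = lift (\<lambda>v w. L (g v w)) t"
proof -
  obtain ps where ps: "set ps \<subseteq> V \<times> W" "t = (\<Sum>(v, w)\<leftarrow>ps. pure v w)"
    using space_cases[OF assms(1)] .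
  have "bilin sX (\<lambda>v w. L (g v w))"
    by (rule bilinear_map_comp[OF linear_map_subset[OF assms(5) subset_refl] assms(4,7)]) auto
  moreover have "L (\<Sum>p\<leftarrow>ps. (\<lambda>(v, w). g v w) p) = (\<Sum>p\<leftarrow>ps. L ((\<lambda>(v, w). g v w) p))"
    by (rule conjunct1[OF linear_map_of_sum_list[OF assms(2,3,6,5)]]) (use ps(1) assms(7) in auto)
  ultimately show ?thesis using lift_sum[OF assms(2,4) ps(1)] lift_sum[OF assms(3) _ ps(1)] ps(2)
    by (simp add: case_prod_unfold)
qed

lemma lift_in:
  assumes "t \<in> space" "vector_space sU" "bilin sU g"
    and "module.subspace sU M" "\<And>v w. v \<in> V \<Longrightarrow> w \<in> W \<Longrightarrow> g v w \<in> M"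
  shows "lift g t \<in> M"
proof -
  obtain ps where ps: "set ps \<subseteq> V \<times> W" "t = (\<Sum>(v, w)\<leftarrow>ps. pure v w)"
    using space_cases[OF assms(1)] .
  have "(\<Sum>p\<leftarrow>ps. (\<lambda>(v, w). g v w) p) \<in> M"
    by (rule conjunct2[OF linear_map_of_sum_list[OF assms(2,2,4) linear_map_ident]])
      (use ps(1) assms(5) in auto)
  thus ?thesis using lift_sum[OF assms(2,3) ps(1)] ps(2) by simp
qed

text \<open>
  One decomposition of \<open>t\<close> into pure tensors serves all parameters \<open>a\<close> at once and turns the lift
  into a finite sum of linear maps.
\<close>

lemma lift_linear_param:
  assumes "t \<in> space" "vector_space sU" "vector_space s" "module.subspace s A"
    and "\<And>a. a \<in> A \<Longrightarrow> bilin sU (g a)"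
    and "\<And>v w. v \<in> V \<Longrightarrow> w \<in> W \<Longrightarrow> linear_map s sU A UNIV (\<lambda>a. g a v w)"
  shows "linear_map s sU A UNIV (\<lambda>a. lift (g a) t)"
proof -
  obtain ps where ps: "set ps \<subseteq> V \<times> W" "t = (\<Sum>(v, w)\<leftarrow>ps. pure v w)"
    using space_cases[OF assms(1)] .
  have "linear_map s sU A UNIV (\<lambda>a. \<Sum>p\<leftarrow>ps. (\<lambda>p. case p of (v, w) \<Rightarrow> g a v w) p)"
    by (rule linear_map_sum_list[OF assms(2)]) (use ps(1) assms(6) in auto)
  thus ?thesis
  proof (rule linear_map_cong[OF _ _ assms(3,4)])
    fix a assume "a \<in> A"
    show "(\<Sum>p\<leftarrow>ps. (case p of (v, w) \<Rightarrow> g a v w)) = lift (g a) t"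
      unfolding ps(2) by (rule lift_sum[OF assms(2,5) ps(1), symmetric]) fact
  qed
qed

lemma lift_ident: assumes "t \<in> space" shows "lift pure t = t"
proof -
  obtain ps where ps: "set ps \<subseteq> V \<times> W" "t = (\<Sum>(v, w)\<leftarrow>ps. pure v w)"
    using space_cases[OF assms] .
  have "bilin tscale pure"
    by (rule bilinear_map_subset[OF bilinear_tensor]) auto
  from lift_sum[OF vector_space_tscale this ps(1)] ps(2) show ?thesis by simp
qed

lemma pure_zero_left: "pure 0 w = 0"
  by (rule linear_map_zero[OF vector_space_left vector_space_tscale
        module.subspace_UNIV[OF module_iff_vector_space[THEN iffD2, OF vector_space_left]] bilinear_mapD(2)[OF bilinear_tensor UNIV_I]])

lemma pure_zero_right: "pure v 0 = 0"
  by (rule linear_map_zero[OF vector_space_right vector_space_tscale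
        module.subspace_UNIV[OF module_iff_vector_space[THEN iffD2, OF vector_space_right]] bilinear_mapD(1)[OF bilinear_tensor UNIV_I]])

lemma pure_scale_left: "pure (sV c v) w = tscale c (pure v w)"
  and pure_scale_right: "pure v (sW c w) = tscale c (pure v w)"
  by (rule linear_mapD(3)[OF bilinear_mapD(2)[OF bilinear_tensor]]
      linear_mapD(3)[OF bilinear_mapD(1)[OF bilinear_tensor]]; simp)+

text \<open>
  A decomposition of \<open>t\<close> over \<open>V' \<times> W'\<close> is also one over \<open>V \<times> W\<close>, and lifts do not depend on the
  decomposition. This compares \<open>sweedler2\<close> with \<open>cosweedler2\<close> and with lifts of maps defined everywhere.
\<close>

lemma lift_subspaces:
  assumes "tensor_pair sV sW V' W'" "V' \<subseteq> V" "W' \<subseteq> W" "vector_space sU" "bilin sU g"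
    and "t \<in> tensor_space sV sW V' W'"
  shows "tensor_lift sV sW V' W' g t = lift g t"
proof -
  interpret P: tensor_pair sV sW V' W' by fact
  obtain ps where ps: "set ps \<subseteq> V' \<times> W'" "t = (\<Sum>(v, w)\<leftarrow>ps. pure v w)"
    using P.space_cases[OF assms(6)] .
  have "set ps \<subseteq> V \<times> W" using ps(1) assms(2,3) by auto
  moreover have "P.bilin sU g" by (rule bilinear_map_subset[OF assms(5,2,3) subset_refl])
  ultimately show ?thesis unfolding ps(2) using lift_sum[OF assms(4,5)] P.lift_sum[OF assms(4) _ ps(1)]
    by metis
qed

text \<open>
  Both sides are the same double sum over a decomposition of \<open>t\<close> and one of \<open>t'\<close>.
\<close>

lemma lift_swap:
  assumes "tensor_pair sV' sW' V' W'" "t \<in> space" "t' \<in> tensor_space sV' sW' V' W'" "vector_space sU"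
    and "\<And>v w. v \<in> V \<Longrightarrow> w \<in> W \<Longrightarrow> bilinear_map sV' sW' sU V' W' UNIV (f v w)"
    and "\<And>v' w'. v' \<in> V' \<Longrightarrow> w' \<in> W' \<Longrightarrow> bilin sU (\<lambda>v w. f v w v' w')"
  shows "lift (\<lambda>v w. tensor_lift sV' sW' V' W' (f v w) t') t =
    tensor_lift sV' sW' V' W' (\<lambda>v' w'. lift (\<lambda>v w. f v w v' w') t) t'"
proof -
  interpret P: tensor_pair sV' sW' V' W' by fact
  obtain ps where ps: "set ps \<subseteq> V \<times> W" "t = (\<Sum>(v, w)\<leftarrow>ps. pure v w)"
    using space_cases[OF assms(2)] .
  obtain qs where qs: "set qs \<subseteq> V' \<times> W'" "t' = (\<Sum>(v, w)\<leftarrow>qs. P.pure v w)"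
    using P.space_cases[OF assms(3)] .
  have bil: "bilin sU (\<lambda>v w. P.lift (f v w) t')"
  proof (rule bilinear_mapI)
    show "linear_map sW sU W UNIV (\<lambda>w. P.lift (f v w) t')" if "v \<in> V" for v
      by (rule P.lift_linear_param[OF assms(3,4) vector_space_right subspace_right assms(5)])
        (use that bilinear_mapD[OF assms(6)] in auto)
    show "linear_map sV sU V UNIV (\<lambda>v. P.lift (f v w) t')" if "w \<in> W" for w
      by (rule P.lift_linear_param[OF assms(3,4) vector_space_left subspace_left assms(5)])
        (use that bilinear_mapD[OF assms(6)] in auto)
  qed
  have bil': "P.bilin sU (\<lambda>v' w'. lift (\<lambda>v w. f v w v' w') t)"
  proof (rule bilinear_mapI)
    show "linear_map sW' sU W' UNIV (\<lambda>w'. lift (\<lambda>v w. f v w v' w') t)" if "v' \<in> V'" for v'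
      by (rule lift_linear_param[OF assms(2,4) P.vector_space_right P.subspace_right assms(6)])
        (use that bilinear_mapD[OF assms(5)] in auto)
    show "linear_map sV' sU V' UNIV (\<lambda>v'. lift (\<lambda>v w. f v w v' w') t)" if "w' \<in> W'" for w'
      by (rule lift_linear_param[OF assms(2,4) P.vector_space_left P.subspace_left assms(6)])
        (use that bilinear_mapD[OF assms(5)] in auto)
  qed
  have "lift (\<lambda>v w. P.lift (f v w) t') t = (\<Sum>p\<leftarrow>ps. P.lift (f (fst p) (snd p)) t')"
    using lift_sum[OF assms(4) bil ps(1)] ps(2) by (simp add: case_prod_unfold)
  also have "\<dots> = (\<Sum>p\<leftarrow>ps. \<Sum>q\<leftarrow>qs. f (fst p) (snd p) (fst q) (snd q))"
    by (rule arg_cong[where f = sum_list], rule map_cong[OF refl])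
      (use ps(1) P.lift_sum[OF assms(4,5) qs(1)] qs(2) in \<open>auto simp: case_prod_unfold\<close>)
  also have "\<dots> = (\<Sum>q\<leftarrow>qs. \<Sum>p\<leftarrow>ps. f (fst p) (snd p) (fst q) (snd q))"
    by (rule sum_list_swap)
  also have "\<dots> = (\<Sum>q\<leftarrow>qs. lift (\<lambda>v w. f v w (fst q) (snd q)) t)"
    by (rule arg_cong[where f = sum_list], rule map_cong[OF refl])
      (use qs(1) lift_sum[OF assms(4,6) ps(1)] ps(2) in \<open>auto simp: case_prod_unfold\<close>)
  also have "\<dots> = P.lift (\<lambda>v' w'. lift (\<lambda>v w. f v w v' w') t) t'"
    using P.lift_sum[OF assms(4) bil' qs(1)] qs(2) by (simp add: case_prod_unfold)
  finally show ?thesis .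
qed

end

section \<open>Graded spaces and differential calculi\<close>

locale graded_space = vector_space s
  for s :: "'k::field \<Rightarrow> 'a::ab_group_add \<Rightarrow> 'a" +
  fixes \<Omega> :: "nat \<Rightarrow> 'a set"
  assumes is_grading: "grading s \<Omega>"
begin

lemma subspace_degree: "subspace (\<Omega> n)"
  using is_grading by (simp add: grading_def)

lemma component_decomposition:
  "(\<forall>n. component \<Omega> n x \<in> \<Omega> n) \<and> finite {n. component \<Omega> n x \<noteq> 0} \<and>
   x = (\<Sum>n | component \<Omega> n x \<noteq> 0. component \<Omega> n x)"
  unfolding component_def
  by (rule theI'[of "\<lambda>c. (\<forall>n. c n \<in> \<Omega> n) \<and> finite {n. c n \<noteq> 0} \<and> x = (\<Sum>n | c n \<noteq> 0. c n)"])
    (use is_grading in \<open>simp add: grading_def\<close>)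

lemma component_degree: "component \<Omega> n x \<in> \<Omega> n"
  and finite_components: "finite {n. component \<Omega> n x \<noteq> 0}"
  and sum_components: "(\<Sum>n | component \<Omega> n x \<noteq> 0. component \<Omega> n x) = x"
  using component_decomposition[of x] by auto

lemma component_unique:
  assumes "\<And>n. c n \<in> \<Omega> n" "finite F" "\<And>n. n \<notin> F \<Longrightarrow> c n = 0" "x = (\<Sum>n\<in>F. c n)"
  shows "component \<Omega> n x = c n"
proof -
  have "{n. c n \<noteq> 0} \<subseteq> F" using assms(3) by blast
  moreover have "(\<Sum>n | c n \<noteq> 0. c n) = (\<Sum>n\<in>F. c n)"
    by (rule sum.mono_neutral_left) (use assms(2,3) in auto)
  ultimately have c: "(\<forall>n. c n \<in> \<Omega> n) \<and> finite {n. c n \<noteq> 0} \<and> x = (\<Sum>n | c n \<noteq> 0. c n)"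
    using assms finite_subset by auto
  have "\<exists>!c. (\<forall>n. c n \<in> \<Omega> n) \<and> finite {n. c n \<noteq> 0} \<and> x = (\<Sum>n | c n \<noteq> 0. c n)"
    using is_grading by (simp add: grading_def)
  hence "(THE c. (\<forall>n. c n \<in> \<Omega> n) \<and> finite {n. c n \<noteq> 0} \<and> x = (\<Sum>n | c n \<noteq> 0. c n)) = c"
    using c by (intro the1_equality) assumption+
  thus ?thesis unfolding component_def by simp
qed

lemma component_homogeneous: "x \<in> \<Omega> m \<Longrightarrow> component \<Omega> n x = (if n = m then x else 0)"
  by (rule component_unique[where F = "{m}"]) (use subspace_degree subspace_0 in auto)

lemma by_degree_superset:
  assumes "finite F" "{n. component \<Omega> n x \<noteq> 0} \<subseteq> F" "\<And>n. f n 0 = 0"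
  shows "by_degree \<Omega> f x = (\<Sum>n\<in>F. f n (component \<Omega> n x))"
  unfolding by_degree_def by (rule sum.mono_neutral_left) (use assms in auto)

lemma linear_component: "linear_map s s UNIV (\<Omega> n) (component \<Omega> n)"
proof (rule linear_mapI)
  show "component \<Omega> n x \<in> \<Omega> n" for x by (rule component_degree)
  fix x y c
  let ?F = "{n. component \<Omega> n x \<noteq> 0} \<union> {n. component \<Omega> n y \<noteq> 0}"
  have id: "z = (\<Sum>n\<in>?F. component \<Omega> n z)" if "{n. component \<Omega> n z \<noteq> 0} \<subseteq> ?F" for z
    using by_degree_superset[of ?F z "\<lambda>n x. x"] that finite_components sum_components[of z]
    by (simp add: by_degree_def)
  have x: "x = (\<Sum>n\<in>?F. component \<Omega> n x)" and y: "y = (\<Sum>n\<in>?F. component \<Omega> n y)"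
    by (intro id; blast)+
  show "component \<Omega> n (x + y) = component \<Omega> n x + component \<Omega> n y"
  proof (rule component_unique[where F = ?F and c = "\<lambda>n. component \<Omega> n x + component \<Omega> n y"])
    show "component \<Omega> n x + component \<Omega> n y \<in> \<Omega> n" for n
      by (intro subspace_add subspace_degree component_degree)
    show "finite ?F" using finite_components by simp
    show "x + y = (\<Sum>n\<in>?F. component \<Omega> n x + component \<Omega> n y)"
      unfolding sum.distrib using x y by simp
  qed auto
  show "component \<Omega> n (s c x) = s c (component \<Omega> n x)"
  proof (rule component_unique[where F = ?F and c = "\<lambda>n. s c (component \<Omega> n x)"])
    show "s c (component \<Omega> n x) \<in> \<Omega> n" for n
      by (intro subspace_scale subspace_degree component_degree)
    show "finite ?F" using finite_components by simp
    show "s c x = (\<Sum>n\<in>?F. s c (component \<Omega> n x))"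
      unfolding scale_sum_right[symmetric] using x by simp
  qed auto
qed

lemma homogeneous_induct:
  assumes "\<And>n x. x \<in> \<Omega> n \<Longrightarrow> P x" "\<And>x y. P x \<Longrightarrow> P y \<Longrightarrow> P (x + y)"
  shows "P x"
proof -
  have "P (\<Sum>n\<in>F. component \<Omega> n x)" if "finite F" for F
    using that
  proof induction
    case empty
    show ?case using assms(1)[OF subspace_0[OF subspace_degree[of 0]]] by simp
  next
    case (insert n F)
    then show ?case using assms(2)[OF assms(1)[OF component_degree]] by simp
  qed
  from this[OF finite_components[of x]] show ?thesis by (simp add: sum_components)
qed

lemma linear_eq_homogeneous:
  assumes "linear_map s sU UNIV UNIV f" "linear_map s sU UNIV UNIV g"
    and "\<And>n x. x \<in> \<Omega> n \<Longrightarrow> f x = g x"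
  shows "f x = g x"
  by (induction x rule: homogeneous_induct)
    (simp_all add: assms(3) linear_mapD(2)[OF assms(1)] linear_mapD(2)[OF assms(2)])

lemma by_degree_homogeneous:
  assumes "x \<in> \<Omega> n" "f n 0 = 0"
  shows "by_degree \<Omega> f x = f n x"
proof (cases "x = 0")
  case True
  then have "component \<Omega> m x = 0" for m using component_homogeneous[OF assms(1), of m] by simp
  then show ?thesis using True assms(2) by (simp add: by_degree_def)
next
  case False
  then have "{m. component \<Omega> m x \<noteq> 0} = {n}" using component_homogeneous[OF assms(1)] by auto
  then show ?thesis using component_homogeneous[OF assms(1), of n] by (simp add: by_degree_def)
qed

lemma linear_by_degree:
  assumes "vector_space sU" "\<And>n. linear_map s sU (\<Omega> n) UNIV (f n)"
  shows "linear_map s sU UNIV UNIV (by_degree \<Omega> f)"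
proof (rule linear_mapI)
  interpret U: vector_space sU by fact
  have f0: "f n 0 = 0" for n
    by (rule linear_map_zero[OF vector_space_axioms assms(1) subspace_degree assms(2)])
  note C = component_degree linear_mapD(2,3)[OF linear_component] linear_mapD(2,3)[OF assms(2)]
  fix x y c
  let ?F = "{n. component \<Omega> n x \<noteq> 0} \<union> {n. component \<Omega> n y \<noteq> 0}"
  have fin: "finite ?F" using finite_components by simp
  have S: "by_degree \<Omega> f z = (\<Sum>n\<in>?F. f n (component \<Omega> n z))" if "{n. component \<Omega> n z \<noteq> 0} \<subseteq> ?F" for z
    using fin that f0 by (rule by_degree_superset)
  have *: "{n. component \<Omega> n (x + y) \<noteq> 0} \<subseteq> ?F" "{n. component \<Omega> n (s c x) \<noteq> 0} \<subseteq> ?F"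
    by (auto simp: C)
  have Sx: "by_degree \<Omega> f x = (\<Sum>n\<in>?F. f n (component \<Omega> n x))"
    and Sy: "by_degree \<Omega> f y = (\<Sum>n\<in>?F. f n (component \<Omega> n y))"
    by (intro S; blast)+
  show "by_degree \<Omega> f (x + y) = by_degree \<Omega> f x + by_degree \<Omega> f y"
    unfolding S[OF *(1)] Sx Sy sum.distrib[symmetric] by (rule sum.cong) (simp_all add: C)
  show "by_degree \<Omega> f (s c x) = sU c (by_degree \<Omega> f x)"
    unfolding S[OF *(2)] Sx U.scale_sum_right by (rule sum.cong) (simp_all add: C)
qed simp

lemma linear_by_degree_param:
  assumes "vector_space sU" "\<And>n x. x \<in> \<Omega> n \<Longrightarrow> linear_map s' sU A UNIV (\<lambda>a. f a n x)"
  shows "linear_map s' sU A UNIV (\<lambda>a. by_degree \<Omega> (f a) x)"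
  unfolding by_degree_def by (rule linear_map_sum[OF assms(1) assms(2)[OF component_degree]])

end

context k_algebra
begin

lemma linear_mult_left: "linear_map s' s V UNIV f \<Longrightarrow> linear_map s' s V UNIV (\<lambda>x. f x * y)"
  by (simp add: linear_map_def distrib_right scale_mult_left)

lemma linear_mult_right: "linear_map s' s V UNIV f \<Longrightarrow> linear_map s' s V UNIV (\<lambda>x. y * f x)"
  by (simp add: linear_map_def distrib_left scale_mult_right)

end

sublocale differential_calculus \<subseteq> graded_space s \<Omega>
  by unfold_locales (rule grading)

context differential_calculus
begin

lemma linear_d_UNIV: "linear_map s s V UNIV d"
  using linear_imp_linear_map[OF linear_d] by (rule linear_map_subset) auto

text \<open>
  The forms \<open>a da\<^sub>1 \<dots> da\<^sub>n\<close> span, so two linear maps that respect products and the differential agree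
  as soon as they agree on \<open>A\<close>. The comodule axioms for forms are proved in this way.
\<close>

lemma calculus_induct [case_names algebra add scale mult diff]:
  assumes A: "\<And>a. a \<in> A \<Longrightarrow> P a"
    and add: "\<And>x y. P x \<Longrightarrow> P y \<Longrightarrow> P (x + y)"
    and scale: "\<And>c x. P x \<Longrightarrow> P (s c x)"
    and mult: "\<And>x y. P x \<Longrightarrow> P y \<Longrightarrow> P (x * y)"
    and diff: "\<And>x. P x \<Longrightarrow> P (d x)"
  shows "P x"
proof (rule homogeneous_induct[of P])
  fix n x assume "x \<in> \<Omega> n"
  hence "x \<in> span {a * prod_list (map d as) | a as. a \<in> A \<and> set as \<subseteq> A \<and> length as = n}"
    using spanned[of n] by simp
  thus "P x"
  proof (induction rule: span_induct_alt)
    case base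
    show ?case using A subspace_0[OF subspace_A] by blast
  next
    case (step c x y)
    have "P (prod_list (map d as))" if "set as \<subseteq> A" for as
      using that by (induction as) (auto intro: A one_A mult diff)
    then show ?case using step by (auto intro: A add scale mult)
  qed
qed (rule add)

text \<open>
  Natural numbers add up to 0 only if all of them are 0, so projecting to degree 0 is an algebra
  map.
\<close>

lemma component_0_mult: "component \<Omega> 0 (x * y) = component \<Omega> 0 x * component \<Omega> 0 y"
proof (induction x rule: homogeneous_induct)
  case (1 m x)
  show ?case
  proof (induction y rule: homogeneous_induct)
    case (1 n y)
    show ?case
      using component_homogeneous[OF degree_mult[OF \<open>x \<in> \<Omega> m\<close> \<open>y \<in> \<Omega> n\<close>], of 0]
        component_homogeneous[OF \<open>x \<in> \<Omega> m\<close>, of 0] component_homogeneous[OF \<open>y \<in> \<Omega> n\<close>, of 0]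
      by (auto split: if_splits)
  qed (simp add: distrib_left linear_mapD(2)[OF linear_component])
qed (simp add: distrib_right linear_mapD(2)[OF linear_component])

lemma component_0_d: "component \<Omega> 0 (d x) = 0"
  by (induction x rule: homogeneous_induct)
    (simp_all add: component_homogeneous[OF degree_d] linear_mapD(2)[OF linear_d_UNIV[of UNIV]]
      linear_mapD(2)[OF linear_component])

lemma component_0_algebra: "a \<in> A \<Longrightarrow> component \<Omega> 0 a = a"
  using component_homogeneous[of a 0 0] by (simp add: degree_0)

lemma component_0_in: "component \<Omega> 0 x \<in> A"
  using component_degree[of 0] by (simp add: degree_0)

lemma linear_component_0: "linear_map s s UNIV UNIV (component \<Omega> 0)"
  by (rule linear_map_subset[OF linear_component]) auto

end

section \<open>The left coaction on the forms of a Hopf algebra\<close>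

locale covariant_calculus =
  hopf_algebra sH H \<Delta> \<epsilon> S + differential_calculus sH H \<Omega>H dH + coproduct_forms sH H \<Delta> \<Omega>H dH
  for sH :: "'k::field \<Rightarrow> 'h::{ring, monoid_mult} \<Rightarrow> 'h" and H \<Delta> \<epsilon> S \<Omega>H dH +
  assumes differentiable: coproduct_differentiable
begin

lemma vector_space_sH: "vector_space sH"
  by unfold_locales

sublocale HH: tensor_pair sH sH H H
  by unfold_locales (rule subspace_A)

sublocale HU: tensor_pair sH sH H UNIV
  by unfold_locales (auto simp: subspace_A)

sublocale UU: tensor_pair sH sH UNIV UNIV
  by unfold_locales auto

lemma extends_coproduct_\<Delta>\<Omega>: "extends_coproduct \<Delta>\<Omega>"
  using differentiable unfolding coproduct_differentiable_def \<Delta>\<Omega>_def by (rule someI_ex)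

lemma \<Delta>\<Omega>_degree: "\<gamma> \<in> \<Omega>H n \<Longrightarrow> \<Delta>\<Omega> \<gamma> \<in> tensor_degree sH sH \<Omega>H \<Omega>H n"
  and \<Delta>\<Omega>_mult: "\<Delta>\<Omega> (\<gamma> * \<gamma>') = tensor_wedge (\<Delta>\<Omega> \<gamma>) (\<Delta>\<Omega> \<gamma>')"
  and \<Delta>\<Omega>_d: "\<Delta>\<Omega> (dH \<gamma>) = tensor_d sH sH \<Omega>H dH dH (\<Delta>\<Omega> \<gamma>)"
  and \<Delta>\<Omega>_algebra: "h \<in> H \<Longrightarrow> \<Delta>\<Omega> h = \<Delta> h"
  and linear_\<Delta>\<Omega>: "linear_map sH tscale UNIV UNIV \<Delta>\<Omega>"
  using extends_coproduct_\<Delta>\<Omega> unfolding extends_coproduct_def by (auto intro: linear_imp_linear_map)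

lemma \<Delta>\<Omega>_in: "\<Delta>\<Omega> \<gamma> \<in> UU.space"
proof (induction \<gamma> rule: homogeneous_induct)
  case (1 n \<gamma>)
  have "tensor_degree sH sH \<Omega>H \<Omega>H n \<subseteq> UU.space"
    unfolding tensor_degree_def by (rule tens.span_minimal) (auto simp: subspace_tensor_space
      intro: subsetD[OF tensor_space_mono[OF subset_UNIV subset_UNIV]])
  then show ?case using \<Delta>\<Omega>_degree[OF 1] by blast
next
  case (2 x y)
  then show ?case
    by (subst linear_mapD(2)[OF linear_\<Delta>\<Omega> UNIV_I UNIV_I]) (rule tens.subspace_add[OF subspace_tensor_space])
qed

lemma bilin_UU:
  assumes "HU.bilin sU f"
  shows "UU.bilin sU (\<lambda>x y. f (component \<Omega>H 0 x) y)"
  by (rule bilinear_mapI)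
    (auto intro: component_0_in bilinear_mapD(1)[OF assms]
      linear_map_comp_on[OF bilinear_mapD(2)[OF assms] linear_component[of 0, unfolded degree_0]])

lemma bilin_tensor: "HU.bilin tscale (\<otimes>\<^sub>H)"
  by (rule bilinear_map_subset[OF bilinear_tensor]) auto

lemma coaction_in: "coaction \<gamma> \<in> HU.space"
  unfolding coaction_def
  by (rule UU.lift_in[OF \<Delta>\<Omega>_in vector_space_tscale bilin_UU[OF bilin_tensor] subspace_tensor_space])
    (simp add: tensor_in component_0_in)

lemma linear_coaction: "linear_map sH tscale UNIV HU.space coaction"
  unfolding coaction_def[abs_def]
  by (rule linear_map_codomain[OF linear_map_comp_on[OF
        UU.lift_linear[OF vector_space_tscale bilin_UU[OF bilin_tensor]]
        linear_map_codomain[OF linear_\<Delta>\<Omega> \<Delta>\<Omega>_in]]])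
    (fold coaction_def, rule coaction_in)

lemma coaction_algebra: assumes h: "h \<in> H" shows "coaction h = \<Delta> h"
proof -
  have D: "\<Delta> h \<in> HH.space" by (rule linear_mapD(1)[OF linear_coproduct h])
  have "coaction h = UU.lift (\<lambda>x y. component \<Omega>H 0 x \<otimes>\<^sub>H y) (\<Delta> h)"
    by (simp add: coaction_def \<Delta>\<Omega>_algebra h)
  also have "\<dots> = HH.lift (\<lambda>x y. component \<Omega>H 0 x \<otimes>\<^sub>H y) (\<Delta> h)"
    by (rule UU.lift_subspaces[OF HH.tensor_pair_axioms subset_UNIV subset_UNIV vector_space_tscale
          bilin_UU[OF bilin_tensor] D, symmetric])
  also have "\<dots> = HH.lift (\<otimes>\<^sub>H) (\<Delta> h)"
    by (rule HH.lift_cong) (simp add: component_0_algebra)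
  also have "\<dots> = \<Delta> h" by (rule HH.lift_ident[OF D])
  finally show ?thesis .
qed

text \<open>
  Projecting the first factor to degree 0 kills the part of \<open>\<Delta>\<Omega> \<gamma>\<close> in \<open>\<Omega>H (n - i) \<otimes> \<Omega>H i\<close> for
  \<open>i < n\<close>.
\<close>

lemma coaction_degree: assumes "\<gamma> \<in> \<Omega>H n" shows "coaction \<gamma> \<in> tensor_space sH sH H (\<Omega>H n)"
proof -
  let ?p = "UU.lift (\<lambda>x y. component \<Omega>H 0 x \<otimes>\<^sub>H y)"
  let ?K = "tensor_space sH sH H (\<Omega>H n)"
  have U: "tensor_space sH sH (\<Omega>H (n - i)) (\<Omega>H i) \<subseteq> UU.space" for i
    by (rule tensor_space_mono) auto
  have p: "linear_map tscale tscale UU.space UNIV ?p"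
    by (rule UU.lift_linear[OF vector_space_tscale bilin_UU[OF bilin_tensor]])
  have "?p t \<in> ?K" if t: "t \<in> tensor_space sH sH (\<Omega>H (n - i)) (\<Omega>H i)" "i \<le> n" for t i
  proof (rule linear_map_span_in[OF vector_space_tscale vector_space_tscale subspace_tensor_space p _ subspace_tensor_space])
    show "t \<in> tens.span {x \<otimes>\<^sub>H y | x y. x \<in> \<Omega>H (n - i) \<and> y \<in> \<Omega>H i}"
      using t(1) by (simp add: tensor_space_def)
    show "{x \<otimes>\<^sub>H y | x y. x \<in> \<Omega>H (n - i) \<and> y \<in> \<Omega>H i} \<subseteq> UU.space"
      by (auto intro: tensor_in)
    fix z assume "z \<in> {x \<otimes>\<^sub>H y | x y. x \<in> \<Omega>H (n - i) \<and> y \<in> \<Omega>H i}"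
    then obtain x y where z: "z = x \<otimes>\<^sub>H y" "x \<in> \<Omega>H (n - i)" "y \<in> \<Omega>H i" by blast
    have pz: "?p z = component \<Omega>H 0 x \<otimes>\<^sub>H y"
      unfolding z(1) by (rule UU.lift_pure[OF vector_space_tscale bilin_UU[OF bilin_tensor]]) auto
    show "?p z \<in> ?K"
    proof (cases "i = n")
      case True
      then show ?thesis using z pz by (auto intro: tensor_in component_0_in)
    next
      case False
      then have "component \<Omega>H 0 x = 0" using component_homogeneous[OF z(2), of 0] t(2) by simp
      then show ?thesis
        using pz by (simp only: UU.pure_zero_left tens.subspace_0[OF subspace_tensor_space])
    qed
  qed
  hence K: "\<And>t. t \<in> (\<Union>i\<le>n. tensor_space sH sH (\<Omega>H (n - i)) (\<Omega>H i)) \<Longrightarrow> ?p t \<in> ?K" by blast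
  have "?p (\<Delta>\<Omega> \<gamma>) \<in> ?K"
  proof (rule linear_map_span_in[OF vector_space_tscale vector_space_tscale subspace_tensor_space p _ subspace_tensor_space K])
    show "(\<Union>i\<le>n. tensor_space sH sH (\<Omega>H (n - i)) (\<Omega>H i)) \<subseteq> UU.space" using U by blast
    show "\<Delta>\<Omega> \<gamma> \<in> tens.span (\<Union>i\<le>n. tensor_space sH sH (\<Omega>H (n - i)) (\<Omega>H i))"
      using \<Delta>\<Omega>_degree[OF assms] unfolding tensor_degree_def .
  qed assumption
  thus ?thesis unfolding coaction_def .
qed

text \<open>
  Properties of the coaction are derived from those of \<open>\<Delta>\<Omega>\<close> by composing test functions with the
  projection of the first factor to degree 0.
\<close>

lemma cosweedler2_eq_lift:
  assumes "vector_space sU" "HU.bilin sU f"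
  shows "cosweedler2 f \<gamma> = UU.lift (\<lambda>x y. f (component \<Omega>H 0 x) y) (\<Delta>\<Omega> \<gamma>)"
proof -
  have "cosweedler2 f \<gamma> = UU.lift (\<lambda>x y. HU.lift f (component \<Omega>H 0 x \<otimes>\<^sub>H y)) (\<Delta>\<Omega> \<gamma>)"
    unfolding cosweedler2_def coaction_def
    by (rule UU.lift_push[OF \<Delta>\<Omega>_in vector_space_tscale assms(1) bilin_UU[OF bilin_tensor]
          HU.lift_linear[OF assms] subspace_tensor_space]) (simp add: tensor_in component_0_in)
  also have "\<dots> = UU.lift (\<lambda>x y. f (component \<Omega>H 0 x) y) (\<Delta>\<Omega> \<gamma>)"
    by (rule UU.lift_cong) (simp add: HU.lift_pure[OF assms] component_0_in)
  finally show ?thesis .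
qed

lemma cosweedler2_linear:
  assumes "vector_space sU" "HU.bilin sU f" "linear_map s sH A UNIV g"
  shows "linear_map s sU A UNIV (\<lambda>a. cosweedler2 f (g a))"
  unfolding cosweedler2_def
  by (rule linear_map_comp_on[OF HU.lift_linear[OF assms(1,2)]
        linear_map_comp[OF linear_coaction assms(3)]])

lemma cosweedler2_linear_param:
  assumes "vector_space sU" "vector_space s" "module.subspace s A"
    and "\<And>a. a \<in> A \<Longrightarrow> HU.bilin sU (g a)"
    and "\<And>v w. v \<in> H \<Longrightarrow> linear_map s sU A UNIV (\<lambda>a. g a v w)"
  shows "linear_map s sU A UNIV (\<lambda>a. cosweedler2 (g a) \<gamma>)"
  unfolding cosweedler2_def
  by (rule HU.lift_linear_param[OF coaction_in assms(1-5)])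

lemma cosweedler2_push:
  assumes "vector_space sU" "vector_space sX" "linear_map sU sX M X L" "module.subspace sU M"
    and "HU.bilin sU g" "\<And>v w. v \<in> H \<Longrightarrow> g v w \<in> M"
  shows "L (cosweedler2 g \<gamma>) = cosweedler2 (\<lambda>v w. L (g v w)) \<gamma>"
  unfolding cosweedler2_def
  by (rule HU.lift_push[OF coaction_in assms(1,2,5,3,4,6)])

lemma cosweedler2_cong:
  "(\<And>v w. v \<in> H \<Longrightarrow> g v w = g' v w) \<Longrightarrow> cosweedler2 g \<gamma> = cosweedler2 g' \<gamma>"
  unfolding cosweedler2_def by (rule HU.lift_cong)

lemma cosweedler2_swap:
  assumes "vector_space sU"
    and "\<And>v w. v \<in> H \<Longrightarrow> HU.bilin sU (f v w)"
    and "\<And>v' w'. v' \<in> H \<Longrightarrow> HU.bilin sU (\<lambda>v w. f v w v' w')"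
  shows "cosweedler2 (\<lambda>v w. cosweedler2 (f v w) \<gamma>') \<gamma> = cosweedler2 (\<lambda>v' w'. cosweedler2 (\<lambda>v w. f v w v' w') \<gamma>) \<gamma>'"
  unfolding cosweedler2_def
  by (rule HU.lift_swap[OF HU.tensor_pair_axioms coaction_in coaction_in assms])

lemma coproduct_in: "h \<in> H \<Longrightarrow> \<Delta> h \<in> HH.space"
  by (rule linear_mapD(1)[OF linear_coproduct])

lemma sweedler2_linear:
  assumes "vector_space sU" "HH.bilin sU f" "linear_map s sH A H g"
  shows "linear_map s sU A UNIV (\<lambda>a. sweedler2 f (g a))"
  unfolding sweedler2_def
  by (rule linear_map_comp_on[OF HH.lift_linear[OF assms(1,2)]
        linear_map_comp_on[OF linear_coproduct assms(3)]])

lemma sweedler2_linear_param: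
  assumes "vector_space sU" "module.subspace sH A" "h \<in> H"
    and "\<And>a. a \<in> A \<Longrightarrow> HH.bilin sU (g a)"
    and "\<And>v w. v \<in> H \<Longrightarrow> w \<in> H \<Longrightarrow> linear_map sH sU A UNIV (\<lambda>a. g a v w)"
  shows "linear_map sH sU A UNIV (\<lambda>a. sweedler2 (g a) h)"
  unfolding sweedler2_def
  by (rule HH.lift_linear_param[OF coproduct_in[OF assms(3)] assms(1) vector_space_sH assms(2,4,5)])

lemma sweedler2_push:
  assumes "vector_space sU" "vector_space sX" "linear_map sU sX M X L" "module.subspace sU M"
    and "HH.bilin sU g" "\<And>v w. v \<in> H \<Longrightarrow> w \<in> H \<Longrightarrow> g v w \<in> M" "h \<in> H"
  shows "L (sweedler2 g h) = sweedler2 (\<lambda>v w. L (g v w)) h"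
  unfolding sweedler2_def
  by (rule HH.lift_push[OF coproduct_in[OF assms(7)] assms(1,2,5,3,4,6)])

lemma sweedler2_in:
  assumes "vector_space sU" "module.subspace sU M" "HH.bilin sU g"
    "\<And>v w. v \<in> H \<Longrightarrow> w \<in> H \<Longrightarrow> g v w \<in> M" "h \<in> H"
  shows "sweedler2 g h \<in> M"
  unfolding sweedler2_def by (rule HH.lift_in[OF coproduct_in[OF assms(5)] assms(1,3,2,4)])

lemma sweedler2_cong:
  "(\<And>v w. v \<in> H \<Longrightarrow> w \<in> H \<Longrightarrow> g v w = g' v w) \<Longrightarrow> sweedler2 g h = sweedler2 g' h"
  unfolding sweedler2_def by (rule HH.lift_cong)

lemma cosweedler2_sweedler2_swap:
  assumes "vector_space sU" "h \<in> H"
    and "\<And>v w. v \<in> H \<Longrightarrow> HH.bilin sU (f v w)"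
    and "\<And>v' w'. v' \<in> H \<Longrightarrow> w' \<in> H \<Longrightarrow> HU.bilin sU (\<lambda>v w. f v w v' w')"
  shows "cosweedler2 (\<lambda>v w. sweedler2 (f v w) h) \<gamma> = sweedler2 (\<lambda>v' w'. cosweedler2 (\<lambda>v w. f v w v' w') \<gamma>) h"
  unfolding cosweedler2_def sweedler2_def
  by (rule HU.lift_swap[OF HH.tensor_pair_axioms coaction_in coproduct_in[OF assms(2)] assms(1,3,4)])

lemma cosweedler2_algebra:
  assumes "vector_space sU" "HU.bilin sU f" "h \<in> H"
  shows "cosweedler2 f h = sweedler2 f h"
  unfolding cosweedler2_def sweedler2_def coaction_algebra[OF assms(3)]
  by (rule HU.lift_subspaces[OF HH.tensor_pair_axioms subset_refl subset_UNIV assms(1,2)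
        coproduct_in[OF assms(3)], symmetric])

lemma sweedler2_one:
  assumes "vector_space sU" "HH.bilin sU f"
  shows "sweedler2 f 1 = f 1 1"
  unfolding sweedler2_def coproduct_one by (rule HH.lift_pure[OF assms one_A one_A])

lemma cosweedler2_one:
  assumes "vector_space sU" "HU.bilin sU f"
  shows "cosweedler2 f 1 = f 1 1"
  unfolding cosweedler2_algebra[OF assms one_A]
  by (rule sweedler2_one[OF assms(1) bilinear_map_subset[OF assms(2)]]) auto

text \<open>
  In \<open>dH x \<otimes> y \<plusminus> x \<otimes> dH y\<close> the first summand has no component of degree 0 in its first factor,
  and the second one only has one for \<open>x\<close> of degree 0, where the sign is \<open>+\<close>.
\<close>

lemma cosweedler2_d:
  assumes "vector_space sU" "HU.bilin sU f"
  shows "cosweedler2 f (dH \<gamma>) = cosweedler2 (\<lambda>x y. f x (dH y)) \<gamma>"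
proof -
  interpret U: vector_space sU by fact
  let ?F = "\<lambda>x y. f (component \<Omega>H 0 x) y"
  let ?g = "\<lambda>x y. dH x \<otimes>\<^sub>H y + by_degree \<Omega>H (\<lambda>i x. tscale ((-1) ^ i) (x \<otimes>\<^sub>H dH y)) x"
  have F: "UU.bilin sU ?F" by (rule bilin_UU[OF assms(2)])
  have f': "HU.bilin sU (\<lambda>x y. f x (dH y))"
    by (rule bilinear_mapI)
      (auto intro: bilinear_mapD(2)[OF assms(2)] linear_map_comp[OF bilinear_mapD(1)[OF assms(2)]] linear_d_UNIV)
  have g: "UU.bilin tscale ?g"
    by (rule bilinear_mapI)
      (auto intro!: linear_map_add vector_space_tscale linear_tensor_left linear_tensor_right
        linear_d_UNIV linear_map_ident linear_by_degree linear_by_degree_param linear_map_scale)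
  have "cosweedler2 f (dH \<gamma>) = UU.lift ?F (UU.lift ?g (\<Delta>\<Omega> \<gamma>))"
    by (simp add: cosweedler2_eq_lift[OF assms] \<Delta>\<Omega>_d tensor_d_def)
  also have "\<dots> = UU.lift (\<lambda>x y. UU.lift ?F (?g x y)) (\<Delta>\<Omega> \<gamma>)"
  proof (rule UU.lift_push[OF \<Delta>\<Omega>_in vector_space_tscale assms(1) g UU.lift_linear[OF assms(1) F] subspace_tensor_space])
    show "?g x y \<in> UU.space" for x y
      unfolding by_degree_def
      by (intro tens.subspace_add[OF subspace_tensor_space] tens.subspace_sum[OF subspace_tensor_space]
          tens.subspace_scale[OF subspace_tensor_space] tensor_in) auto
  qed
  also have "\<dots> = UU.lift (\<lambda>x y. f (component \<Omega>H 0 x) (dH y)) (\<Delta>\<Omega> \<gamma>)"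
  proof (rule UU.lift_cong)
    fix x y
    have g_in: "?g x y \<in> UU.space" for x
      unfolding by_degree_def
      by (intro tens.subspace_add[OF subspace_tensor_space] tens.subspace_sum[OF subspace_tensor_space]
          tens.subspace_scale[OF subspace_tensor_space] tensor_in) auto
    show "UU.lift ?F (?g x y) = f (component \<Omega>H 0 x) (dH y)"
    proof (rule linear_eq_homogeneous[where f = "\<lambda>x. UU.lift ?F (?g x y)" and sU = sU])
      show "linear_map sH sU UNIV UNIV (\<lambda>x. UU.lift ?F (?g x y))"
        by (rule linear_map_comp_on[OF UU.lift_linear[OF assms(1) F]
            linear_map_codomain[OF bilinear_mapD(2)[OF g UNIV_I] g_in]])
      show "linear_map sH sU UNIV UNIV (\<lambda>x. f (component \<Omega>H 0 x) (dH y))"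
        by (rule bilinear_mapD(2)[OF bilin_UU[OF f'] UNIV_I])
      fix n x assume x: "x \<in> \<Omega>H n"
      have dx: "f (component \<Omega>H 0 (dH x)) y = 0"
        unfolding component_0_d
        by (rule linear_map_zero[OF vector_space_sH assms(1) subspace_A bilinear_mapD(2)[OF assms(2) UNIV_I]])
      have z: "f (component \<Omega>H 0 x) (dH y) = 0" if "n > 0"
        using component_homogeneous[OF x, of 0] that
          linear_map_zero[OF vector_space_sH assms(1) subspace_A bilinear_mapD(2)[OF assms(2) UNIV_I], of "dH y"]
        by simp
      have "?g x y = dH x \<otimes>\<^sub>H y + tscale ((-1) ^ n) (x \<otimes>\<^sub>H dH y)"
        using by_degree_homogeneous[OF x, of "\<lambda>i x. tscale ((-1) ^ i) (x \<otimes>\<^sub>H dH y)"]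
        by (simp add: UU.pure_zero_left tens.scale_zero_right)
      hence "UU.lift ?F (?g x y) = UU.lift ?F (dH x \<otimes>\<^sub>H y) + sU ((-1) ^ n) (UU.lift ?F (x \<otimes>\<^sub>H dH y))"
        using linear_mapD(2)[OF UU.lift_linear[OF assms(1) F], of "dH x \<otimes>\<^sub>H y" "tscale ((-1) ^ n) (x \<otimes>\<^sub>H dH y)"]
          linear_mapD(3)[OF UU.lift_linear[OF assms(1) F], of "x \<otimes>\<^sub>H dH y" "(-1) ^ n"]
          tensor_in[of "dH x" UNIV y UNIV sH sH] tens.subspace_scale[OF subspace_tensor_space tensor_in[of x UNIV "dH y" UNIV sH sH]]
          tensor_in[of x UNIV "dH y" UNIV sH sH]
        by simp
      also have "\<dots> = f (component \<Omega>H 0 x) (dH y)"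
        unfolding UU.lift_pure[OF assms(1) F UNIV_I UNIV_I] dx using z by (cases "n = 0") simp_all
      finally show "UU.lift ?F (?g x y) = f (component \<Omega>H 0 x) (dH y)" .
    qed
  qed
  also have "\<dots> = cosweedler2 (\<lambda>x y. f x (dH y)) \<gamma>"
    by (rule cosweedler2_eq_lift[OF assms(1) f', symmetric])
  finally show ?thesis .
qed


section \<open>Multilinear Sweedler expressions\<close>

lemma linear_ident_H: "linear_map sH sH H H (\<lambda>x. x)"
  by (simp add: linear_map_def)

lemma linear_mult_left_H:
  "linear_map s sH A H g \<Longrightarrow> c \<in> H \<Longrightarrow> linear_map s sH A H (\<lambda>a. g a * c)"
  by (simp add: linear_map_def distrib_right scale_mult_left mult_A)

lemma linear_mult_right_H:
  "linear_map s sH A H g \<Longrightarrow> c \<in> H \<Longrightarrow> linear_map s sH A H (\<lambda>a. c * g a)"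
  by (simp add: linear_map_def distrib_left scale_mult_right mult_A)

lemma linear_antipode_comp: "linear_map s sH A H g \<Longrightarrow> linear_map s sH A H (\<lambda>a. S (g a))"
  by (rule linear_map_comp_on[OF linear_antipode])

lemma linear_counit_scale:
  assumes "vector_space sU" "linear_map s sH A H g"
  shows "linear_map s sU A UNIV (\<lambda>a. sU (\<epsilon> (g a)) x)"
proof -
  interpret U: vector_space sU by fact
  show ?thesis using assms(2) linear_counit by (simp add: linear_map_def U.scale_left_distrib)
qed

lemma linear_H_UNIV: "linear_map s sH A H g \<Longrightarrow> linear_map s sH A UNIV g"
  by (simp add: linear_map_def)

lemma HU_bilin_left: "HU.bilin sU f \<Longrightarrow> linear_map s sH A H g \<Longrightarrow> linear_map s sU A UNIV (\<lambda>a. f (g a) y)"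
  by (rule linear_map_comp_on[OF bilinear_mapD(2)]) auto

lemma HU_bilin_right: "HU.bilin sU f \<Longrightarrow> x \<in> H \<Longrightarrow> linear_map s sH A UNIV g \<Longrightarrow> linear_map s sU A UNIV (\<lambda>a. f x (g a))"
  by (rule linear_map_comp[OF bilinear_mapD(1)]) auto

lemma HH_bilin_left: "HH.bilin sU f \<Longrightarrow> y \<in> H \<Longrightarrow> linear_map s sH A H g \<Longrightarrow> linear_map s sU A UNIV (\<lambda>a. f (g a) y)"
  by (rule linear_map_comp_on[OF bilinear_mapD(2)]) auto

lemma HH_bilin_right: "HH.bilin sU f \<Longrightarrow> x \<in> H \<Longrightarrow> linear_map s sH A H g \<Longrightarrow> linear_map s sU A UNIV (\<lambda>a. f x (g a))"
  by (rule linear_map_comp_on[OF bilinear_mapD(1)]) auto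

text \<open>
  In the Sweedler expressions below each variable occurs exactly once, so its linearity follows by
  descending to its occurrence: at each node at most one of these rules applies.
\<close>

lemmas multilinear_intros =
  linear_map_ident linear_ident_H linear_mult_left_H linear_mult_right_H linear_antipode_comp
  linear_mult_left linear_mult_right linear_counit_scale linear_map_scale
  linear_tensor_left linear_tensor_right
  cosweedler2_linear cosweedler2_linear_param sweedler2_linear sweedler2_linear_param
  bilinear_mapI mult_A subspace_A subspace_UNIV vector_space_sH vector_space_tscale linear_antipode
  linear_mapD(1)[OF linear_antipode]

definition trilin ::
  "('k \<Rightarrow> 'u::ab_group_add \<Rightarrow> 'u) \<Rightarrow> ('h \<Rightarrow> 'h \<Rightarrow> 'h \<Rightarrow> 'u) \<Rightarrow> bool" where
  "trilin sU f \<longleftrightarrow> (\<forall>x\<in>H. HU.bilin sU (f x)) \<and> (\<forall>u\<in>H. \<forall>y. linear_map sH sU H UNIV (\<lambda>x. f x u y))"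

lemma trilinI:
  assumes "\<And>u y. u \<in> H \<Longrightarrow> linear_map sH sU H UNIV (\<lambda>x. f x u y)"
    and "\<And>x y. x \<in> H \<Longrightarrow> linear_map sH sU H UNIV (\<lambda>u. f x u y)"
    and "\<And>x u. x \<in> H \<Longrightarrow> u \<in> H \<Longrightarrow> linear_map sH sU UNIV UNIV (\<lambda>y. f x u y)"
  shows "trilin sU f"
  using assms by (simp add: trilin_def bilinear_map_def)

lemma trilinD:
  assumes "trilin sU f"
  shows "linear_map s sH A H g \<Longrightarrow> u \<in> H \<Longrightarrow> linear_map s sU A UNIV (\<lambda>a. f (g a) u y)"
    and "x \<in> H \<Longrightarrow> linear_map s sH A H g \<Longrightarrow> linear_map s sU A UNIV (\<lambda>a. f x (g a) y)"
    and "x \<in> H \<Longrightarrow> u \<in> H \<Longrightarrow> linear_map s sH A UNIV g \<Longrightarrow> linear_map s sU A UNIV (\<lambda>a. f x u (g a))"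
proof -
  have f: "HU.bilin sU (f x)" "linear_map sH sU H UNIV (\<lambda>x. f x u y)" if "x \<in> H" "u \<in> H" for x u y
    using assms that by (simp_all add: trilin_def)
  show "linear_map s sH A H g \<Longrightarrow> u \<in> H \<Longrightarrow> linear_map s sU A UNIV (\<lambda>a. f (g a) u y)"
    by (rule linear_map_comp_on[OF f(2)[OF one_A]])
  show "x \<in> H \<Longrightarrow> linear_map s sH A H g \<Longrightarrow> linear_map s sU A UNIV (\<lambda>a. f x (g a) y)"
    by (rule HU_bilin_left[OF f(1)[OF _ one_A]])
  show "x \<in> H \<Longrightarrow> u \<in> H \<Longrightarrow> linear_map s sH A UNIV g \<Longrightarrow> linear_map s sU A UNIV (\<lambda>a. f x u (g a))"
    by (rule HU_bilin_right[OF f(1)[OF _ one_A]])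
qed

lemma trilin_bilin: "trilin sU f \<Longrightarrow> x \<in> H \<Longrightarrow> HU.bilin sU (f x)"
  by (simp add: trilin_def)

lemma trilin_bilin_HH: "trilin sU f \<Longrightarrow> HH.bilin sU (\<lambda>u v. f u v y)"
  by (rule bilinear_mapI) (auto intro: trilinD(1,2)[of sU f] linear_ident_H)

lemma bilin_cosweedler2:
  assumes U: "vector_space sU" and f: "trilin sU f"
  shows "HU.bilin sU (\<lambda>x y. cosweedler2 (f x) y)"
  by (auto intro!: bilinear_mapI cosweedler2_linear_param cosweedler2_linear trilin_bilin[OF f] trilinD(1)[OF f]
      linear_ident_H linear_map_ident subspace_A U vector_space_sH)

lemma bilin_sweedler2:
  assumes U: "vector_space sU" and f: "trilin sU f"
  shows "HU.bilin sU (\<lambda>x y. sweedler2 (\<lambda>u v. f u v y) x)"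
  by (auto intro!: bilinear_mapI sweedler2_linear_param sweedler2_linear trilin_bilin_HH[OF f] trilinD(3)[OF f]
      linear_ident_H linear_map_ident U)

lemma sweedler2_mult:
  assumes U: "vector_space sU" and f: "HH.bilin sU f" and h: "h \<in> H" and h': "h' \<in> H"
  shows "sweedler2 f (h * h') = sweedler2 (\<lambda>x y. sweedler2 (\<lambda>x' y'. f (x * x') (y * y')) h') h"
proof -
  note ml = multilinear_intros h' HH_bilin_left[OF f] HH_bilin_right[OF f]
  have b: "HH.bilin tscale (\<lambda>x' y'. (x * x') \<otimes>\<^sub>H (y * y'))" for x y
    by (auto intro!: ml)
  have m: "sweedler2 (\<lambda>x' y'. (x * x') \<otimes>\<^sub>H (y * y')) h' \<in> HH.space" if "x \<in> H" "y \<in> H" for x y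
    by (rule sweedler2_in[OF vector_space_tscale subspace_tensor_space b _ h'])
      (auto intro!: tensor_in mult_A that)
  have "sweedler2 f (h * h') = HH.lift f (\<Delta> (h * h'))" by (simp add: sweedler2_def)
  also have "\<dots> = HH.lift f (sweedler2 (\<lambda>x y. sweedler2 (\<lambda>x' y'. (x * x') \<otimes>\<^sub>H (y * y')) h') h)"
    by (simp add: coproduct_mult h h')
  also have "\<dots> = sweedler2 (\<lambda>x y. HH.lift f (sweedler2 (\<lambda>x' y'. (x * x') \<otimes>\<^sub>H (y * y')) h')) h"
    by (rule sweedler2_push[OF vector_space_tscale U HH.lift_linear[OF U f] subspace_tensor_space _ _ h])
      (auto intro!: ml m)
  also have "\<dots> = sweedler2 (\<lambda>x y. sweedler2 (\<lambda>x' y'. HH.lift f ((x * x') \<otimes>\<^sub>H (y * y'))) h') h"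
    by (rule sweedler2_cong,
        rule sweedler2_push[OF vector_space_tscale U HH.lift_linear[OF U f] subspace_tensor_space b _ h'])
      (auto intro!: tensor_in mult_A)
  also have "\<dots> = sweedler2 (\<lambda>x y. sweedler2 (\<lambda>x' y'. f (x * x') (y * y')) h') h"
    by (intro sweedler2_cong) (simp add: HH.lift_pure[OF U f] mult_A)
  finally show ?thesis .
qed

text \<open>
  The wedge product on \<open>\<Omega>H \<otimes> \<Omega>H\<close> has the sign \<open>(-1) ^ (j * k)\<close>, where \<open>k\<close> is the degree of the first
  factor of the second tensor. Projecting that factor to degree 0 leaves only \<open>k = 0\<close>, so that the
  coaction is multiplicative without signs.
\<close>

lemma cosweedler2_mult:
  assumes U: "vector_space sU" and f: "HU.bilin sU f"
  shows "cosweedler2 f (\<gamma> * \<gamma>') = cosweedler2 (\<lambda>x y. cosweedler2 (\<lambda>x' y'. f (x * x') (y * y')) \<gamma>') \<gamma>"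
proof -
  interpret U: vector_space sU by fact
  let ?c = "component \<Omega>H 0"
  define F where "F = (\<lambda>x y. f (?c x) y)"
  define W where "W = (\<lambda>x y x' y'. by_degree \<Omega>H (\<lambda>j y. by_degree \<Omega>H (\<lambda>k x'.
         tscale ((-1) ^ (j * k)) ((x * x') \<otimes>\<^sub>H (y * y'))) x') y)"
  have F: "UU.bilin sU F" unfolding F_def by (rule bilin_UU[OF f])
  note lin = linear_map_scale vector_space_tscale linear_tensor_left linear_tensor_right
    linear_mult_left linear_mult_right linear_map_ident
  have W1: "linear_map sH tscale UNIV UNIV (\<lambda>x. W x y x' y')" for y x' y'
    unfolding W_def by (intro linear_by_degree_param lin)
  have W2: "linear_map sH tscale UNIV UNIV (\<lambda>y. W x y x' y')" for x x' y'
    unfolding W_def by (intro linear_by_degree linear_by_degree_param lin)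
  have W3: "linear_map sH tscale UNIV UNIV (\<lambda>x'. W x y x' y')" for x y y'
    unfolding W_def by (rule linear_by_degree_param[OF vector_space_tscale]) (intro linear_by_degree lin)
  have W4: "linear_map sH tscale UNIV UNIV (\<lambda>y'. W x y x' y')" for x y x'
    unfolding W_def by (intro linear_by_degree_param lin)
  have W_in: "W x y x' y' \<in> UU.space" for x y x' y'
    unfolding W_def by_degree_def
    by (intro tens.subspace_sum[OF subspace_tensor_space]
        tens.subspace_scale[OF subspace_tensor_space] tensor_in) auto
  have W34: "UU.bilin tscale (W x y)" for x y
    by (rule bilinear_mapI[OF W4 W3])
  have LW_in: "UU.lift (W x y) t \<in> UU.space" if "t \<in> UU.space" for x y t
    by (rule UU.lift_in[OF that vector_space_tscale W34 subspace_tensor_space W_in])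
  have W12: "UU.bilin tscale (\<lambda>x y. UU.lift (W x y) t)" if "t \<in> UU.space" for t
    by (rule bilinear_mapI;
        rule UU.lift_linear_param[OF that vector_space_tscale vector_space_sH subspace_UNIV W34])
      (rule W1 W2)+
  note LF = UU.lift_linear[OF U F]
  have eval: "UU.lift F (W x y x' y') = f (?c x * ?c x') (y * y')" for x y x' y'
  proof (rule linear_eq_homogeneous[where f = "\<lambda>y. UU.lift F (W x y x' y')" and sU = sU])
    show "linear_map sH sU UNIV UNIV (\<lambda>y. UU.lift F (W x y x' y'))"
      by (rule linear_map_comp_on[OF LF linear_map_codomain[OF W2 W_in]])
    show "linear_map sH sU UNIV UNIV (\<lambda>y. f (?c x * ?c x') (y * y'))"
      by (intro HU_bilin_right[OF f] mult_A component_0_in linear_mult_left linear_map_ident)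
    fix j y assume y: "y \<in> \<Omega>H j"
    show "UU.lift F (W x y x' y') = f (?c x * ?c x') (y * y')"
    proof (rule linear_eq_homogeneous[where f = "\<lambda>x'. UU.lift F (W x y x' y')" and sU = sU])
      show "linear_map sH sU UNIV UNIV (\<lambda>x'. UU.lift F (W x y x' y'))"
        by (rule linear_map_comp_on[OF LF linear_map_codomain[OF W3 W_in]])
      show "linear_map sH sU UNIV UNIV (\<lambda>x'. f (?c x * ?c x') (y * y'))"
        by (intro HU_bilin_left[OF f] linear_mult_right_H component_0_in
            linear_component[of 0, unfolded degree_0])
      fix k x' assume x': "x' \<in> \<Omega>H k"
      have "W x y x' y' = by_degree \<Omega>H (\<lambda>k x'. tscale ((-1) ^ (j * k)) ((x * x') \<otimes>\<^sub>H (y * y'))) x'"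
        unfolding W_def by (rule by_degree_homogeneous[OF y])
          (simp add: by_degree_def UU.pure_zero_right tens.scale_zero_right)
      also have "\<dots> = tscale ((-1) ^ (j * k)) ((x * x') \<otimes>\<^sub>H (y * y'))"
        by (rule by_degree_homogeneous[OF x']) (simp add: UU.pure_zero_left tens.scale_zero_right)
      finally have "UU.lift F (W x y x' y') = sU ((-1) ^ (j * k)) (f (?c x * ?c x') (y * y'))"
        using linear_mapD(3)[OF LF tensor_in[OF UNIV_I UNIV_I]] UU.lift_pure[OF U F UNIV_I UNIV_I]
        by (simp add: F_def component_0_mult)
      \<comment> \<open>For \<open>k = 0\<close> the sign is 1; for \<open>k > 0\<close> both sides vanish.\<close>
      also have "\<dots> = f (?c x * ?c x') (y * y')"
      proof (cases "k = 0")
        case False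
        then have "?c x' = 0" using component_homogeneous[OF x', of 0] by simp
        moreover have "f 0 z = 0" for z
          by (rule linear_map_zero[OF vector_space_sH U subspace_A bilinear_mapD(2)[OF f UNIV_I]])
        ultimately show ?thesis by simp
      qed simp
      finally show "UU.lift F (W x y x' y') = f (?c x * ?c x') (y * y')" .
    qed
  qed
  have "cosweedler2 f (\<gamma> * \<gamma>') = UU.lift F (UU.lift (\<lambda>x y. UU.lift (W x y) (\<Delta>\<Omega> \<gamma>')) (\<Delta>\<Omega> \<gamma>))"
    unfolding cosweedler2_eq_lift[OF U f] \<Delta>\<Omega>_mult tensor_wedge_def F_def W_def ..
  also have "\<dots> = UU.lift (\<lambda>x y. UU.lift F (UU.lift (W x y) (\<Delta>\<Omega> \<gamma>'))) (\<Delta>\<Omega> \<gamma>)"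
    by (rule UU.lift_push[OF \<Delta>\<Omega>_in vector_space_tscale U W12[OF \<Delta>\<Omega>_in] LF subspace_tensor_space LW_in[OF \<Delta>\<Omega>_in]])
  also have "\<dots> = UU.lift (\<lambda>x y. UU.lift (\<lambda>x' y'. UU.lift F (W x y x' y')) (\<Delta>\<Omega> \<gamma>')) (\<Delta>\<Omega> \<gamma>)"
    by (rule UU.lift_cong, rule UU.lift_push[OF \<Delta>\<Omega>_in vector_space_tscale U W34 LF subspace_tensor_space W_in])
  also have "\<dots> = UU.lift (\<lambda>x y. UU.lift (\<lambda>x' y'. f (?c x * ?c x') (y * y')) (\<Delta>\<Omega> \<gamma>')) (\<Delta>\<Omega> \<gamma>)"
    by (simp only: eval)
  also have "\<dots> = UU.lift (\<lambda>x y. cosweedler2 (\<lambda>x' y'. f (?c x * x') (y * y')) \<gamma>') (\<Delta>\<Omega> \<gamma>)"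
    by (rule UU.lift_cong, rule cosweedler2_eq_lift[symmetric, OF U])
      (auto intro!: multilinear_intros HU_bilin_left[OF f] HU_bilin_right[OF f] component_0_in)
  also have "\<dots> = cosweedler2 (\<lambda>x y. cosweedler2 (\<lambda>x' y'. f (x * x') (y * y')) \<gamma>') \<gamma>"
    by (rule cosweedler2_eq_lift[symmetric, OF U])
      (auto intro!: U multilinear_intros HU_bilin_left[OF f] HU_bilin_right[OF f])
  finally show ?thesis .
qed

section \<open>The comodule axioms\<close>

text \<open>
  The map \<open>\<gamma> \<mapsto> \<epsilon>(\<gamma>\<^sub>-\<^sub>1) \<gamma>\<^sub>0\<close> is multiplicative, commutes with \<open>dH\<close> and is the identity on \<open>H\<close> by the
  counit axiom, hence it is the identity.
\<close>

lemma coaction_counit: "cosweedler2 (\<lambda>x y. sH (\<epsilon> x) y) \<gamma> = \<gamma>"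
proof -
  have bil: "HU.bilin sH (\<lambda>x y. sH (\<epsilon> x) y)" by (auto intro!: multilinear_intros)
  note lin = cosweedler2_linear[OF vector_space_sH bil linear_map_ident, of UNIV]
  show ?thesis
  proof (induction \<gamma> rule: calculus_induct)
    case (algebra h)
    show ?case unfolding cosweedler2_algebra[OF vector_space_sH bil algebra] by (rule counit_left[OF algebra])
  next
    case (add x y)
    then show ?case by (simp add: linear_mapD(2)[OF lin])
  next
    case (scale c x)
    then show ?case by (simp add: linear_mapD(3)[OF lin])
  next
    case (mult \<gamma> \<gamma>')
    have "cosweedler2 (\<lambda>x y. sH (\<epsilon> x) y) (\<gamma> * \<gamma>') =
        cosweedler2 (\<lambda>x y. cosweedler2 (\<lambda>x' y'. sH (\<epsilon> (x * x')) (y * y')) \<gamma>') \<gamma>"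
      by (rule cosweedler2_mult[OF vector_space_sH bil])
    also have "\<dots> = cosweedler2 (\<lambda>x y. cosweedler2 (\<lambda>x' y'. sH (\<epsilon> x) y * sH (\<epsilon> x') y') \<gamma>') \<gamma>"
      by (intro cosweedler2_cong)
        (simp add: counit_mult scale_mult_left[symmetric] scale_mult_right[symmetric])
    also have "\<dots> = cosweedler2 (\<lambda>x y. sH (\<epsilon> x) y * cosweedler2 (\<lambda>x' y'. sH (\<epsilon> x') y') \<gamma>') \<gamma>"
      by (rule cosweedler2_cong, rule cosweedler2_push[symmetric, OF vector_space_sH vector_space_sH _ subspace_UNIV bil])
        (auto intro!: multilinear_intros)
    also have "\<dots> = cosweedler2 (\<lambda>x y. sH (\<epsilon> x) y) \<gamma> * \<gamma>'"
      unfolding mult(2)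
      by (rule cosweedler2_push[symmetric, OF vector_space_sH vector_space_sH _ subspace_UNIV bil])
        (auto intro!: multilinear_intros)
    finally show ?case by (simp add: mult)
  next
    case (diff x)
    have "cosweedler2 (\<lambda>x y. sH (\<epsilon> x) y) (dH x) = cosweedler2 (\<lambda>x y. sH (\<epsilon> x) (dH y)) x"
      by (rule cosweedler2_d[OF vector_space_sH bil])
    also have "\<dots> = cosweedler2 (\<lambda>x y. dH (sH (\<epsilon> x) y)) x"
      by (rule cosweedler2_cong) (simp add: linear_mapD(3)[OF linear_d_UNIV[of UNIV]])
    also have "\<dots> = dH (cosweedler2 (\<lambda>x y. sH (\<epsilon> x) y) x)"
      by (rule cosweedler2_push[symmetric, OF vector_space_sH vector_space_sH linear_d_UNIV subspace_UNIV bil]) simp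
    finally show ?case by (simp add: diff)
  qed
qed


text \<open>
  The coassociativity axiom is an equation between triple tensors. Every trilinear \<open>f\<close> factors through
  the triple tensor product, by the map \<open>?L\<close> below, and is applied to both sides of that equation.
\<close>

lemma coaction_coassoc_algebra:
  assumes U: "vector_space sU" and f: "trilin sU f" and h: "h \<in> H"
  shows "sweedler2 (\<lambda>x y. sweedler2 (f x) y) h = sweedler2 (\<lambda>x y. sweedler2 (\<lambda>u v. f u v y) x) h"
proof -
  interpret P: tensor_pair sH tscale H HH.space
    by unfold_locales (auto simp: subspace_A subspace_tensor_space)
  have fb: "HH.bilin sU (f x)" if "x \<in> H" for x
    by (rule bilinear_map_subset[OF trilin_bilin[OF f that]]) auto
  let ?L = "P.lift (\<lambda>u t. HH.lift (f u) t)"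
  have g: "P.bilin sU (\<lambda>u t. HH.lift (f u) t)"
  proof (rule bilinear_mapI)
    show "linear_map tscale sU HH.space UNIV (HH.lift (f x))" if "x \<in> H" for x
      by (rule HH.lift_linear[OF U fb[OF that]])
    show "linear_map sH sU H UNIV (\<lambda>x. HH.lift (f x) t)" if "t \<in> HH.space" for t
      by (rule HH.lift_linear_param[OF that U vector_space_sH subspace_A fb])
        (auto intro: trilinD(1)[OF f] linear_ident_H)
  qed
  note L = P.lift_linear[OF U g]
  note b = bilinear_mapI linear_tensor_left linear_tensor_right linear_ident_H linear_map_ident
  have "?L (sweedler2 (\<lambda>x y. tensor sH tscale x (\<Delta> y)) h) =
      sweedler2 (\<lambda>x y. ?L (tensor sH tscale x (\<Delta> y))) h"
    by (rule sweedler2_push[OF vector_space_tscale U L subspace_tensor_space _ _ h])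
      (auto intro!: b tensor_in coproduct_in linear_map_subset[OF linear_coproduct])
  also have "\<dots> = sweedler2 (\<lambda>x y. sweedler2 (f x) y) h"
    by (rule sweedler2_cong) (simp add: P.lift_pure[OF U g] coproduct_in sweedler2_def)
  finally have R: "?L (sweedler2 (\<lambda>x y. tensor sH tscale x (\<Delta> y)) h) = \<dots>" .
  have b3: "HH.bilin tscale (\<lambda>u v. tensor sH tscale u (v \<otimes>\<^sub>H y))" for y
    by (auto intro!: b)
  have in3: "sweedler2 (\<lambda>u v. tensor sH tscale u (v \<otimes>\<^sub>H y)) x \<in> P.space" if "x \<in> H" "y \<in> H" for x y
    by (rule sweedler2_in[OF vector_space_tscale subspace_tensor_space b3 _ that(1)])
      (auto intro!: tensor_in that)
  have "?L (sweedler2 (\<lambda>x y. sweedler2 (\<lambda>u v. tensor sH tscale u (v \<otimes>\<^sub>H y)) x) h) =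
      sweedler2 (\<lambda>x y. ?L (sweedler2 (\<lambda>u v. tensor sH tscale u (v \<otimes>\<^sub>H y)) x)) h"
    by (rule sweedler2_push[OF vector_space_tscale U L subspace_tensor_space _ in3 h])
      (auto intro!: multilinear_intros)
  also have "\<dots> = sweedler2 (\<lambda>x y. sweedler2 (\<lambda>u v. ?L (tensor sH tscale u (v \<otimes>\<^sub>H y))) x) h"
    by (rule sweedler2_cong, rule sweedler2_push[OF vector_space_tscale U L subspace_tensor_space b3])
      (auto intro!: tensor_in)
  also have "\<dots> = sweedler2 (\<lambda>x y. sweedler2 (\<lambda>u v. f u v y) x) h"
    by (intro sweedler2_cong) (simp add: P.lift_pure[OF U g] tensor_in HH.lift_pure[OF U fb])
  finally show ?thesis using R coassoc[OF h] by simp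
qed

text \<open>
  The statement is proved for all test functions \<open>f\<close> simultaneously: for a product \<open>\<gamma> * \<gamma>'\<close> the
  hypothesis for \<open>\<gamma>'\<close> is used with the arguments of \<open>f\<close> multiplied by fixed elements, and the one for
  \<open>\<gamma>\<close> with a function that contains the sums over the coaction of \<open>\<gamma>'\<close>.
\<close>

lemma coaction_coassoc:
  assumes U: "vector_space sU" and f: "trilin sU f"
  shows "cosweedler2 (\<lambda>x y. cosweedler2 (f x) y) \<gamma> =
    cosweedler2 (\<lambda>x y. sweedler2 (\<lambda>u v. f u v y) x) \<gamma>"
  using f
proof (induction \<gamma> arbitrary: f rule: calculus_induct)
  case (algebra h)
  note f = algebra(2)
  have "cosweedler2 (\<lambda>x y. cosweedler2 (f x) y) h = sweedler2 (\<lambda>x y. cosweedler2 (f x) y) h"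
    by (rule cosweedler2_algebra[OF U bilin_cosweedler2[OF U f] algebra(1)])
  also have "\<dots> = sweedler2 (\<lambda>x y. sweedler2 (f x) y) h"
    by (rule sweedler2_cong) (rule cosweedler2_algebra[OF U trilin_bilin[OF f]])
  also have "\<dots> = sweedler2 (\<lambda>x y. sweedler2 (\<lambda>u v. f u v y) x) h"
    by (rule coaction_coassoc_algebra[OF U f algebra(1)])
  also have "\<dots> = cosweedler2 (\<lambda>x y. sweedler2 (\<lambda>u v. f u v y) x) h"
    by (rule cosweedler2_algebra[OF U bilin_sweedler2[OF U f] algebra(1), symmetric])
  finally show ?case .
next
  case (add x y)
  show ?case
    unfolding linear_mapD(2)[OF cosweedler2_linear[OF U bilin_cosweedler2[OF U add(3)] linear_map_ident] UNIV_I UNIV_I]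
      linear_mapD(2)[OF cosweedler2_linear[OF U bilin_sweedler2[OF U add(3)] linear_map_ident] UNIV_I UNIV_I]
      add.IH(1)[OF add(3)] add.IH(2)[OF add(3)] ..
next
  case (scale c x)
  show ?case
    unfolding linear_mapD(3)[OF cosweedler2_linear[OF U bilin_cosweedler2[OF U scale(2)] linear_map_ident] UNIV_I]
      linear_mapD(3)[OF cosweedler2_linear[OF U bilin_sweedler2[OF U scale(2)] linear_map_ident] UNIV_I]
      scale.IH[OF scale(2)] ..
next
  case (mult \<gamma> \<gamma>')
  note f = mult(3)
  note ml = U multilinear_intros trilinD[OF f]
  have f1: "trilin sU (\<lambda>x' p q. f (x * x') (u * p) (v * q))" if "x \<in> H" "u \<in> H" for x u v
    by (rule trilinI) (auto intro!: ml that)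
  have f2: "trilin sU (\<lambda>x u v. cosweedler2 (\<lambda>x' y'. sweedler2 (\<lambda>p q. f (x * p) (u * q) (v * y')) x') \<gamma>')"
    by (rule trilinI) (auto intro!: ml)
  have "cosweedler2 (\<lambda>x y. cosweedler2 (f x) y) (\<gamma> * \<gamma>') =
      cosweedler2 (\<lambda>x y. cosweedler2 (\<lambda>x' y'. cosweedler2 (f (x * x')) (y * y')) \<gamma>') \<gamma>"
    by (rule cosweedler2_mult[OF U bilin_cosweedler2[OF U f]])
  also have "\<dots> = cosweedler2 (\<lambda>x y. cosweedler2 (\<lambda>x' y'. cosweedler2 (\<lambda>u v.
      cosweedler2 (\<lambda>u' v'. f (x * x') (u * u') (v * v')) y') y) \<gamma>') \<gamma>"
    by (intro cosweedler2_cong) (rule cosweedler2_mult[OF U trilin_bilin[OF f]], rule mult_A)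
  also have "\<dots> = cosweedler2 (\<lambda>x y. cosweedler2 (\<lambda>u v. cosweedler2 (\<lambda>x' y'.
      cosweedler2 (\<lambda>u' v'. f (x * x') (u * u') (v * v')) y') \<gamma>') y) \<gamma>"
    by (rule cosweedler2_cong, rule cosweedler2_swap[OF U]) (auto intro!: ml)
  also have "\<dots> = cosweedler2 (\<lambda>x y. cosweedler2 (\<lambda>u v. cosweedler2 (\<lambda>x' y'.
      sweedler2 (\<lambda>p q. f (x * p) (u * q) (v * y')) x') \<gamma>') y) \<gamma>"
    by (rule cosweedler2_cong, rule cosweedler2_cong, rule mult.IH(2)[OF f1])
  also have "\<dots> = cosweedler2 (\<lambda>x y. sweedler2 (\<lambda>a b. cosweedler2 (\<lambda>x' y'.
      sweedler2 (\<lambda>p q. f (a * p) (b * q) (y * y')) x') \<gamma>') x) \<gamma>"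
    by (rule mult.IH(1)[OF f2])
  also have "\<dots> = cosweedler2 (\<lambda>x y. cosweedler2 (\<lambda>x' y'. sweedler2 (\<lambda>a b.
      sweedler2 (\<lambda>p q. f (a * p) (b * q) (y * y')) x') x) \<gamma>') \<gamma>"
    by (rule cosweedler2_cong, rule cosweedler2_sweedler2_swap[symmetric, OF U]) (auto intro!: ml)
  also have "\<dots> = cosweedler2 (\<lambda>x y. cosweedler2 (\<lambda>x' y'. sweedler2 (\<lambda>a b. f a b (y * y')) (x * x')) \<gamma>') \<gamma>"
    by (intro cosweedler2_cong) (rule sweedler2_mult[symmetric, OF U trilin_bilin_HH[OF f]])
  also have "\<dots> = cosweedler2 (\<lambda>x y. sweedler2 (\<lambda>u v. f u v y) x) (\<gamma> * \<gamma>')"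
    by (rule cosweedler2_mult[symmetric, OF U bilin_sweedler2[OF U f]])
  finally show ?case .
next
  case (diff \<gamma>)
  note f = diff(2)
  have f': "trilin sU (\<lambda>x u y. f x u (dH y))"
    by (rule trilinI) (auto intro!: trilinD[OF f] linear_ident_H linear_d_UNIV)
  have "cosweedler2 (\<lambda>x y. cosweedler2 (f x) y) (dH \<gamma>) = cosweedler2 (\<lambda>x y. cosweedler2 (f x) (dH y)) \<gamma>"
    by (rule cosweedler2_d[OF U bilin_cosweedler2[OF U f]])
  also have "\<dots> = cosweedler2 (\<lambda>x y. cosweedler2 (\<lambda>u v. f x u (dH v)) y) \<gamma>"
    by (rule cosweedler2_cong) (rule cosweedler2_d[OF U trilin_bilin[OF f]])
  also have "\<dots> = cosweedler2 (\<lambda>x y. sweedler2 (\<lambda>u v. f u v (dH y)) x) \<gamma>"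
    by (rule diff.IH[OF f'])
  also have "\<dots> = cosweedler2 (\<lambda>x y. sweedler2 (\<lambda>u v. f u v y) x) (dH \<gamma>)"
    by (rule cosweedler2_d[symmetric, OF U bilin_sweedler2[OF U f]])
  finally show ?case .
qed

section \<open>Coinvariant forms\<close>

text \<open>
  The projection \<open>\<pi>(\<gamma>) = S(\<gamma>\<^sub>-\<^sub>1) \<gamma>\<^sub>0\<close> of a Hopf module onto its coinvariants.
\<close>

definition coinv_proj :: "'h \<Rightarrow> 'h" where
  "coinv_proj \<gamma> = cosweedler2 (\<lambda>x y. S x * y) \<gamma>"

lemma bilin_antipode_mult: "HU.bilin sH (\<lambda>x y. S x * y)"
  by (auto intro!: multilinear_intros linear_H_UNIV[OF linear_antipode])

lemma linear_coinv_proj: "linear_map s sH A UNIV g \<Longrightarrow> linear_map s sH A UNIV (\<lambda>a. coinv_proj (g a))"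
  unfolding coinv_proj_def by (rule cosweedler2_linear[OF vector_space_sH bilin_antipode_mult])

text \<open>
  This is \<open>\<gamma>\<^sub>-\<^sub>2 S(\<gamma>\<^sub>-\<^sub>1) \<gamma>\<^sub>0 = \<epsilon>(\<gamma>\<^sub>-\<^sub>1) \<gamma>\<^sub>0 = \<gamma>\<close>, so a form is recovered from \<open>\<gamma>\<^sub>-\<^sub>1 \<otimes> \<pi>(\<gamma>\<^sub>0)\<close>.
\<close>

lemma coaction_times_coinv_proj: "cosweedler2 (\<lambda>x y. x * coinv_proj y) \<gamma> = \<gamma>"
proof -
  note lin = multilinear_intros linear_H_UNIV[OF linear_antipode] linear_H_UNIV[OF linear_ident_H]
  have t: "trilin sH (\<lambda>x u v. x * (S u * v))"
    by (rule trilinI) (auto intro!: lin)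
  have "cosweedler2 (\<lambda>x y. x * coinv_proj y) \<gamma> = cosweedler2 (\<lambda>x y. cosweedler2 (\<lambda>u v. x * (S u * v)) y) \<gamma>"
    unfolding coinv_proj_def
    by (rule cosweedler2_cong, rule cosweedler2_push[OF vector_space_sH vector_space_sH _ subspace_UNIV bilin_antipode_mult])
      (auto intro!: lin)
  also have "\<dots> = cosweedler2 (\<lambda>x y. sweedler2 (\<lambda>u v. u * (S v * y)) x) \<gamma>"
    by (rule coaction_coassoc[OF vector_space_sH t])
  also have "\<dots> = cosweedler2 (\<lambda>x y. sweedler2 (\<lambda>u v. u * S v) x * y) \<gamma>"
    unfolding mult.assoc[symmetric]
    by (rule cosweedler2_cong, rule sweedler2_push[symmetric, OF vector_space_sH vector_space_sH _ subspace_UNIV])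
      (auto intro!: lin)
  also have "\<dots> = cosweedler2 (\<lambda>x y. sH (\<epsilon> x) y) \<gamma>"
    by (rule cosweedler2_cong) (simp add: antipode_right scale_mult_left[symmetric])
  also have "\<dots> = \<gamma>" by (rule coaction_counit)
  finally show ?thesis .
qed

text \<open>
  The coaction of \<open>\<gamma>\<close> equals \<open>\<Delta>(\<gamma>\<^sub>-\<^sub>1) (1 \<otimes> \<pi>(\<gamma>\<^sub>0))\<close>: by coassociativity the latter is
  \<open>\<gamma>\<^sub>-\<^sub>1 \<otimes> (\<gamma>\<^sub>0)\<^sub>-\<^sub>1 \<pi>((\<gamma>\<^sub>0)\<^sub>0)\<close>, and the preceding lemma applies to \<open>\<gamma>\<^sub>0\<close>.
\<close>

lemma cosweedler2_via_coinv_proj: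
  assumes U: "vector_space sU" and f: "HU.bilin sU f"
  shows "cosweedler2 (\<lambda>x y. sweedler2 (\<lambda>u v. f u (v * coinv_proj y)) x) \<gamma> = cosweedler2 f \<gamma>"
proof -
  note lin = multilinear_intros linear_coinv_proj HU_bilin_left[OF f] HU_bilin_right[OF f]
    linear_H_UNIV[OF linear_ident_H]
  have t: "trilin sU (\<lambda>x u y. f x (u * coinv_proj y))"
    by (rule trilinI) (auto intro!: lin)
  have "cosweedler2 (\<lambda>x y. sweedler2 (\<lambda>u v. f u (v * coinv_proj y)) x) \<gamma> =
      cosweedler2 (\<lambda>x y. cosweedler2 (\<lambda>u v. f x (u * coinv_proj v)) y) \<gamma>"
    by (rule coaction_coassoc[OF U t, symmetric])
  also have "\<dots> = cosweedler2 (\<lambda>x y. f x (cosweedler2 (\<lambda>u v. u * coinv_proj v) y)) \<gamma>"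
    by (rule cosweedler2_cong, rule cosweedler2_push[symmetric, OF vector_space_sH U _ subspace_UNIV])
      (auto intro!: lin)
  finally show ?thesis by (simp add: coaction_times_coinv_proj)
qed

text \<open>
  The coaction of \<open>\<pi>(\<gamma>)\<close> is \<open>\<Delta>(S(\<gamma>\<^sub>-\<^sub>1))\<close> times that of \<open>\<gamma>\<^sub>0\<close>. With the preceding formula for the
  latter it becomes \<open>\<Delta>(S(\<gamma>\<^sub>-\<^sub>2) \<gamma>\<^sub>-\<^sub>1) (1 \<otimes> \<pi>(\<gamma>\<^sub>0)) = 1 \<otimes> \<pi>(\<gamma>)\<close>.
\<close>

lemma cosweedler2_coinv_proj:
  assumes U: "vector_space sU" and f: "HU.bilin sU f"
  shows "cosweedler2 f (coinv_proj \<gamma>) = f 1 (coinv_proj \<gamma>)"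
proof -
  note lin = U one_A multilinear_intros linear_coinv_proj HU_bilin_left[OF f] HU_bilin_right[OF f]
    linear_H_UNIV[OF linear_ident_H]
  have *: "cosweedler2 f (S u * w) = cosweedler2 (\<lambda>x y. sweedler2 (\<lambda>a b. f a (b * coinv_proj y)) (S u * x)) w"
    if u: "u \<in> H" for u w
  proof -
    note Su = linear_mapD(1)[OF linear_antipode u]
    have "cosweedler2 f (S u * w) = cosweedler2 (\<lambda>a b. cosweedler2 (\<lambda>x y. f (a * x) (b * y)) w) (S u)"
      by (rule cosweedler2_mult[OF U f])
    also have "\<dots> = sweedler2 (\<lambda>a b. cosweedler2 (\<lambda>x y. f (a * x) (b * y)) w) (S u)"
      by (rule cosweedler2_algebra[OF U _ Su]) (auto intro!: lin)
    also have "\<dots> = sweedler2 (\<lambda>a b. cosweedler2 (\<lambda>x y. sweedler2 (\<lambda>p q. f (a * p) (b * (q * coinv_proj y))) x) w) (S u)"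
      by (rule sweedler2_cong, rule cosweedler2_via_coinv_proj[symmetric, OF U]) (auto intro!: lin)
    also have "\<dots> = cosweedler2 (\<lambda>x y. sweedler2 (\<lambda>a b. sweedler2 (\<lambda>p q. f (a * p) (b * (q * coinv_proj y))) x) (S u)) w"
      by (rule cosweedler2_sweedler2_swap[symmetric, OF U Su]) (auto intro!: lin)
    also have "\<dots> = cosweedler2 (\<lambda>x y. sweedler2 (\<lambda>a b. f a (b * coinv_proj y)) (S u * x)) w"
      unfolding mult.assoc[symmetric]
      by (rule cosweedler2_cong, rule sweedler2_mult[symmetric, OF U _ Su]) (auto intro!: lin)
    finally show ?thesis .
  qed
  have t: "trilin sU (\<lambda>u x y. sweedler2 (\<lambda>a b. f a (b * coinv_proj y)) (S u * x))"
    by (rule trilinI) (auto intro!: lin)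
  have b: "linear_map sH sU H UNIV (sweedler2 (\<lambda>a b. f a (b * coinv_proj y)))" for y
    by (rule sweedler2_linear[OF U _ linear_ident_H]) (auto intro!: lin)
  have b1: "HH.bilin sU (\<lambda>a b. f a (b * coinv_proj y))" for y
    by (auto intro!: lin)
  have "cosweedler2 f (coinv_proj \<gamma>) = cosweedler2 (\<lambda>u w. cosweedler2 f (S u * w)) \<gamma>"
    unfolding coinv_proj_def
    by (rule cosweedler2_push[OF vector_space_sH U cosweedler2_linear[OF U f linear_map_ident] subspace_UNIV bilin_antipode_mult])
      simp
  also have "\<dots> = cosweedler2 (\<lambda>u w. cosweedler2 (\<lambda>x y. sweedler2 (\<lambda>a b. f a (b * coinv_proj y)) (S u * x)) w) \<gamma>"
    by (rule cosweedler2_cong) (rule *)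
  also have "\<dots> = cosweedler2 (\<lambda>x y. sweedler2 (\<lambda>u v. sweedler2 (\<lambda>a b. f a (b * coinv_proj y)) (S u * v)) x) \<gamma>"
    by (rule coaction_coassoc[OF U t])
  also have "\<dots> = cosweedler2 (\<lambda>x y. sweedler2 (\<lambda>a b. f a (b * coinv_proj y)) (sweedler2 (\<lambda>u v. S u * v) x)) \<gamma>"
    by (rule cosweedler2_cong, rule sweedler2_push[symmetric, OF vector_space_sH U b subspace_A])
      (auto intro!: lin linear_H_UNIV[OF linear_antipode])
  also have "\<dots> = cosweedler2 (\<lambda>x y. f 1 (coinv_proj (sH (\<epsilon> x) y))) \<gamma>"
  proof (rule cosweedler2_cong)
    fix x y assume "x \<in> H"
    then show "sweedler2 (\<lambda>a b. f a (b * coinv_proj y)) (sweedler2 (\<lambda>u v. S u * v) x) =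
        f 1 (coinv_proj (sH (\<epsilon> x) y))"
      using linear_mapD(3)[OF b one_A] sweedler2_one[OF U b1]
        linear_mapD(3)[OF linear_coinv_proj[OF linear_map_ident] UNIV_I]
        linear_mapD(3)[OF bilinear_mapD(1)[OF f one_A] UNIV_I]
      by (simp add: antipode_left)
  qed
  also have "\<dots> = f 1 (coinv_proj (cosweedler2 (\<lambda>x y. sH (\<epsilon> x) y) \<gamma>))"
    by (rule cosweedler2_push[symmetric, OF vector_space_sH U _ subspace_UNIV])
      (auto intro!: lin)
  finally show ?thesis by (simp add: coaction_counit)
qed

lemma cosweedler2_in:
  assumes U: "vector_space sU" and f: "HU.bilin sU f" and K: "module.subspace sU K" and \<gamma>: "\<gamma> \<in> \<Omega>H n"
    and "\<And>x y. x \<in> H \<Longrightarrow> y \<in> \<Omega>H n \<Longrightarrow> f x y \<in> K"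
  shows "cosweedler2 f \<gamma> \<in> K"
proof -
  interpret P: tensor_pair sH sH H "\<Omega>H n"
    by unfold_locales (auto simp: subspace_A subspace_degree)
  have f': "P.bilin sU f" by (rule bilinear_map_subset[OF f]) auto
  have "cosweedler2 f \<gamma> = P.lift f (coaction \<gamma>)"
    unfolding cosweedler2_def
    by (rule HU.lift_subspaces[symmetric, OF P.tensor_pair_axioms _ _ U f coaction_degree[OF \<gamma>]]) auto
  also have "\<dots> \<in> K" by (rule P.lift_in[OF coaction_degree[OF \<gamma>] U f' K assms(5)])
  finally show ?thesis .
qed

lemma coinv_proj_in_coinvariants:
  assumes "\<gamma> \<in> \<Omega>H n" shows "coinv_proj \<gamma> \<in> coinvariants n"
proof -
  have "S x * y \<in> \<Omega>H n" if "x \<in> H" "y \<in> \<Omega>H n" for x y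
    using degree_mult[of "S x" 0 y n] linear_mapD(1)[OF linear_antipode that(1)] that(2)
    by (simp add: degree_0)
  hence "coinv_proj \<gamma> \<in> \<Omega>H n"
    unfolding coinv_proj_def
    by (rule cosweedler2_in[OF vector_space_sH bilin_antipode_mult subspace_degree assms])
  moreover have "coaction (coinv_proj \<gamma>) = 1 \<otimes>\<^sub>H coinv_proj \<gamma>"
    using cosweedler2_coinv_proj[OF vector_space_tscale bilin_tensor]
    by (simp add: cosweedler2_def HU.lift_ident[OF coaction_in])
  ultimately show ?thesis by (simp add: coinvariants_def)
qed

lemma cosweedler2_coinvariant:
  assumes U: "vector_space sU" and f: "HU.bilin sU f" and \<gamma>: "\<gamma> \<in> coinvariants n"
  shows "cosweedler2 f \<gamma> = f 1 \<gamma>"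
  using \<gamma> HU.lift_pure[OF U f one_A UNIV_I] by (simp add: cosweedler2_def coinvariants_def)

lemma cosweedler2_times_coinvariant:
  assumes U: "vector_space sU" and f: "HU.bilin sU f" and h: "h \<in> H" and \<gamma>: "\<gamma> \<in> coinvariants n"
  shows "cosweedler2 f (h * \<gamma>) = sweedler2 (\<lambda>x y. f x (y * \<gamma>)) h"
proof -
  note lin = U one_A multilinear_intros HU_bilin_left[OF f] HU_bilin_right[OF f]
    linear_H_UNIV[OF linear_ident_H]
  have "cosweedler2 f (h * \<gamma>) = cosweedler2 (\<lambda>x y. cosweedler2 (\<lambda>x' y'. f (x * x') (y * y')) \<gamma>) h"
    by (rule cosweedler2_mult[OF U f])
  also have "\<dots> = sweedler2 (\<lambda>x y. cosweedler2 (\<lambda>x' y'. f (x * x') (y * y')) \<gamma>) h"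
    by (rule cosweedler2_algebra[OF U _ h]) (auto intro!: lin)
  also have "\<dots> = sweedler2 (\<lambda>x y. f (x * 1) (y * \<gamma>)) h"
    by (rule sweedler2_cong, rule cosweedler2_coinvariant[OF U _ \<gamma>]) (auto intro!: lin)
  finally show ?thesis by simp
qed

lemma coinv_proj_times_coinvariant:
  assumes h: "h \<in> H" and \<gamma>: "\<gamma> \<in> coinvariants n"
  shows "coinv_proj (h * \<gamma>) = sH (\<epsilon> h) \<gamma>"
proof -
  have "coinv_proj (h * \<gamma>) = sweedler2 (\<lambda>x y. S x * (y * \<gamma>)) h"
    unfolding coinv_proj_def by (rule cosweedler2_times_coinvariant[OF vector_space_sH bilin_antipode_mult h \<gamma>])
  also have "\<dots> = sweedler2 (\<lambda>x y. S x * y) h * \<gamma>"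
    unfolding mult.assoc[symmetric]
    by (rule sweedler2_push[symmetric, OF vector_space_sH vector_space_sH _ subspace_UNIV _ _ h])
      (auto intro!: multilinear_intros linear_H_UNIV[OF linear_antipode])
  finally show ?thesis by (simp add: antipode_left h scale_mult_left[symmetric])
qed

end

section \<open>The crossed product calculus\<close>

locale crossed_calculus =
  covariant_calculus sH H \<Delta> \<epsilon> S \<Omega>H dH +
  twisted_module_calculus sH H \<Delta> \<epsilon> S sB B act \<sigma> \<sigma>' \<Omega>B dB +
  crossed_product sH H \<Delta> \<Omega>H dH S sB B \<Omega>B dB act \<sigma>
  for sH :: "'k::field \<Rightarrow> 'h::{ring, monoid_mult} \<Rightarrow> 'h" and H \<Delta> \<epsilon> S \<Omega>H dH
    and sB :: "'k \<Rightarrow> 'b::{ring, monoid_mult} \<Rightarrow> 'b" and B act \<sigma> \<sigma>' \<Omega>B dB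
begin

lemma vector_space_sB: "vector_space sB"
  by unfold_locales

sublocale BH: tensor_pair sB sH B H
  by unfold_locales (auto simp: B.subspace_A subspace_A)

sublocale TU: tensor_pair sB sH UNIV UNIV
  by unfold_locales auto

sublocale CU: tensor_pair tscale sH "tensor_space sB sH B H" UNIV
  by unfold_locales (auto simp: subspace_tensor_space)

lemma subspace_crossed_forms: "module.subspace tscale (crossed_forms n)"
  unfolding crossed_forms_def tensor_degree_def by simp

lemma crossed_forms_subset: "crossed_forms n \<subseteq> TU.space"
  unfolding crossed_forms_def tensor_degree_def
  by (rule tens.span_minimal) (auto simp: subspace_tensor_space
      intro: subsetD[OF tensor_space_mono[OF subset_UNIV subset_UNIV]])

lemma tensor_in_crossed_forms:
  assumes "\<omega> \<in> \<Omega>B (n - i)" "\<gamma> \<in> \<Omega>H i" "i \<le> n"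
  shows "\<omega> \<otimes>\<^sub>B \<gamma> \<in> crossed_forms n"
  unfolding crossed_forms_def tensor_degree_def
  by (rule tens.span_base) (use assms in \<open>auto intro!: tensor_in\<close>)


subsection \<open>The unit acts trivially on forms\<close>

lemma bilinear_act_degree: "bilinear_map sH sB sB H (\<Omega>B k) UNIV act"
proof (cases "k = 0")
  case True
  then show ?thesis using bilinear_map_subset[OF bilinear_act] by (auto simp: B.degree_0)
next
  case False
  then show ?thesis using bilinear_map_subset[OF bilinear_act_forms[of k]] by auto
qed

lemma linear_act_left: "b \<in> \<Omega>B k \<Longrightarrow> linear_map s sH A H g \<Longrightarrow> linear_map s sB A UNIV (\<lambda>a. act (g a) b)"
  by (rule linear_map_comp_on[OF bilinear_mapD(2)[OF bilinear_act_degree]])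

lemma linear_act_right: "h \<in> H \<Longrightarrow> linear_map sB sB (\<Omega>B k) UNIV (\<lambda>b. act h b)"
  by (rule bilinear_mapD(1)[OF bilinear_act_degree])

lemma linear_diagonal_act:
  assumes "b \<in> \<Omega>B k" "set bs \<subseteq> \<Omega>B 1"
  shows "linear_map sH sB H UNIV (diagonal_act act b bs)"
  using assms
proof (induction bs arbitrary: b k)
  case Nil
  then show ?case by (auto intro!: linear_act_left linear_ident_H)
next
  case (Cons b' bs)
  then have IH: "linear_map sH sB H UNIV (diagonal_act act b' bs)" by auto
  show ?case
    unfolding diagonal_act.simps
    by (rule sweedler2_linear[OF vector_space_sB _ linear_ident_H])
      (intro bilinear_mapI B.linear_mult_left B.linear_mult_right IH
        linear_act_left[OF Cons.prems(1)] linear_ident_H)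
qed

lemma diagonal_act_one:
  assumes "b \<in> \<Omega>B k" "set bs \<subseteq> \<Omega>B 1"
  shows "diagonal_act act b bs 1 = act 1 b * prod_list (map (act 1) bs)"
  using assms
proof (induction bs arbitrary: b k)
  case (Cons b' bs)
  then have b': "b' \<in> \<Omega>B 1" "set bs \<subseteq> \<Omega>B 1" by auto
  have "diagonal_act act b (b' # bs) 1 = act 1 b * diagonal_act act b' bs 1"
    unfolding diagonal_act.simps
    by (rule sweedler2_one[OF vector_space_sB])
      (intro bilinear_mapI B.linear_mult_left B.linear_mult_right linear_diagonal_act[OF b']
        linear_act_left[OF Cons.prems(1)] linear_ident_H)
  then show ?case using Cons.IH[OF b'] by (simp add: mult.assoc)
qed simp

lemma d_degree_1: "b \<in> B \<Longrightarrow> dB b \<in> \<Omega>B 1"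
  using B.degree_d[of b 0] by (simp add: B.degree_0)

text \<open>
  As \<open>\<Delta> 1 = 1 \<otimes> 1\<close>, the diagonal action of \<open>1\<close> on \<open>b db\<^sub>1 \<dots> db\<^sub>k\<close> acts by \<open>1\<close> on each factor.
\<close>

lemma one_act_forms: assumes "\<omega> \<in> \<Omega>B k" shows "act 1 \<omega> = \<omega>"
proof -
  have "act 1 \<omega> + sB (- 1) \<omega> \<in> {0}"
  proof (rule linear_map_span_in[OF vector_space_sB vector_space_sB B.subspace_degree,
        where f = "\<lambda>\<omega>. act 1 \<omega> + sB (- 1) \<omega>"])
    show "linear_map sB sB (\<Omega>B k) UNIV (\<lambda>\<omega>. act 1 \<omega> + sB (- 1) \<omega>)"
      by (intro linear_map_add linear_act_right one_A linear_map_scale vector_space_sB linear_map_ident)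
    show "{b * prod_list (map dB bs) | b bs. b \<in> B \<and> set bs \<subseteq> B \<and> length bs = k} \<subseteq> \<Omega>B k"
      unfolding B.spanned[of k] by (rule B.span_superset)
    show "B.subspace {0}" by simp
    show "\<omega> \<in> B.span {b * prod_list (map dB bs) | b bs. b \<in> B \<and> set bs \<subseteq> B \<and> length bs = k}"
      using assms B.spanned[of k] by simp
    fix x assume "x \<in> {b * prod_list (map dB bs) | b bs. b \<in> B \<and> set bs \<subseteq> B \<and> length bs = k}"
    then obtain b bs where x: "x = b * prod_list (map dB bs)" "b \<in> B" "set bs \<subseteq> B" by blast
    have m: "map (act 1) (map dB bs) = map dB bs"
      using x(3) by (auto simp: act_d one_A one_act subset_iff)
    have "set (map dB bs) \<subseteq> \<Omega>B 1" using x(3) d_degree_1 by auto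
    then have "act 1 x = act 1 b * prod_list (map (act 1) (map dB bs))"
      using act_forms[OF one_A x(2,3)] x(1) diagonal_act_one[of b 0 "map dB bs"] x(2)
      by (simp add: B.degree_0)
    then show "act 1 x + sB (- 1) x \<in> {0}" unfolding m by (simp add: x one_act)
  qed
  then show ?thesis by simp
qed


subsection \<open>Products with forms on the base\<close>

text \<open>
  The summand of \<open>crossed_wedge\<close> for homogeneous factors, without its Koszul sign.
\<close>

definition wedge_term :: "'b \<Rightarrow> 'h \<Rightarrow> 'b \<Rightarrow> 'h \<Rightarrow> ('b, 'h, 'k) tensor" where
  "wedge_term \<omega> \<gamma> \<omega>' \<gamma>' = cosweedler3 (\<lambda>h1 h2 \<gamma>0. cosweedler2 (\<lambda>h1' \<gamma>0'.
              (\<omega> * act h1 \<omega>' * \<sigma> h2 h1') \<otimes>\<^sub>B (\<gamma>0 * \<gamma>0')) \<gamma>') \<gamma>"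

lemma linear_sigma_left: "y \<in> H \<Longrightarrow> linear_map s sH A H g \<Longrightarrow> linear_map s sB A UNIV (\<lambda>a. \<sigma> (g a) y)"
  by (rule linear_map_comp_on[OF bilinear_mapD(2)[OF bilinear_map_subset[OF bilinear_sigma subset_refl subset_refl subset_UNIV]]])

lemma linear_sigma_right: "x \<in> H \<Longrightarrow> linear_map s sH A H g \<Longrightarrow> linear_map s sB A UNIV (\<lambda>a. \<sigma> x (g a))"
  by (rule linear_map_comp_on[OF bilinear_mapD(1)[OF bilinear_map_subset[OF bilinear_sigma subset_refl subset_refl subset_UNIV]]])

lemmas crossed_intros = multilinear_intros linear_sigma_left linear_sigma_right linear_act_right
  B.linear_mult_left B.linear_mult_right vector_space_sB B.subspace_UNIV B.subspace_degree B.subspace_A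
  one_A linear_H_UNIV[OF linear_ident_H]

lemma linear_wedge_term:
  assumes "\<omega>' \<in> \<Omega>B k"
  shows "B.subspace A \<Longrightarrow> linear_map sB tscale A UNIV (\<lambda>\<omega>. wedge_term \<omega> \<gamma> \<omega>' \<gamma>')"
    and "subspace V \<Longrightarrow> linear_map sH tscale V UNIV (\<lambda>\<gamma>. wedge_term \<omega> \<gamma> \<omega>' \<gamma>')"
    and "subspace V \<Longrightarrow> linear_map sH tscale V UNIV (\<lambda>\<gamma>'. wedge_term \<omega> \<gamma> \<omega>' \<gamma>')"
  unfolding wedge_term_def cosweedler3_def
  by (auto intro!: crossed_intros linear_act_left[OF assms])

lemma linear_wedge_term_form: "linear_map sB tscale (\<Omega>B k) UNIV (\<lambda>\<omega>'. wedge_term \<omega> \<gamma> \<omega>' \<gamma>')"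
  unfolding wedge_term_def cosweedler3_def
  by (auto intro!: crossed_intros linear_act_left)

text \<open>
  The coaction of \<open>1\<close> is \<open>1 \<otimes> 1\<close>, so the product is \<open>\<omega> (1 \<cdot> \<omega>') \<sigma>(1 \<otimes> \<gamma>\<^sub>-\<^sub>1) \<otimes> \<gamma>\<^sub>0\<close>. Here \<open>1\<close> acts trivially,
  \<open>\<sigma>(1 \<otimes> h) = \<epsilon>(h)\<close>, and the coaction is counital.
\<close>

lemma wedge_term_one:
  assumes "\<omega>' \<in> \<Omega>B k" shows "wedge_term \<omega> 1 \<omega>' \<gamma> = (\<omega> * \<omega>') \<otimes>\<^sub>B \<gamma>"
proof -
  note lin = crossed_intros linear_act_left[OF assms]
  have "wedge_term \<omega> 1 \<omega>' \<gamma> = cosweedler2 (\<lambda>u v. cosweedler2 (\<lambda>h1' \<gamma>0'.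
              (\<omega> * act 1 \<omega>' * \<sigma> u h1') \<otimes>\<^sub>B (v * \<gamma>0')) \<gamma>) 1"
    unfolding wedge_term_def cosweedler3_def
    by (rule cosweedler2_one[OF vector_space_tscale]) (auto intro!: lin)
  also have "\<dots> = cosweedler2 (\<lambda>h1' \<gamma>0'. (\<omega> * act 1 \<omega>' * \<sigma> 1 h1') \<otimes>\<^sub>B (1 * \<gamma>0')) \<gamma>"
    by (rule cosweedler2_one[OF vector_space_tscale]) (auto intro!: lin)
  also have "\<dots> = cosweedler2 (\<lambda>h1' \<gamma>0'. (\<omega> * \<omega>') \<otimes>\<^sub>B sH (\<epsilon> h1') \<gamma>0') \<gamma>"
  proof (rule cosweedler2_cong)
    fix h \<gamma>0 assume "h \<in> H"
    then have "(\<omega> * act 1 \<omega>' * \<sigma> 1 h) \<otimes>\<^sub>B (1 * \<gamma>0) = sB (\<epsilon> h) (\<omega> * \<omega>') \<otimes>\<^sub>B \<gamma>0"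
      by (simp add: one_act_forms[OF assms] sigma_one_left B.scale_mult_right[symmetric])
    then show "(\<omega> * act 1 \<omega>' * \<sigma> 1 h) \<otimes>\<^sub>B (1 * \<gamma>0) = (\<omega> * \<omega>') \<otimes>\<^sub>B sH (\<epsilon> h) \<gamma>0"
      by (simp only: TU.pure_scale_left TU.pure_scale_right)
  qed
  also have "\<dots> = (\<omega> * \<omega>') \<otimes>\<^sub>B cosweedler2 (\<lambda>h \<gamma>. sH (\<epsilon> h) \<gamma>) \<gamma>"
    by (rule cosweedler2_push[symmetric, OF vector_space_sH vector_space_tscale _ subspace_UNIV])
      (auto intro!: lin)
  finally show ?thesis by (simp add: coaction_counit)
qed

text \<open>
  The lifts in the definition of \<open>crossed_wedge\<close> can be evaluated only once the function \<open>Z\<close> that they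
  extend is known to be linear in each of its four arguments.
\<close>

lemma crossed_wedge_base:
  assumes "t \<in> TU.space"
  shows "crossed_wedge (\<omega> \<otimes>\<^sub>B 1) t = TU.lift (\<lambda>\<omega>' \<gamma>. (\<omega> * \<omega>') \<otimes>\<^sub>B \<gamma>) t"
proof -
  define Z where "Z = (\<lambda>\<omega> \<gamma> \<omega>' \<gamma>'. by_degree \<Omega>H (\<lambda>j \<gamma>. by_degree \<Omega>B (\<lambda>k \<omega>'.
         tscale ((-1) ^ (j * k)) (wedge_term \<omega> \<gamma> \<omega>' \<gamma>')) \<omega>') \<gamma>)"
  note deg = linear_by_degree linear_by_degree_param B.linear_by_degree B.linear_by_degree_param
    vector_space_tscale linear_map_scale
  have Z1: "linear_map sB tscale UNIV UNIV (\<lambda>\<omega>. Z \<omega> \<gamma> \<omega>' \<gamma>')" for \<gamma> \<omega>' \<gamma>'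
    unfolding Z_def
    by (intro linear_by_degree_param B.linear_by_degree_param deg linear_wedge_term(1)[OF _ B.subspace_UNIV])
  have Z2: "linear_map sH tscale UNIV UNIV (\<lambda>\<gamma>. Z \<omega> \<gamma> \<omega>' \<gamma>')" for \<omega> \<omega>' \<gamma>'
    unfolding Z_def
    by (intro linear_by_degree B.linear_by_degree_param deg linear_wedge_term(2)[OF _ subspace_degree])
  have Z3: "linear_map sB tscale UNIV UNIV (\<lambda>\<omega>'. Z \<omega> \<gamma> \<omega>' \<gamma>')" for \<omega> \<gamma> \<gamma>'
    unfolding Z_def
    by (rule linear_by_degree_param[OF vector_space_tscale])
      (intro B.linear_by_degree deg linear_wedge_term_form)
  have Z4: "linear_map sH tscale UNIV UNIV (\<lambda>\<gamma>'. Z \<omega> \<gamma> \<omega>' \<gamma>')" for \<omega> \<gamma> \<omega>'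
    unfolding Z_def
    by (intro linear_by_degree_param B.linear_by_degree_param deg linear_wedge_term(3)[OF _ subspace_UNIV])
  have Z34: "TU.bilin tscale (Z \<omega> \<gamma>)" for \<omega> \<gamma>
    by (rule bilinear_mapI[OF Z4 Z3])
  have Z12: "TU.bilin tscale (\<lambda>\<omega> \<gamma>. TU.lift (Z \<omega> \<gamma>) t)"
  proof (rule bilinear_mapI)
    show "linear_map sH tscale UNIV UNIV (\<lambda>\<gamma>. TU.lift (Z \<omega> \<gamma>) t)" for \<omega>
      by (rule TU.lift_linear_param[OF assms vector_space_tscale vector_space_sH subspace_UNIV Z34 Z2])
    show "linear_map sB tscale UNIV UNIV (\<lambda>\<omega>. TU.lift (Z \<omega> \<gamma>) t)" for \<gamma>
      by (rule TU.lift_linear_param[OF assms vector_space_tscale vector_space_sB B.subspace_UNIV Z34 Z1])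
  qed
  have Z: "Z \<omega> 1 \<omega>' \<gamma> = (\<omega> * \<omega>') \<otimes>\<^sub>B \<gamma>" for \<omega>' \<gamma>
  proof (rule B.linear_eq_homogeneous[where f = "\<lambda>\<omega>'. Z \<omega> 1 \<omega>' \<gamma>" and sU = tscale])
    show "linear_map sB tscale UNIV UNIV (\<lambda>\<omega>'. Z \<omega> 1 \<omega>' \<gamma>)" by (rule Z3)
    show "linear_map sB tscale UNIV UNIV (\<lambda>\<omega>'. (\<omega> * \<omega>') \<otimes>\<^sub>B \<gamma>)"
      by (intro linear_tensor_left B.linear_mult_right linear_map_ident)
    fix k \<omega>' assume k: "\<omega>' \<in> \<Omega>B k"
    have z: "wedge_term \<omega> 0 \<omega>'' \<gamma>' = 0" "wedge_term \<omega> \<gamma> 0 \<gamma>' = 0" if "\<omega>'' \<in> \<Omega>B i" for \<omega>'' i \<gamma> \<gamma>'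
      using linear_map_zero[OF vector_space_sH vector_space_tscale subspace_UNIV linear_wedge_term(2)[OF that subspace_UNIV]]
        linear_map_zero[OF vector_space_sB vector_space_tscale B.subspace_degree linear_wedge_term_form]
      by auto
    have "Z \<omega> 1 \<omega>' \<gamma> = by_degree \<Omega>B (\<lambda>k \<omega>'. tscale ((-1) ^ (0 * k)) (wedge_term \<omega> 1 \<omega>' \<gamma>)) \<omega>'"
      unfolding Z_def
      by (rule by_degree_homogeneous)
        (simp_all add: degree_0 one_A by_degree_def z(1)[OF B.component_degree] tens.scale_zero_right)
    also have "\<dots> = tscale ((-1) ^ (0 * k)) (wedge_term \<omega> 1 \<omega>' \<gamma>)"
      by (rule B.by_degree_homogeneous[OF k]) (simp add: z(2)[OF k] tens.scale_zero_right)
    finally show "Z \<omega> 1 \<omega>' \<gamma> = (\<omega> * \<omega>') \<otimes>\<^sub>B \<gamma>" by (simp add: wedge_term_one[OF k])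
  qed
  have "crossed_wedge (\<omega> \<otimes>\<^sub>B 1) t = TU.lift (\<lambda>\<omega> \<gamma>. TU.lift (Z \<omega> \<gamma>) t) (\<omega> \<otimes>\<^sub>B 1)"
    unfolding crossed_wedge_def Z_def wedge_term_def ..
  also have "\<dots> = TU.lift (Z \<omega> 1) t"
    by (rule TU.lift_pure[OF vector_space_tscale Z12]) auto
  also have "\<dots> = TU.lift (\<lambda>\<omega>' \<gamma>. (\<omega> * \<omega>') \<otimes>\<^sub>B \<gamma>) t"
    by (rule TU.lift_cong) (rule Z)
  finally show ?thesis .
qed

lemma bilin_base_mult: "TU.bilin tscale (\<lambda>\<omega>' \<gamma>. (\<omega> * \<omega>') \<otimes>\<^sub>B \<gamma>)"
  by (auto intro!: crossed_intros)


subsection \<open>The ideal generated by forms on the base\<close>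

definition positive_base_forms :: "nat \<Rightarrow> ('b, 'h, 'k) tensor set" where
  "positive_base_forms n = tens.span (\<Union>i<n. tensor_space sB sH (\<Omega>B (n - i)) (\<Omega>H i))"

lemma subspace_positive_base_forms: "tens.subspace (positive_base_forms n)"
  unfolding positive_base_forms_def by simp

lemma positive_base_forms_subset: "positive_base_forms n \<subseteq> crossed_forms n"
  unfolding positive_base_forms_def crossed_forms_def tensor_degree_def by (intro tens.span_mono UN_mono) auto

lemma linear_map_span_tensor_spaces:
  assumes "vector_space sU" "linear_map tscale sU TU.space UNIV L" "module.subspace sU K"
    and "\<And>i \<omega> \<gamma>. i \<in> I \<Longrightarrow> \<omega> \<in> V i \<Longrightarrow> \<gamma> \<in> W i \<Longrightarrow> L (\<omega> \<otimes>\<^sub>B \<gamma>) \<in> K"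
    and "t \<in> tens.span (\<Union>i\<in>I. tensor_space sB sH (V i) (W i))"
  shows "L t \<in> K"
proof (rule linear_map_span_in[OF vector_space_tscale assms(1) subspace_tensor_space assms(2) _ assms(3) _ assms(5)])
  have T: "tensor_space sB sH (V i) (W i) \<subseteq> TU.space" for i
    by (rule tensor_space_mono) auto
  then show "(\<Union>i\<in>I. tensor_space sB sH (V i) (W i)) \<subseteq> TU.space" by blast
  fix x assume "x \<in> (\<Union>i\<in>I. tensor_space sB sH (V i) (W i))"
  then obtain i where i: "i \<in> I" "x \<in> tensor_space sB sH (V i) (W i)" by blast
  show "L x \<in> K"
    by (rule linear_map_span_in[OF vector_space_tscale assms(1) subspace_tensor_space assms(2) _ assms(3) _ i(2)[unfolded tensor_space_def]])
      (use assms(4)[OF i(1)] in \<open>auto intro!: tensor_in\<close>)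
qed

lemma wedge_base_in_positive_base_forms:
  assumes "\<omega> \<in> \<Omega>B 1" "t \<in> crossed_forms (n - 1)" "n > 0"
  shows "crossed_wedge (\<omega> \<otimes>\<^sub>B 1) t \<in> positive_base_forms n"
proof -
  have "TU.lift (\<lambda>\<omega>' \<gamma>. (\<omega> * \<omega>') \<otimes>\<^sub>B \<gamma>) t \<in> positive_base_forms n"
  proof (rule linear_map_span_tensor_spaces[OF vector_space_tscale
        TU.lift_linear[OF vector_space_tscale bilin_base_mult] subspace_positive_base_forms _
        assms(2)[unfolded crossed_forms_def tensor_degree_def]])
    fix i \<omega>' \<gamma> assume i: "i \<in> {..n - 1}" "\<omega>' \<in> \<Omega>B (n - 1 - i)" "\<gamma> \<in> \<Omega>H i"
    \<comment> \<open>The truncated subtractions are harmless because \<open>i \<le> n - 1\<close> and \<open>n > 0\<close>.\<close>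
    have e: "1 + (n - 1 - i) = n - i" and i': "i < n" using i(1) assms(3) by auto
    have "\<omega> * \<omega>' \<in> \<Omega>B (n - i)"
      using B.degree_mult[OF assms(1) i(2)] unfolding e .
    then have "(\<omega> * \<omega>') \<otimes>\<^sub>B \<gamma> \<in> positive_base_forms n"
      unfolding positive_base_forms_def by (intro tens.span_base) (use i(3) i' in \<open>auto intro!: tensor_in\<close>)
    then show "TU.lift (\<lambda>\<omega>' \<gamma>. (\<omega> * \<omega>') \<otimes>\<^sub>B \<gamma>) (\<omega>' \<otimes>\<^sub>B \<gamma>) \<in> positive_base_forms n"
      by (simp add: TU.lift_pure[OF vector_space_tscale bilin_base_mult])
  qed
  then show ?thesis
    using crossed_wedge_base[of t \<omega>] assms(2) crossed_forms_subset[of "n - 1"] by auto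
qed

text \<open>
  Since \<open>n - i > 0\<close>, a spanning form \<open>b db\<^sub>1 \<dots> db\<^sub>m\<close> of degree \<open>m = n - i\<close> has the factor \<open>b db\<^sub>1\<close> of
  degree 1, which is split off on the left.
\<close>

lemma positive_tensor_in_base_ideal:
  assumes "i < n" "\<omega> \<in> \<Omega>B (n - i)" "\<gamma> \<in> \<Omega>H i"
  shows "\<omega> \<otimes>\<^sub>B \<gamma> \<in> base_ideal n"
proof (rule linear_map_span_in[OF vector_space_sB vector_space_tscale B.subspace_UNIV
      linear_tensor_left[OF linear_map_ident] subset_UNIV, where K = "base_ideal n"])
  show "tens.subspace (base_ideal n)" unfolding base_ideal_def by simp
  show "\<omega> \<in> B.span {b * prod_list (map dB bs) | b bs. b \<in> B \<and> set bs \<subseteq> B \<and> length bs = n - i}"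
    using assms(2) B.spanned[of "n - i"] by simp
  fix x assume "x \<in> {b * prod_list (map dB bs) | b bs. b \<in> B \<and> set bs \<subseteq> B \<and> length bs = n - i}"
  then obtain b bs where x: "x = b * prod_list (map dB bs)" "b \<in> B" "set bs \<subseteq> B" "length bs = n - i"
    by blast
  then obtain b' bs' where bs: "bs = b' # bs'" using assms(1) by (cases bs) auto
  let ?r = "prod_list (map dB bs')"
  have bs': "set bs' \<subseteq> B" "length bs' = n - 1 - i" using x bs by auto
  have "b * dB b' \<in> \<Omega>B (0 + 1)"
    by (rule B.degree_mult) (use x bs d_degree_1 in \<open>auto simp: B.degree_0\<close>)
  moreover have "?r \<in> \<Omega>B (n - 1 - i)"
  proof -
    have "1 * ?r \<in> B.span {b * prod_list (map dB bs) | b bs. b \<in> B \<and> set bs \<subseteq> B \<and> length bs = n - 1 - i}"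
      using bs' B.one_A by (intro B.span_base) blast
    then show ?thesis unfolding B.spanned[of "n - 1 - i", symmetric] by simp
  qed
  then have r: "?r \<otimes>\<^sub>B \<gamma> \<in> crossed_forms (n - 1)"
    by (rule tensor_in_crossed_forms[OF _ assms(3)]) (use assms(1) in simp)
  ultimately have "crossed_wedge ((b * dB b') \<otimes>\<^sub>B 1) (?r \<otimes>\<^sub>B \<gamma>) \<in> base_ideal n"
    unfolding base_ideal_def by (intro tens.span_base) auto
  moreover have "crossed_wedge ((b * dB b') \<otimes>\<^sub>B 1) (?r \<otimes>\<^sub>B \<gamma>) = (b * dB b' * ?r) \<otimes>\<^sub>B \<gamma>"
    using crossed_wedge_base[OF tensor_in[OF UNIV_I UNIV_I], of "b * dB b'" ?r \<gamma>]
      TU.lift_pure[OF vector_space_tscale bilin_base_mult] by simp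
  ultimately show "x \<otimes>\<^sub>B \<gamma> \<in> base_ideal n" by (simp add: x(1) bs mult.assoc)
qed

lemma base_ideal_eq: assumes "n > 0" shows "base_ideal n = positive_base_forms n"
proof
  have sub: "tens.subspace (base_ideal n)" unfolding base_ideal_def by simp
  show "base_ideal n \<subseteq> positive_base_forms n"
    unfolding base_ideal_def
    by (rule tens.span_minimal[OF _ subspace_positive_base_forms])
      (auto intro: wedge_base_in_positive_base_forms assms)
  show "positive_base_forms n \<subseteq> base_ideal n"
  proof
    fix t assume "t \<in> positive_base_forms n"
    then have "t \<in> tens.span (\<Union>i\<in>{..<n}. tensor_space sB sH (\<Omega>B (n - i)) (\<Omega>H i))"
      unfolding positive_base_forms_def .
    then show "t \<in> base_ideal n"
      by (rule linear_map_span_tensor_spaces[where L = "\<lambda>t. t", OF vector_space_tscale linear_map_ident sub, rotated])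
        (auto intro: positive_tensor_in_base_ideal)
  qed
qed

subsection \<open>The vertical map\<close>

definition vertical_tensor :: "'b \<Rightarrow> 'h \<Rightarrow> (('b, 'h, 'k) tensor, 'h, 'k) tensor" where
  "vertical_tensor b \<gamma> = cosweedler2 (\<lambda>x y. tensor tscale sH (b \<otimes>\<^sub>B x) (coinv_proj y)) \<gamma>"

lemmas vertical_intros = crossed_intros linear_coinv_proj

lemma bilin_vertical_tensor_arg: "HU.bilin tscale (\<lambda>x y. tensor tscale sH (b \<otimes>\<^sub>B x) (coinv_proj y))"
  by (auto intro!: vertical_intros)

lemma linear_vertical_tensor_left: "linear_map sB tscale UNIV UNIV (\<lambda>b. vertical_tensor b \<gamma>)"
  unfolding vertical_tensor_def by (auto intro!: vertical_intros)

lemma linear_vertical_tensor_right: "linear_map sH tscale UNIV UNIV (\<lambda>\<gamma>. vertical_tensor b \<gamma>)"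
  unfolding vertical_tensor_def
  by (rule cosweedler2_linear[OF vector_space_tscale bilin_vertical_tensor_arg linear_map_ident])

text \<open>
  Summing over the second coaction first leaves \<open>(b \<otimes> \<gamma>\<^sub>-\<^sub>1) \<otimes> \<pi>(\<gamma>\<^sub>0)\<close>.
\<close>

lemma vertical_eq:
  "vertical n t = TU.lift (\<lambda>b \<gamma>. vertical_tensor (component \<Omega>B 0 b) (component \<Omega>H n \<gamma>)) t"
  unfolding vertical_def vertical_tensor_def cosweedler3_def coinv_proj_def
  by (rule TU.lift_cong, rule cosweedler2_cong,
      rule cosweedler2_push[symmetric, OF vector_space_sH vector_space_tscale _ subspace_UNIV bilin_antipode_mult])
    (auto intro!: vertical_intros)

lemma bilin_vertical:
  "TU.bilin tscale (\<lambda>b \<gamma>. vertical_tensor (component \<Omega>B 0 b) (component \<Omega>H n \<gamma>))"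
proof (rule bilinear_mapI)
  show "linear_map sH tscale UNIV UNIV (\<lambda>\<gamma>. vertical_tensor (component \<Omega>B 0 b) (component \<Omega>H n \<gamma>))" for b
    by (rule linear_map_comp[OF linear_vertical_tensor_right])
      (rule linear_map_subset[OF linear_component]; simp)
  show "linear_map sB tscale UNIV UNIV (\<lambda>b. vertical_tensor (component \<Omega>B 0 b) (component \<Omega>H n \<gamma>))" for \<gamma>
    by (rule linear_map_comp[OF linear_vertical_tensor_left]) (rule B.linear_component_0)
qed

lemma linear_vertical: "linear_map tscale tscale TU.space UNIV (vertical n)"
  unfolding vertical_eq[abs_def] by (rule TU.lift_linear[OF vector_space_tscale bilin_vertical])

lemma vertical_pure:
  "vertical n (b \<otimes>\<^sub>B \<gamma>) = vertical_tensor (component \<Omega>B 0 b) (component \<Omega>H n \<gamma>)"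
  unfolding vertical_eq by (rule TU.lift_pure[OF vector_space_tscale bilin_vertical]) auto

lemma vertical_tensor_in:
  assumes "b \<in> B" "\<gamma> \<in> \<Omega>H n" shows "vertical_tensor b \<gamma> \<in> vertical_target n"
  unfolding vertical_tensor_def vertical_target_def
  by (rule cosweedler2_in[OF vector_space_tscale bilin_vertical_tensor_arg subspace_tensor_space assms(2)])
    (auto intro!: tensor_in coinv_proj_in_coinvariants simp: crossed_space_def assms)

lemma vertical_in:
  assumes "t \<in> TU.space" shows "vertical n t \<in> vertical_target n"
  unfolding vertical_eq
  by (rule TU.lift_in[OF assms vector_space_tscale bilin_vertical])
    (auto simp: vertical_target_def subspace_tensor_space intro!: vertical_tensor_in[unfolded vertical_target_def]
      B.component_0_in component_degree)

lemma vertical_positive_base_forms: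
  assumes "t \<in> positive_base_forms n" shows "vertical n t = 0"
proof -
  have "vertical n t \<in> {0}"
  proof (rule linear_map_span_tensor_spaces[OF vector_space_tscale linear_vertical _ _ assms[unfolded positive_base_forms_def]])
    fix i \<omega> \<gamma> assume i: "i \<in> {..<n}" "\<omega> \<in> \<Omega>B (n - i)" "\<gamma> \<in> \<Omega>H i"
    have "component \<Omega>H n \<gamma> = 0" using component_homogeneous[OF i(3), of n] i(1) by simp
    then show "vertical n (\<omega> \<otimes>\<^sub>B \<gamma>) \<in> {0}"
      using linear_map_zero[OF vector_space_sH vector_space_tscale subspace_UNIV linear_vertical_tensor_right]
      by (simp add: vertical_pure)
  qed simp
  then show ?thesis by simp
qed

text \<open>
  On \<open>(B \<otimes> H) \<otimes> coinvariants n\<close> this inverts the restriction of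
  \<open>vertical n\<close> to \<open>B \<otimes> \<Omega>H n\<close>.
\<close>

definition recombine :: "(('b, 'h, 'k) tensor, 'h, 'k) tensor \<Rightarrow> ('b, 'h, 'k) tensor" where
  "recombine = CU.lift (\<lambda>t \<gamma>. BH.lift (\<lambda>b h. b \<otimes>\<^sub>B (h * \<gamma>)) t)"

lemma bilin_recombine: "CU.bilin tscale (\<lambda>t \<gamma>. BH.lift (\<lambda>b h. b \<otimes>\<^sub>B (h * \<gamma>)) t)"
proof -
  have b: "BH.bilin tscale (\<lambda>b h. b \<otimes>\<^sub>B (h * \<gamma>))" for \<gamma>
    by (auto intro!: vertical_intros)
  show ?thesis
  proof (rule bilinear_mapI)
    show "linear_map sH tscale UNIV UNIV (\<lambda>\<gamma>. BH.lift (\<lambda>b h. b \<otimes>\<^sub>B (h * \<gamma>)) t)"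
      if "t \<in> BH.space" for t
      by (rule BH.lift_linear_param[OF that vector_space_tscale vector_space_sH subspace_UNIV b])
        (auto intro!: vertical_intros)
    show "linear_map tscale tscale BH.space UNIV (\<lambda>t. BH.lift (\<lambda>b h. b \<otimes>\<^sub>B (h * \<gamma>)) t)" for \<gamma>
      by (rule BH.lift_linear[OF vector_space_tscale b])
  qed
qed

lemma linear_recombine: "linear_map tscale tscale CU.space UNIV recombine"
  unfolding recombine_def by (rule CU.lift_linear[OF vector_space_tscale bilin_recombine])

lemma recombine_pure:
  assumes "b \<in> B" "h \<in> H"
  shows "recombine (tensor tscale sH (b \<otimes>\<^sub>B h) \<gamma>) = b \<otimes>\<^sub>B (h * \<gamma>)"
proof -
  have b: "BH.bilin tscale (\<lambda>b h. b \<otimes>\<^sub>B (h * \<gamma>))"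
    by (auto intro!: vertical_intros)
  have "recombine (tensor tscale sH (b \<otimes>\<^sub>B h) \<gamma>) = BH.lift (\<lambda>b h. b \<otimes>\<^sub>B (h * \<gamma>)) (b \<otimes>\<^sub>B h)"
    unfolding recombine_def
    by (rule CU.lift_pure[OF vector_space_tscale bilin_recombine]) (auto intro!: tensor_in assms)
  also have "\<dots> = b \<otimes>\<^sub>B (h * \<gamma>)" by (rule BH.lift_pure[OF vector_space_tscale b assms])
  finally show ?thesis .
qed

lemma vertical_tensor_in_CU: "b \<in> B \<Longrightarrow> vertical_tensor b \<gamma> \<in> CU.space"
  unfolding vertical_tensor_def cosweedler2_def
  by (rule HU.lift_in[OF coaction_in vector_space_tscale bilin_vertical_tensor_arg subspace_tensor_space])
    (auto intro!: tensor_in)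

lemma recombine_vertical_tensor:
  assumes "b \<in> B" shows "recombine (vertical_tensor b \<gamma>) = b \<otimes>\<^sub>B \<gamma>"
proof -
  have "recombine (vertical_tensor b \<gamma>) =
      cosweedler2 (\<lambda>x y. recombine (tensor tscale sH (b \<otimes>\<^sub>B x) (coinv_proj y))) \<gamma>"
    unfolding vertical_tensor_def
    by (rule cosweedler2_push[OF vector_space_tscale vector_space_tscale linear_recombine
          subspace_tensor_space bilin_vertical_tensor_arg])
      (auto intro!: tensor_in assms)
  also have "\<dots> = cosweedler2 (\<lambda>x y. b \<otimes>\<^sub>B (x * coinv_proj y)) \<gamma>"
    by (rule cosweedler2_cong) (simp add: recombine_pure assms)
  also have "\<dots> = b \<otimes>\<^sub>B cosweedler2 (\<lambda>x y. x * coinv_proj y) \<gamma>"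
    by (rule cosweedler2_push[symmetric, OF vector_space_sH vector_space_tscale _ subspace_UNIV])
      (auto intro!: vertical_intros)
  finally show ?thesis by (simp add: coaction_times_coinv_proj)
qed

lemma recombine_vertical:
  assumes "t \<in> TU.space"
  shows "recombine (vertical n t) = TU.lift (\<lambda>b \<gamma>. component \<Omega>B 0 b \<otimes>\<^sub>B component \<Omega>H n \<gamma>) t"
proof -
  have "recombine (vertical n t) =
      TU.lift (\<lambda>b \<gamma>. recombine (vertical_tensor (component \<Omega>B 0 b) (component \<Omega>H n \<gamma>))) t"
    unfolding vertical_eq
    by (rule TU.lift_push[OF assms vector_space_tscale vector_space_tscale bilin_vertical
          linear_recombine subspace_tensor_space]) (rule vertical_tensor_in_CU[OF B.component_0_in])
  also have "\<dots> = TU.lift (\<lambda>b \<gamma>. component \<Omega>B 0 b \<otimes>\<^sub>B component \<Omega>H n \<gamma>) t"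
    by (rule TU.lift_cong) (rule recombine_vertical_tensor[OF B.component_0_in])
  finally show ?thesis .
qed

text \<open>
  By \<open>recombine_vertical\<close> the composite is the projection of \<open>crossed_forms n\<close> to \<open>B \<otimes> \<Omega>H n\<close>, and
  \<open>positive_base_forms n\<close> is the complementary summand. Hence a form killed by \<open>vertical n\<close> lies in
  \<open>positive_base_forms n\<close>.
\<close>

lemma recombine_vertical_congruent:
  assumes "t \<in> crossed_forms n"
  shows "t + tscale (- 1) (recombine (vertical n t)) \<in> positive_base_forms n"
proof -
  let ?P = "TU.lift (\<lambda>b \<gamma>. component \<Omega>B 0 b \<otimes>\<^sub>B component \<Omega>H n \<gamma>)"
  have bil: "TU.bilin tscale (\<lambda>b \<gamma>. component \<Omega>B 0 b \<otimes>\<^sub>B component \<Omega>H n \<gamma>)"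
    by (rule bilinear_mapI)
      (auto intro!: linear_tensor_left linear_tensor_right B.linear_component_0
        linear_map_subset[OF linear_component])
  have "t + tscale (- 1) (?P t) \<in> positive_base_forms n"
  proof (rule linear_map_span_tensor_spaces[where L = "\<lambda>t. t + tscale (- 1) (?P t)", OF vector_space_tscale _
        subspace_positive_base_forms _ assms[unfolded crossed_forms_def tensor_degree_def]])
    show "linear_map tscale tscale TU.space UNIV (\<lambda>t. t + tscale (- 1) (?P t))"
      by (intro linear_map_add linear_map_scale vector_space_tscale linear_map_ident
          TU.lift_linear[OF vector_space_tscale bil])
    fix i \<omega> \<gamma> assume i: "i \<in> {..n}" "\<omega> \<in> \<Omega>B (n - i)" "\<gamma> \<in> \<Omega>H i"
    have P: "?P (\<omega> \<otimes>\<^sub>B \<gamma>) = component \<Omega>B 0 \<omega> \<otimes>\<^sub>B component \<Omega>H n \<gamma>"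
      by (rule TU.lift_pure[OF vector_space_tscale bil]) auto
    show "\<omega> \<otimes>\<^sub>B \<gamma> + tscale (- 1) (?P (\<omega> \<otimes>\<^sub>B \<gamma>)) \<in> positive_base_forms n"
    proof (cases "i = n")
      case True
      then have "?P (\<omega> \<otimes>\<^sub>B \<gamma>) = \<omega> \<otimes>\<^sub>B \<gamma>"
        unfolding P using B.component_homogeneous[OF i(2), of 0] component_homogeneous[OF i(3), of n] by simp
      then have "\<omega> \<otimes>\<^sub>B \<gamma> + tscale (- 1) (?P (\<omega> \<otimes>\<^sub>B \<gamma>)) = 0"
        by (simp only: tens.scale_minus_left tens.scale_one right_minus)
      then show ?thesis by (simp only: tens.subspace_0[OF subspace_positive_base_forms])
    next
      case False
      then have "?P (\<omega> \<otimes>\<^sub>B \<gamma>) = 0"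
        unfolding P using component_homogeneous[OF i(3), of n] by (simp add: TU.pure_zero_right)
      then have "\<omega> \<otimes>\<^sub>B \<gamma> + tscale (- 1) (?P (\<omega> \<otimes>\<^sub>B \<gamma>)) = \<omega> \<otimes>\<^sub>B \<gamma>"
        by (simp only: tens.scale_zero_right add_0_right)
      moreover have "\<omega> \<otimes>\<^sub>B \<gamma> \<in> positive_base_forms n"
        unfolding positive_base_forms_def
        by (intro tens.span_base) (use i False in \<open>auto intro!: tensor_in\<close>)
      ultimately show ?thesis by simp
    qed
  qed
  then show ?thesis using recombine_vertical[of t n] assms crossed_forms_subset[of n] by auto
qed

text \<open>
  For coinvariant \<open>\<gamma>\<close> the coaction of \<open>h\<gamma>\<close> is \<open>h\<^sub>1 \<otimes> h\<^sub>2\<gamma>\<close>, and \<open>\<pi>(h\<^sub>2\<gamma>) = S(h\<^sub>2) h\<^sub>3 \<gamma> = \<epsilon>(h\<^sub>2) \<gamma>\<close>. So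
  \<open>b \<otimes> h\<gamma>\<close> is a preimage of \<open>(b \<otimes> h) \<otimes> \<gamma>\<close> under the vertical map.
\<close>

lemma vertical_tensor_times_coinvariant:
  assumes "b \<in> B" "h \<in> H" "\<gamma> \<in> coinvariants n"
  shows "vertical_tensor b (h * \<gamma>) = tensor tscale sH (b \<otimes>\<^sub>B h) \<gamma>"
proof -
  have "vertical_tensor b (h * \<gamma>) = sweedler2 (\<lambda>x y. tensor tscale sH (b \<otimes>\<^sub>B x) (coinv_proj (y * \<gamma>))) h"
    unfolding vertical_tensor_def
    by (rule cosweedler2_times_coinvariant[OF vector_space_tscale bilin_vertical_tensor_arg assms(2,3)])
  also have "\<dots> = sweedler2 (\<lambda>x y. tensor tscale sH (b \<otimes>\<^sub>B sH (\<epsilon> y) x) \<gamma>) h"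
    by (rule sweedler2_cong)
      (simp add: coinv_proj_times_coinvariant[OF _ assms(3)] CU.pure_scale_left CU.pure_scale_right TU.pure_scale_right)
  also have "\<dots> = tensor tscale sH (b \<otimes>\<^sub>B sweedler2 (\<lambda>x y. sH (\<epsilon> y) x) h) \<gamma>"
    by (rule sweedler2_push[symmetric, OF vector_space_sH vector_space_tscale _ subspace_UNIV _ _ assms(2)])
      (auto intro!: vertical_intros)
  finally show ?thesis by (simp add: counit_right assms(2))
qed

lemma vertical_surj: "vertical_target n \<subseteq> vertical n ` crossed_forms n"
proof -
  let ?I = "vertical n ` crossed_forms n"
  have I: "tens.subspace ?I"
    by (rule linear_map_image_subspace[OF vector_space_tscale vector_space_tscale subspace_crossed_forms
          linear_map_subset[OF linear_vertical crossed_forms_subset subset_refl]])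
  have "tensor tscale sH t \<gamma> \<in> ?I" if t: "t \<in> crossed_space" and \<gamma>: "\<gamma> \<in> coinvariants n" for t \<gamma>
  proof (rule linear_map_span_in[OF vector_space_tscale vector_space_tscale tens.subspace_UNIV
        linear_tensor_left[OF linear_map_ident] subset_UNIV I])
    show "t \<in> tens.span {b \<otimes>\<^sub>B h | b h. b \<in> B \<and> h \<in> H}"
      using t unfolding crossed_space_def tensor_space_def .
    fix x assume "x \<in> {b \<otimes>\<^sub>B h | b h. b \<in> B \<and> h \<in> H}"
    then obtain b h where x: "x = b \<otimes>\<^sub>B h" "b \<in> B" "h \<in> H" by blast
    have g: "h * \<gamma> \<in> \<Omega>H n"
      using degree_mult[of h 0 \<gamma> n] x(3) \<gamma> by (simp add: degree_0 coinvariants_def)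
    have "vertical n (b \<otimes>\<^sub>B (h * \<gamma>)) = tensor tscale sH x \<gamma>"
      using component_homogeneous[OF g, of n] B.component_0_algebra[OF x(2)]
      by (simp add: vertical_pure x(1) vertical_tensor_times_coinvariant[OF x(2,3) \<gamma>])
    moreover have "b \<otimes>\<^sub>B (h * \<gamma>) \<in> crossed_forms n"
      by (rule tensor_in_crossed_forms[OF _ g]) (use x(2) in \<open>auto simp: B.degree_0\<close>)
    ultimately show "tensor tscale sH x \<gamma> \<in> ?I" by (metis imageI)
  qed
  then show ?thesis
    unfolding vertical_target_def tensor_space_def[of tscale sH]
    by (intro tens.span_minimal[OF _ I]) auto
qed

subsection \<open>Exactness\<close>

lemma vertical_exact:
  assumes "n > 0"
  shows "short_exact tscale tscale tscale (base_ideal n) id (crossed_forms n) (vertical n) (vertical_target n)"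
  unfolding short_exact_def base_ideal_eq[OF assms]
proof (intro conjI)
  show "tens.subspace (positive_base_forms n)" by (rule subspace_positive_base_forms)
  show "tens.subspace (crossed_forms n)" by (rule subspace_crossed_forms)
  show "tens.subspace (vertical_target n)" unfolding vertical_target_def by (rule subspace_tensor_space)
  show "linear_map tscale tscale (positive_base_forms n) (crossed_forms n) id"
    using positive_base_forms_subset by (auto simp: linear_map_def)
  show "linear_map tscale tscale (crossed_forms n) (vertical_target n) (vertical n)"
    by (rule linear_map_codomain[OF linear_map_subset[OF linear_vertical crossed_forms_subset subset_refl]])
      (use vertical_in crossed_forms_subset in blast)
  show "inj_on id (positive_base_forms n)" by simp
  show "id ` positive_base_forms n = {t \<in> crossed_forms n. vertical n t = 0}"
  proof (intro set_eqI iffI)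
    fix t assume "t \<in> id ` positive_base_forms n"
    then show "t \<in> {t \<in> crossed_forms n. vertical n t = 0}"
      using positive_base_forms_subset vertical_positive_base_forms by auto
  next
    fix t assume "t \<in> {t \<in> crossed_forms n. vertical n t = 0}"
    then have t: "t \<in> crossed_forms n" "vertical n t = 0" by auto
    have "recombine 0 = 0"
      by (rule linear_map_zero[OF vector_space_tscale vector_space_tscale subspace_tensor_space linear_recombine])
    then have "t + tscale (- 1) 0 \<in> positive_base_forms n"
      using recombine_vertical_congruent[OF t(1)] t(2) by simp
    then show "t \<in> id ` positive_base_forms n" by (simp only: tens.scale_zero_right add_0_right image_id id_apply)
  qed
  show "vertical n ` crossed_forms n = vertical_target n"
    using vertical_surj vertical_in crossed_forms_subset by blast
qed

end

theorem proposition3p22: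
  fixes sH :: "'k::field \<Rightarrow> 'h::{ring, monoid_mult} \<Rightarrow> 'h"
    and sB :: "'k \<Rightarrow> 'b::{ring, monoid_mult} \<Rightarrow> 'b"
    and H :: "'h set" and \<Delta> :: "'h \<Rightarrow> ('h, 'h, 'k) tensor" and \<epsilon> :: "'h \<Rightarrow> 'k" and S :: "'h \<Rightarrow> 'h"
    and \<Omega>H :: "nat \<Rightarrow> 'h set" and dH :: "'h \<Rightarrow> 'h"
    and B :: "'b set" and act :: "'h \<Rightarrow> 'b \<Rightarrow> 'b" and \<sigma> \<sigma>' :: "'h \<Rightarrow> 'h \<Rightarrow> 'b"
    and \<Omega>B :: "nat \<Rightarrow> 'b set" and dB :: "'b \<Rightarrow> 'b"
    and n :: nat
  assumes "hopf_algebra sH H \<Delta> \<epsilon> S"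
    and "bij_betw S H H"
    and "twisted_module_algebra sH H \<Delta> \<epsilon> S sB B act \<sigma> \<sigma>'"
    and "twisted_module_calculus sH H \<Delta> \<epsilon> S sB B act \<sigma> \<sigma>' \<Omega>B dB"
    and "differential_calculus sH H \<Omega>H dH"
    and "coproduct_forms.coproduct_differentiable sH H \<Delta> \<Omega>H dH"
    and "n > 0"
  shows "short_exact tscale tscale tscale
    (crossed_product.base_ideal sH H \<Delta> \<Omega>H dH sB \<Omega>B act \<sigma> n)
    id
    (crossed_product.crossed_forms sH \<Omega>H sB \<Omega>B n)
    (crossed_product.vertical sH H \<Delta> \<Omega>H dH S sB \<Omega>B n)
    (crossed_product.vertical_target sH H \<Delta> \<Omega>H dH sB B n)"
proof -
  interpret crossed_calculus sH H \<Delta> \<epsilon> S \<Omega>H dH sB B act \<sigma> \<sigma>' \<Omega>B dB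
    by (intro crossed_calculus.intro covariant_calculus.intro covariant_calculus_axioms.intro assms)
  show ?thesis by (rule vertical_exact[OF assms(7)])
qed

end
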